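(* Let $\Omega\subset\mathbb{R}^N$ be a bounded regular domain with $B_{1/2}\Subset\Omega$, $\lambda_0:\Omega\to(0,\infty)$ a function bounded away from zero and from infinity, $g:\partial\Omega\to\mathbb{R}$ Lipschitz, and let $u_\infty$ be a uniform limit, along some sequence $p\to\infty$, of weak solutions $u_p$ to $$-\Delta_p u_p+\lambda_0(x)\chi_{\{u_p>0\}}(x)=0\ \text{ in }\Omega,\qquad u_p=g\ \text{ on }\partial\Omega.$$ Then there exists a constant $0<\xi=\xi(N,\mathrm{Lip}[g])\le1$, depending only on $N$ and the Lipschitz constant of $g$, such that $$\mathcal{H}^{N-\xi}\left(\partial\{u_\infty>0\}\cap B_{\frac12}\right)<\infty.$$
   Context: $\Delta_p u=\operatorname{div}(|\nabla u|^{p-2}\nabla u)$; $\mathcal{H}^s$ is $s$-dimensional Hausdorff measure; $B_{1/2}$ is the ball of radius $1/2$ centred at the origin. "Regular domain" means a domain with smooth boundary. A weak solution $u_p\in W^{1,p}(\Omega)$ satisfies $\int_\Omega|\nabla u_p|^{p-2}\nabla u_p\cdot\nabla\varphi\,dx=-\int_\Omega\lambda_0\chi_{\{u_p>0\}}\varphi\,dx$ for all $\varphi\in C^1_0(\Omega)$ and takes the boundary value $g$. *)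

theory Defs
  imports "HOL-Analysis.Analysis"
begin

section \<open>Hausdorff measure\<close>

text \<open>
  The weight \<open>\<alpha>(s) (diam E / 2)\<^sup>s\<close> of a covering set, where \<open>\<alpha>(s) = \<pi>\<^bsup>s/2\<^esup> / \<Gamma>(s/2 + 1)\<close>.
  The case \<open>s = 0\<close> is separate because \<open>0 powr 0 = 0\<close> in the library, whereas a singleton has
  weight 1 for the counting measure.
\<close>
definition hausdorff_weight :: "real \<Rightarrow> 'a::metric_space set \<Rightarrow> real" where
  "hausdorff_weight s E =
     (if E = {} then 0 else if s = 0 then 1 else unit_ball_vol s * (diameter E / 2) powr s)"

text \<open>Boundedness of the covering sets is explicit since \<^const>\<open>diameter\<close> is unspecified on
  unbounded sets.\<close>
definition hausdorff_premeasure :: "real \<Rightarrow> real \<Rightarrow> 'a::metric_space set \<Rightarrow> ennreal" where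
  "hausdorff_premeasure \<delta> s A =
     Inf {(\<Sum>i. ennreal (hausdorff_weight s (E i))) | E :: nat \<Rightarrow> 'a set.
            A \<subseteq> (\<Union>i. E i) \<and> (\<forall>i. bounded (E i) \<and> diameter (E i) \<le> \<delta>)}"

definition hausdorff_measure :: "real \<Rightarrow> 'a::metric_space set \<Rightarrow> ennreal" where
  "hausdorff_measure s A = (SUP \<delta>\<in>{0<..}. hausdorff_premeasure \<delta> s A)"

section \<open>Differentiable functions and regular domains\<close>

text \<open>\<open>Ck_on k S f\<close>: \<open>f\<close> is of class \<open>C\<^sup>k\<close> on the set \<open>S\<close>, which is meant to be open.\<close>
primrec Ck_on :: "nat \<Rightarrow> 'a::euclidean_space set \<Rightarrow> ('a \<Rightarrow> real) \<Rightarrow> bool" where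
  "Ck_on 0 S f \<longleftrightarrow> continuous_on S f"
| "Ck_on (Suc k) S f \<longleftrightarrow>
     (\<forall>x\<in>S. f differentiable (at x)) \<and>
     (\<forall>v. Ck_on k S (\<lambda>x. frechet_derivative f (at x) v))"

definition smooth_on :: "'a::euclidean_space set \<Rightarrow> ('a \<Rightarrow> real) \<Rightarrow> bool" where
  "smooth_on S f \<longleftrightarrow> (\<forall>k. Ck_on k S f)"

definition gradient :: "('a::euclidean_space \<Rightarrow> real) \<Rightarrow> 'a \<Rightarrow> 'a" where
  "gradient f x = (\<Sum>b\<in>Basis. frechet_derivative f (at x) b *\<^sub>R b)"

text \<open>
  Near each boundary point the set is, in suitable orthonormal coordinates with last axis \<open>e\<close>,
  the strict epigraph of a smooth function of the remaining coordinates.  Smooth functions on the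
  hyperplane orthogonal to \<open>e\<close> are represented by smooth functions \<open>\<gamma>\<close> on the whole space that
  are only evaluated on that hyperplane.
\<close>
definition smooth_boundary :: "'a::euclidean_space set \<Rightarrow> bool" where
  "smooth_boundary \<Omega> \<longleftrightarrow>
     (\<forall>x0\<in>frontier \<Omega>. \<exists>r>0. \<exists>e \<gamma>. norm e = 1 \<and> smooth_on UNIV \<gamma> \<and>
        \<Omega> \<inter> ball x0 r = {x \<in> ball x0 r. x \<bullet> e > \<gamma> (x - (x \<bullet> e) *\<^sub>R e)})"

definition regular_domain :: "'a::euclidean_space set \<Rightarrow> bool" where
  "regular_domain \<Omega> \<longleftrightarrow> open \<Omega> \<and> connected \<Omega> \<and> \<Omega> \<noteq> {} \<and> smooth_boundary \<Omega>"

text \<open>The least Lipschitz constant; only meaningful for functions that are Lipschitz on \<open>S\<close>.\<close>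
definition Lip :: "'a::metric_space set \<Rightarrow> ('a \<Rightarrow> 'b::metric_space) \<Rightarrow> real" where
  "Lip S g = Inf {C. C-lipschitz_on S g}"

section \<open>Sobolev spaces\<close>

definition compactly_supported_in :: "'a::euclidean_space set \<Rightarrow> ('a \<Rightarrow> real) \<Rightarrow> bool" where
  "compactly_supported_in \<Omega> \<phi> \<longleftrightarrow>
     compact (closure {x. \<phi> x \<noteq> 0}) \<and> closure {x. \<phi> x \<noteq> 0} \<subseteq> \<Omega>"

definition C1_0 :: "'a::euclidean_space set \<Rightarrow> ('a \<Rightarrow> real) set" where
  "C1_0 \<Omega> = {\<phi>. Ck_on 1 UNIV \<phi> \<and> compactly_supported_in \<Omega> \<phi>}"

definition Cinf_0 :: "'a::euclidean_space set \<Rightarrow> ('a \<Rightarrow> real) set" where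
  "Cinf_0 \<Omega> = {\<phi>. smooth_on UNIV \<phi> \<and> compactly_supported_in \<Omega> \<phi>}"

definition Lp_on ::
  "real \<Rightarrow> 'a::euclidean_space set \<Rightarrow> ('a \<Rightarrow> 'b::euclidean_space) \<Rightarrow> bool" where
  "Lp_on p \<Omega> f \<longleftrightarrow>
     set_borel_measurable lebesgue \<Omega> f \<and> set_integrable lebesgue \<Omega> (\<lambda>x. norm (f x) powr p)"

text \<open>\<open>W1p_grad p \<Omega> u G\<close>: \<open>u\<close> belongs to \<open>W\<^bsup>1,p\<^esup>(\<Omega>)\<close> and \<open>G\<close> is its weak gradient.\<close>
definition W1p_grad ::
  "real \<Rightarrow> 'a::euclidean_space set \<Rightarrow> ('a \<Rightarrow> real) \<Rightarrow> ('a \<Rightarrow> 'a) \<Rightarrow> bool" where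
  "W1p_grad p \<Omega> u G \<longleftrightarrow> Lp_on p \<Omega> u \<and> Lp_on p \<Omega> G \<and>
     (\<forall>\<phi>\<in>Cinf_0 \<Omega>. \<forall>b\<in>Basis.
        (LINT x:\<Omega>|lebesgue. u x * (gradient \<phi> x \<bullet> b)) =
        - (LINT x:\<Omega>|lebesgue. (G x \<bullet> b) * \<phi> x))"

text \<open>\<open>W\<^bsup>1,p\<^esup>\<^sub>0(\<Omega>)\<close>, the closure of the test functions in \<open>W\<^bsup>1,p\<^esup>(\<Omega>)\<close>.\<close>
definition W1p_0 :: "real \<Rightarrow> 'a::euclidean_space set \<Rightarrow> ('a \<Rightarrow> real) set" where
  "W1p_0 p \<Omega> = {w. \<exists>G. W1p_grad p \<Omega> w G \<and>
     (\<exists>\<phi>::nat \<Rightarrow> 'a \<Rightarrow> real. (\<forall>n. \<phi> n \<in> Cinf_0 \<Omega>) \<and>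
        (\<lambda>n. LINT x:\<Omega>|lebesgue. \<bar>w x - \<phi> n x\<bar> powr p) \<longlonglongrightarrow> 0 \<and>
        (\<lambda>n. LINT x:\<Omega>|lebesgue. norm (G x - gradient (\<phi> n) x) powr p) \<longlonglongrightarrow> 0)}"

text \<open>Boundary values in the Sobolev sense; the choice of the Lipschitz extension of \<open>g\<close> does not
  matter, as Lipschitz functions vanishing on the boundary belong to \<^const>\<open>W1p_0\<close>.\<close>
definition has_boundary_value ::
  "real \<Rightarrow> 'a::euclidean_space set \<Rightarrow> ('a \<Rightarrow> real) \<Rightarrow> ('a \<Rightarrow> real) \<Rightarrow> bool" where
  "has_boundary_value p \<Omega> u g \<longleftrightarrow>
     (\<exists>h. (\<exists>C. C-lipschitz_on (closure \<Omega>) h) \<and> (\<forall>x\<in>frontier \<Omega>. h x = g x) \<and>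
          (\<lambda>x. u x - h x) \<in> W1p_0 p \<Omega>)"

section \<open>The dead core problem\<close>

text \<open>Weak solutions of \<open>-\<Delta>\<^sub>p u + \<lambda> \<chi>\<^bsub>{u>0}\<^esub> = 0\<close> in \<open>\<Omega>\<close>, \<open>u = g\<close> on \<open>\<partial>\<Omega>\<close>.\<close>
definition weak_solution ::
  "real \<Rightarrow> 'a::euclidean_space set \<Rightarrow> ('a \<Rightarrow> real) \<Rightarrow> ('a \<Rightarrow> real) \<Rightarrow> ('a \<Rightarrow> real) \<Rightarrow> bool" where
  "weak_solution p \<Omega> lam g u \<longleftrightarrow>
     (\<exists>G. W1p_grad p \<Omega> u G \<and>
        (\<forall>\<phi>\<in>C1_0 \<Omega>.
           (LINT x:\<Omega>|lebesgue. (norm (G x) powr (p - 2) *\<^sub>R G x) \<bullet> gradient \<phi> x) =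
           - (LINT x:\<Omega>|lebesgue. lam x * indicator {y. u y > 0} x * \<phi> x))) \<and>
     has_boundary_value p \<Omega> u g"

end

(*
  Testing with truncations of u_p - f, where f is C^1, |grad f| <= Lip g and f is close to g on the
  boundary, bounds the L^p norm of grad u_p wherever |u_p - f| is not small; by Young's inequality the
  constants involving lambda disappear as p -> oo, so u_oo is Lipschitz near B_(1/2) with a constant
  K(N, Lip g).  On the other hand c |x - y|^(p/(p-1)), whose p-Laplacian is a constant below lambda,
  is a barrier, and comparison gives sup u_oo >= r/2 over B_r(y) whenever u_oo(y) > 0.  Together, every
  ball of small radius r around a free boundary point contains a ball of radius r/(8K) inside
  {u_oo > 0}.  Hence the free boundary is porous: subdividing a cube into M^N subcubes, with M
  depending only on N and K, at least one of them misses it, and H^s is finite for M^s = M^N - 1.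

  A weak solution is the strong limit of v_i = phi_i + h_i, with
  phi_i test functions and h_i mollifications of a Lipschitz extension h of g; since
  v_i = h_i near the boundary, C^1 functions of v_i - f are admissible test functions as soon as
  they vanish near the boundary values of h - f.
*)
theory Submission
  imports Defs "HOL-Computational_Algebra.Polynomial" "HOL-Real_Asymp.Real_Asymp"
begin

section \<open>C^1 calculus with explicit gradients, and integration by parts on the whole
  space\<close>

section \<open>Continuously differentiable functions\<close>

text \<open>Nonlinear functions of u_p are needed as test functions, while u_p is known only through
  weak derivatives. All compositions are therefore formed on C^1 approximants, and one limit
  passage, in L^1 with weight 1 + |grad u_p|^(p-1), transfers the identity. With other vector fields
  in place of the p-flux, the same identity serves as the chain rule for u_p and as the equation of
  the barrier.

  The constants decide the result. The energy bound has the form |Omega| (Lip^p + p M / delta),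
  where M bounds lambda: its only exponential growth in p is Lip^p. Division by (2 (Lip + 1))^p
  leaves terms of order p 2^(-p), so M and |Omega| vanish as p -> oo with delta fixed, and delta ->
  0 comes afterwards. Likewise the barrier depends on lambda only through a power 1/(p-1), which
  tends to 1. What survives is a bound 3 Lip + 2 on each partial derivative of u_oo - h, with h a
  Lipschitz extension of g. Summing over coordinates and adding h back gives K(N, Lip) = N (3 Lip +
  2) + Lip.\<close>

definition C1_grad :: "'a::euclidean_space set \<Rightarrow> ('a \<Rightarrow> real) \<Rightarrow> ('a \<Rightarrow> 'a) \<Rightarrow> bool" where
  "C1_grad S f F \<longleftrightarrow> (\<forall>x\<in>S. (f has_derivative (\<lambda>v. F x \<bullet> v)) (at x)) \<and> continuous_on S F"

lemma C1_gradD: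
  "C1_grad S f F \<Longrightarrow> x \<in> S \<Longrightarrow> (f has_derivative (\<lambda>v. F x \<bullet> v)) (at x)"
  "C1_grad S f F \<Longrightarrow> continuous_on S F"
  by (auto simp: C1_grad_def)

lemma C1_grad_continuous: "C1_grad S f F \<Longrightarrow> continuous_on S f"
  unfolding C1_grad_def
  by (meson continuous_at_imp_continuous_on has_derivative_continuous)

lemma C1_grad_subset: "C1_grad S f F \<Longrightarrow> T \<subseteq> S \<Longrightarrow> C1_grad T f F"
  unfolding C1_grad_def using continuous_on_subset by blast

lemma gradient_eqI:
  assumes "(f has_derivative (\<lambda>v. w \<bullet> v)) (at x)"
  shows "gradient f x = w"
proof -
  have "frechet_derivative f (at x) = (\<lambda>v. w \<bullet> v)"
    using frechet_derivative_at[OF assms] by simp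
  then show ?thesis
    unfolding gradient_def by (simp add: euclidean_representation)
qed

lemma C1_grad_gradient: "C1_grad S f F \<Longrightarrow> x \<in> S \<Longrightarrow> gradient f x = F x"
  by (blast intro: gradient_eqI C1_gradD(1))

text \<open>\<open>Ck_on\<close> speaks of directional derivatives one at a time. By linearity all
  of them are combinations of those along \<open>Basis\<close>, so continuity of each amounts to
  continuity of the gradient vector.\<close>

lemma Ck_on_1_iff_C1_grad: "Ck_on 1 S f \<longleftrightarrow> C1_grad S f (gradient f)"
proof
  assume L: "Ck_on 1 S f"
  then have d: "\<And>x. x \<in> S \<Longrightarrow> f differentiable (at x)"
    and c: "\<And>v. continuous_on S (\<lambda>x. frechet_derivative f (at x) v)" by auto
  have "(f has_derivative (\<lambda>v. gradient f x \<bullet> v)) (at x)" if "x \<in> S" for x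
  proof -
    have hd: "(f has_derivative frechet_derivative f (at x)) (at x)"
      using d[OF that] frechet_derivative_works by blast
    then interpret linear "frechet_derivative f (at x)"
      using has_derivative_linear by blast
    have "frechet_derivative f (at x) v = gradient f x \<bullet> v" for v
    proof -
      have "frechet_derivative f (at x) v = frechet_derivative f (at x) (\<Sum>b\<in>Basis. (v \<bullet> b) *\<^sub>R b)"
        by (simp add: euclidean_representation)
      also have "\<dots> = (\<Sum>b\<in>Basis. (v \<bullet> b) * frechet_derivative f (at x) b)"
        by (simp add: sum scaleR)
      also have "\<dots> = gradient f x \<bullet> v"
        unfolding gradient_def by (simp add: inner_sum_left inner_commute[of v] mult.commute)
      finally show ?thesis .
    qed
    then show ?thesis using hd by presburger
  qed
  moreover have "continuous_on S (gradient f)"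
    unfolding gradient_def using c by (intro continuous_intros)
  ultimately show "C1_grad S f (gradient f)" unfolding C1_grad_def by blast
next
  assume R: "C1_grad S f (gradient f)"
  have fd: "frechet_derivative f (at x) v = gradient f x \<bullet> v" if "x \<in> S" for x v
    using fun_cong[OF frechet_derivative_at[OF C1_gradD(1)[OF R that]], of v] by simp
  have "continuous_on S (\<lambda>x. frechet_derivative f (at x) v)" for v
    using C1_gradD(2)[OF R] fd by (simp add: continuous_on_inner continuous_on_const cong: continuous_on_cong)
  then show "Ck_on 1 S f"
    using C1_gradD(1)[OF R] by (auto simp: differentiable_def)
qed

lemma C1_grad_Ck_on: "C1_grad S f F \<Longrightarrow> Ck_on 1 S f"
proof -
  assume a: "C1_grad S f F"
  then have "C1_grad S f (gradient f)"
    unfolding C1_grad_def using C1_grad_gradient[OF a] by (simp cong: continuous_on_cong)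
  then show ?thesis by (simp only: Ck_on_1_iff_C1_grad)
qed

lemma C1_grad_const: "C1_grad S (\<lambda>x. c) (\<lambda>x. 0)"
  by (auto simp: C1_grad_def)

lemma C1_grad_add:
  "C1_grad S f F \<Longrightarrow> C1_grad S g G \<Longrightarrow> C1_grad S (\<lambda>x. f x + g x) (\<lambda>x. F x + G x)"
  unfolding C1_grad_def by (auto intro!: derivative_eq_intros continuous_intros simp: inner_add_left)

lemma C1_grad_diff:
  "C1_grad S f F \<Longrightarrow> C1_grad S g G \<Longrightarrow> C1_grad S (\<lambda>x. f x - g x) (\<lambda>x. F x - G x)"
  unfolding C1_grad_def by (auto intro!: derivative_eq_intros continuous_intros simp: inner_diff_left)

lemma C1_grad_mult:
  assumes "C1_grad S f F" "C1_grad S g G"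
  shows "C1_grad S (\<lambda>x. f x * g x) (\<lambda>x. f x *\<^sub>R G x + g x *\<^sub>R F x)"
  using assms C1_grad_continuous[OF assms(1)] C1_grad_continuous[OF assms(2)]
  unfolding C1_grad_def
  by (auto intro!: derivative_eq_intros continuous_intros simp: inner_add_left)

lemma C1_grad_compose:
  assumes "C1_grad S f F" "\<And>t. (T has_real_derivative T' t) (at t)" "continuous_on UNIV T'"
  shows "C1_grad S (\<lambda>x. T (f x)) (\<lambda>x. T' (f x) *\<^sub>R F x)"
proof -
  have "continuous_on S (\<lambda>x. T' (f x))"
    using continuous_on_compose2[OF assms(3) C1_grad_continuous[OF assms(1)]] by auto
  moreover have "((\<lambda>x. T (f x)) has_derivative (\<lambda>v. (T' (f x) *\<^sub>R F x) \<bullet> v)) (at x)" if "x \<in> S" for x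
    using has_derivative_compose[OF C1_gradD(1)[OF assms(1) that] assms(2)[unfolded has_field_derivative_def]]
    by simp
  ultimately show ?thesis
    using C1_gradD(2)[OF assms(1)] unfolding C1_grad_def
    by (intro conjI ballI continuous_on_scaleR)
qed

lemma C1_grad_inner: "C1_grad S (\<lambda>x. (x - y) \<bullet> b) (\<lambda>x. b)"
  unfolding C1_grad_def by (auto intro!: derivative_eq_intros simp: inner_commute)

lemma C1_grad_norm_sq: "C1_grad S (\<lambda>x. (norm (x - y))\<^sup>2) (\<lambda>x. 2 *\<^sub>R (x - y))"
  unfolding C1_grad_def power2_norm_eq_inner
  by (auto intro!: derivative_eq_intros continuous_intros simp: inner_commute)

lemma C1_grad_zero_off:
  assumes "C1_grad UNIV f F" "closed K" "\<And>x. x \<notin> K \<Longrightarrow> f x = 0" "x \<notin> K"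
  shows "F x = 0"
proof -
  have "((\<lambda>x. 0::real) has_derivative (\<lambda>v. F x \<bullet> v)) (at x)"
  proof (rule has_derivative_transform_within_open)
    show "(f has_derivative (\<lambda>v. F x \<bullet> v)) (at x)" using C1_gradD(1)[OF assms(1)] by auto
    show "open (- K)" using assms by auto
  qed (use assms in auto)
  then have "(\<lambda>v. F x \<bullet> v) = (\<lambda>v. 0)"
    using has_derivative_unique[OF _ has_derivative_const] by metis
  then show ?thesis by (metis inner_eq_zero_iff)
qed

text \<open>The open sets \<Omega> and \<open>- K\<close> cover the space, and being C^1 is local;
  on the overlap the two derivatives agree, which forces \<open>F\<close> to vanish there. Functions
  that are C^1 only on \<Omega> become test functions on the whole space in this way.\<close>

lemma C1_grad_extend_zero:
  assumes "open \<Omega>" "compact K" "K \<subseteq> \<Omega>" "C1_grad \<Omega> f F" "\<And>x. x \<in> \<Omega> - K \<Longrightarrow> f x = 0"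
  shows "C1_grad UNIV (\<lambda>x. if x \<in> \<Omega> then f x else 0) (\<lambda>x. if x \<in> \<Omega> then F x else 0)"
    (is "C1_grad UNIV ?f ?F")
proof -
  have op: "open (- K)" using assms(2) by (simp add: compact_imp_closed open_Compl)
  have 1: "(?f has_derivative (\<lambda>v. F x \<bullet> v)) (at x)" if "x \<in> \<Omega>" for x
    by (rule has_derivative_transform_within_open[OF C1_gradD(1)[OF assms(4) that] assms(1) that]) auto
  have 2: "(?f has_derivative (\<lambda>v. 0)) (at x)" if "x \<in> - K" for x
    by (rule has_derivative_transform_within_open[OF has_derivative_const op that])
       (use assms in auto)
  have 0: "F x = 0" if "x \<in> \<Omega> - K" for x
  proof -
    have "(\<lambda>v. F x \<bullet> v) = (\<lambda>v. 0)"
      using has_derivative_unique[OF 1 2] that by auto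
    then show ?thesis by (metis inner_eq_zero_iff)
  qed
  have "(?f has_derivative (\<lambda>v. ?F x \<bullet> v)) (at x)" for x
    using 1[of x] 2[of x] assms(3) by (cases "x \<in> \<Omega>") auto
  moreover have "continuous_on (\<Omega> \<union> - K) ?F"
  proof (rule continuous_on_open_Un[OF assms(1) op])
    show "continuous_on \<Omega> ?F"
      using C1_gradD(2)[OF assms(4)] by (simp cong: continuous_on_cong)
    have "?F x = 0" if "x \<in> - K" for x
      using 0[of x] that by auto
    then show "continuous_on (- K) ?F"
      by (intro continuous_on_eq[OF continuous_on_const[of "- K" 0]]) auto
  qed
  moreover have "\<Omega> \<union> - K = UNIV" using assms(3) by auto
  ultimately show ?thesis unfolding C1_grad_def by simp
qed

lemma C1_0_I:
  assumes "C1_grad UNIV f F" "compact K" "K \<subseteq> \<Omega>" "\<And>x. x \<notin> K \<Longrightarrow> f x = 0"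
  shows "f \<in> C1_0 \<Omega>"
proof -
  have sub: "closure {x. f x \<noteq> 0} \<subseteq> K"
    using assms(2,4) by (intro closure_minimal) (auto simp: compact_imp_closed)
  then have "compact (closure {x. f x \<noteq> 0})"
    using assms(2) compact_imp_bounded[of K] bounded_subset[OF _ sub] compact_eq_bounded_closed by blast
  then show ?thesis
    unfolding C1_0_def compactly_supported_in_def using C1_grad_Ck_on[OF assms(1)] sub assms(3) by auto
qed

lemma C1_0_D:
  assumes "f \<in> C1_0 \<Omega>"
  shows "C1_grad UNIV f (gradient f)" "\<exists>K. compact K \<and> K \<subseteq> \<Omega> \<and> (\<forall>x. x \<notin> K \<longrightarrow> f x = 0)"
proof -
  show "C1_grad UNIV f (gradient f)"
    using assms unfolding C1_0_def Ck_on_1_iff_C1_grad by auto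
  show "\<exists>K. compact K \<and> K \<subseteq> \<Omega> \<and> (\<forall>x. x \<notin> K \<longrightarrow> f x = 0)"
    using assms closure_subset[of "{x. f x \<noteq> 0}"] unfolding C1_0_def compactly_supported_in_def
    by (intro exI[of _ "closure {x. f x \<noteq> 0}"]) auto
qed

lemma Cinf_0_subset_C1_0: "Cinf_0 \<Omega> \<subseteq> C1_0 \<Omega>"
  unfolding Cinf_0_def C1_0_def smooth_on_def by blast

lemma C1_compact_support_bounds:
  assumes "C1_grad UNIV f F" "compact K" "\<And>x. x \<notin> K \<Longrightarrow> f x = 0"
  obtains B where "B \<ge> 0" "\<And>x. \<bar>f x\<bar> \<le> B" "\<And>x. norm (F x) \<le> B"
proof -
  have "bounded (f ` K)" "bounded (F ` K)"
    using assms C1_grad_continuous[OF assms(1)] C1_gradD(2)[OF assms(1)]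
    by (auto intro!: compact_imp_bounded compact_continuous_image intro: continuous_on_subset)
  then obtain a b where ab: "\<And>x. x \<in> K \<Longrightarrow> norm (f x) \<le> a" "\<And>x. x \<in> K \<Longrightarrow> norm (F x) \<le> b"
    unfolding bounded_iff by auto
  have F0: "F x = 0" if "x \<notin> K" for x
    using C1_grad_zero_off[OF assms(1) compact_imp_closed[OF assms(2)] assms(3) that] .
  show ?thesis
  proof (rule that[of "max 0 (max a b)"])
    show "\<bar>f x\<bar> \<le> max 0 (max a b)" for x
      using ab(1)[of x] assms(3)[of x] by (cases "x \<in> K") auto
    show "norm (F x) \<le> max 0 (max a b)" for x
      using ab(2)[of x] F0[of x] by (cases "x \<in> K") auto
  qed simp
qed

lemma compact_supported_integrable:
  fixes f :: "'a::euclidean_space \<Rightarrow> 'b::euclidean_space"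
  assumes "continuous_on UNIV f" "compact K" "\<And>x. x \<notin> K \<Longrightarrow> f x = 0"
  shows "integrable lebesgue f"
proof -
  have "set_integrable lborel K f"
    unfolding set_integrable_def
    by (rule borel_integrable_compact[OF assms(2) continuous_on_subset[OF assms(1)]]) simp
  moreover have "(\<lambda>x. indicat_real K x *\<^sub>R f x) = f"
    using assms(3) by (auto simp: indicator_def)
  ultimately have "integrable lborel f"
    unfolding set_integrable_def by simp
  then show ?thesis
    using integrable_completion[of f lborel] by auto
qed

lemma mean_value_C1_grad:
  assumes "C1_grad S f F" "convex S" "x \<in> S" "y \<in> S" "\<And>z. z \<in> S \<Longrightarrow> norm (F z) \<le> B"
  shows "\<bar>f x - f y\<bar> \<le> B * norm (x - y)"
proof -
  have "norm (f x - f y) \<le> B * norm (x - y)"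
  proof (rule differentiable_bound[OF assms(2)])
    show "(f has_derivative (\<lambda>v. F z \<bullet> v)) (at z within S)" if "z \<in> S" for z
      using C1_gradD(1)[OF assms(1) that] has_derivative_at_withinI by blast
    show "onorm (\<lambda>v. F z \<bullet> v) \<le> B" if "z \<in> S" for z
    proof (rule onorm_le)
      show "norm (F z \<bullet> v) \<le> B * norm v" for v
        using Cauchy_Schwarz_ineq2[of "F z" v] assms(5)[OF that]
        by (metis mult_right_mono norm_ge_zero order_trans real_norm_def)
    qed
  qed (use assms in auto)
  then show ?thesis by simp
qed

lemma integral_lebesgue_translate:
  fixes f :: "'a::euclidean_space \<Rightarrow> real"
  assumes "continuous_on UNIV f"
  shows "(LINT x|lebesgue. f (x + a)) = (LINT x|lebesgue. f x)"
proof -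
  have m: "f \<in> borel_measurable borel"
    using assms by (rule borel_measurable_continuous_onI)
  then have m': "(\<lambda>x. f (x + a)) \<in> borel_measurable borel" by measurable
  have "(LINT x|lborel. f x) = (LINT x|distr lborel borel ((+) a). f x)"
    by (simp add: lborel_distr_plus)
  also have "\<dots> = (LINT x|lborel. f (a + x))"
    using m by (subst integral_distr) auto
  finally show ?thesis
    using m m' by (simp add: integral_completion add.commute)
qed

text \<open>By translation invariance every difference quotient in direction \<open>b\<close> has
  integral zero, and dominated convergence passes to the derivative. Neither iterated integrals nor
  boundary terms occur.\<close>

lemma integral_gradient_compact_support:
  fixes f :: "'a::euclidean_space \<Rightarrow> real"
  assumes f: "C1_grad UNIV f F" and K: "compact K" and 0: "\<And>x. x \<notin> K \<Longrightarrow> f x = 0"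
  shows "(LINT x|lebesgue. F x \<bullet> b) = 0"
proof -
  obtain B where B: "B \<ge> 0" "\<And>x. \<bar>f x\<bar> \<le> B" "\<And>x. norm (F x) \<le> B"
    using C1_compact_support_bounds[OF f K 0] by blast
  obtain R where R: "\<And>x. x \<in> K \<Longrightarrow> norm x \<le> R"
    using compact_imp_bounded[OF K] unfolding bounded_iff by auto
  define h where "h n = 1 / real (Suc n)" for n
  have h: "0 < h n" "h n \<le> 1" for n by (auto simp: h_def)
  have h0: "h \<longlonglongrightarrow> 0" unfolding h_def by (rule LIMSEQ_Suc[OF lim_1_over_n])
  define s where "s n x = (f (x + h n *\<^sub>R b) - f x) / h n" for n x
  \<comment> \<open>The shifts \<open>h n *\<^sub>R b\<close> have length at most
    \<open>norm b\<close>, so all quotients vanish outside this enlarged ball; inside, the mean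
    value inequality bounds them by \<open>B * norm b\<close>.\<close>
  define w where "w x = B * norm b * indicat_real (cball 0 (R + norm b)) x" for x :: 'a
  note cf = C1_grad_continuous[OF f]
  have if1: "integrable lebesgue f"
    by (rule compact_supported_integrable[OF cf K 0])
  have if2: "integrable lebesgue (\<lambda>x. f (x + a))" for a
  proof (rule compact_supported_integrable)
    show "continuous_on UNIV (\<lambda>x. f (x + a))"
      by (rule continuous_on_compose2[OF cf]) (auto intro!: continuous_intros)
    show "compact ((+) (- a) ` K)" using K by (rule compact_translation)
    show "f (x + a) = 0" if "x \<notin> (+) (- a) ` K" for x
    proof (rule 0)
      show "x + a \<notin> K"
        using that by (metis add.commute diff_add_cancel image_eqI uminus_add_conv_diff add_diff_cancel)
    qed
  qed
  have s0: "(LINT x|lebesgue. s n x) = 0" for n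
  proof -
    have "(LINT x|lebesgue. s n x) = (LINT x|lebesgue. f (x + h n *\<^sub>R b) - f x) / h n"
      unfolding s_def by simp
    also have "(LINT x|lebesgue. f (x + h n *\<^sub>R b) - f x) = 0"
      using if1 if2 integral_lebesgue_translate[OF cf] by simp
    finally show ?thesis by simp
  qed
  have "(\<lambda>n. LINT x|lebesgue. s n x) \<longlonglongrightarrow> (LINT x|lebesgue. F x \<bullet> b)"
  proof (rule integral_dominated_convergence[where w=w])
    show "(\<lambda>x. F x \<bullet> b) \<in> borel_measurable lebesgue"
      using C1_gradD(2)[OF f]
      by (intro measurable_completion) (simp add: borel_measurable_continuous_onI continuous_on_inner continuous_on_const)
    show "s n \<in> borel_measurable lebesgue" for n
      unfolding s_def using if1 if2 by (intro borel_measurable_divide borel_measurable_diff) auto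
    show "integrable lebesgue w"
      unfolding w_def by (intro integrable_mult_right integrable_real_indicator) (auto intro: emeasure_bounded_finite[OF bounded_cball, unfolded infinity_ennreal_def])
    show "AE x in lebesgue. (\<lambda>n. s n x) \<longlonglongrightarrow> F x \<bullet> b"
    proof (rule AE_I2)
      fix x
      have "((\<lambda>t. f (x + t *\<^sub>R b)) has_derivative (\<lambda>t. F x \<bullet> (t *\<^sub>R b))) (at 0)"
      proof (rule has_derivative_compose[where g=f, of "\<lambda>t. x + t *\<^sub>R b" _ 0 UNIV, simplified])
        show "((\<lambda>t. x + t *\<^sub>R b) has_derivative (\<lambda>t. t *\<^sub>R b)) (at 0)"
          by (auto intro!: derivative_eq_intros)
        show "(f has_derivative (\<lambda>v. F x \<bullet> v)) (at x)"
          using C1_gradD(1)[OF f] by simp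
      qed
      then have "((\<lambda>t. f (x + t *\<^sub>R b)) has_real_derivative (F x \<bullet> b)) (at 0)"
        unfolding has_field_derivative_def
        by (rule has_derivative_eq_rhs) (auto simp: fun_eq_iff)
      then have "((\<lambda>t. (f (x + t *\<^sub>R b) - f x) / t) \<longlongrightarrow> F x \<bullet> b) (at 0)"
        unfolding DERIV_def by simp
      moreover have "filterlim h (at 0) sequentially"
        unfolding filterlim_at using h0 h by (auto simp: less_imp_neq[THEN not_sym])
      ultimately show "(\<lambda>n. s n x) \<longlonglongrightarrow> F x \<bullet> b"
        unfolding s_def by (rule filterlim_compose)
    qed
    show "AE x in lebesgue. norm (s n x) \<le> w x" for n
    proof (rule AE_I2)
      fix x
      show "norm (s n x) \<le> w x"
      proof (cases "x \<in> cball 0 (R + norm b)")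
        case True
        have "\<bar>f (x + h n *\<^sub>R b) - f x\<bar> \<le> B * norm ((x + h n *\<^sub>R b) - x)"
          by (rule mean_value_C1_grad[OF f]) (auto simp: B)
        then have "\<bar>f (x + h n *\<^sub>R b) - f x\<bar> \<le> B * norm b * h n"
          using h[of n] by (simp add: mult_ac)
        then show ?thesis
          using True h[of n] unfolding s_def w_def by (simp add: divide_simps)
      next
        case False
        have "h n * norm b \<le> norm b" using h[of n] by (simp add: mult_left_le_one_le)
        then have "norm (x + h n *\<^sub>R b) > R"
          using False norm_diff_ineq[of x "h n *\<^sub>R b"] h[of n] by (auto simp: not_le)
        then have "f (x + h n *\<^sub>R b) = 0" "f x = 0"
          using False 0 R by (force, metis False R 0 add_increasing2 dist_0_norm mem_cball norm_ge_zero)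
        then show ?thesis using B unfolding s_def w_def by auto
      qed
    qed
  qed
  then show ?thesis using s0 LIMSEQ_unique by (simp add: LIMSEQ_const_iff)
qed

text \<open>Integration by parts against the field x - y, whose divergence is the dimension: the
  preceding lemma is applied to \<open>((x - y) \<bullet> b) * f x\<close> for each coordinate
  \<open>b\<close>. A multiple of this field is the p-flux of the radial barrier.\<close>

lemma integral_position_gradient:
  fixes f :: "'a::euclidean_space \<Rightarrow> real"
  assumes f: "C1_grad UNIV f F" and K: "compact K" and 0: "\<And>x. x \<notin> K \<Longrightarrow> f x = 0"
  shows "(LINT x|lebesgue. (x - y) \<bullet> F x) = - real DIM('a) * (LINT x|lebesgue. f x)"
proof -
  note cf = C1_grad_continuous[OF f] and cF = C1_gradD(2)[OF f]
  have F0: "F x = 0" if "x \<notin> K" for x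
    using C1_grad_zero_off[OF f compact_imp_closed[OF K] 0 that] .
  have i1: "integrable lebesgue f" by (rule compact_supported_integrable[OF cf K 0])
  have i2: "integrable lebesgue (\<lambda>x. ((x - y) \<bullet> b) * (F x \<bullet> b))" for b
    by (rule compact_supported_integrable[OF _ K]) (auto intro!: continuous_intros cF simp: F0)
  have b: "(LINT x|lebesgue. ((x - y) \<bullet> b) * (F x \<bullet> b)) = - (LINT x|lebesgue. f x)"
    if "b \<in> Basis" for b
  proof -
    have "C1_grad UNIV (\<lambda>x. ((x - y) \<bullet> b) * f x) (\<lambda>x. ((x - y) \<bullet> b) *\<^sub>R F x + f x *\<^sub>R b)"
      by (rule C1_grad_mult[OF C1_grad_inner f])
    then have "(LINT x|lebesgue. (((x - y) \<bullet> b) *\<^sub>R F x + f x *\<^sub>R b) \<bullet> b) = 0"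
      by (rule integral_gradient_compact_support[OF _ K]) (simp add: 0)
    then have "(LINT x|lebesgue. ((x - y) \<bullet> b) * (F x \<bullet> b) + f x) = 0"
      using that by (simp add: inner_add_left)
    then show ?thesis using i1 i2 by simp
  qed
  have "(LINT x|lebesgue. (x - y) \<bullet> F x) = (LINT x|lebesgue. (\<Sum>b\<in>Basis. ((x - y) \<bullet> b) * (F x \<bullet> b)))"
    by (intro Bochner_Integration.integral_cong refl) (rule euclidean_inner)
  also have "\<dots> = (\<Sum>b\<in>Basis. LINT x|lebesgue. ((x - y) \<bullet> b) * (F x \<bullet> b))"
    by (rule Bochner_Integration.integral_sum) (rule i2)
  also have "\<dots> = - real DIM('a) * (LINT x|lebesgue. f x)"
    by (simp add: b)
  finally show ?thesis .
qed

section \<open>Convolution with probability kernels: contraction and convergence in L^1\<close>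

section \<open>Mollification\<close>

lemma norm_diff_le_add_via: "norm (a - c :: 'a::real_normed_vector) \<le> norm (a - b) + norm (b - c)"
  using norm_triangle_ineq[of "a - b" "b - c"] by simp

text \<open>Induction over integrable functions. An indicator is handled by squeezing its set
  between a closed \<open>T\<close> and an open \<open>U\<close> with \<open>U - T\<close> small; a
  Urysohn function for the two differs from the indicator only on \<open>U - T\<close>.\<close>

lemma L1_approx_continuous:
  fixes f :: "'a::euclidean_space \<Rightarrow> 'b::{banach, second_countable_topology}"
  assumes "integrable lborel f"
  shows "\<forall>e>0. \<exists>k. continuous_on UNIV k \<and> integrable lborel k \<and> (LINT x|lborel. norm (f x - k x)) < e"
  using assms
proof (induction rule: integrable_induct)
  case (base A c)
  show ?case
  proof (intro allI impI)
    fix e :: real assume "e > 0"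
    \<comment> \<open>The error is at most \<open>2 * d * norm c\<close>, which this choice puts
      below \<open>e\<close>; the \<open>+ 1\<close> covers the case c = 0.\<close>
    define d where "d = e / (2 * (norm c + 1))"
    have d: "d > 0" unfolding d_def using \<open>e > 0\<close> by (simp add: add_nonneg_pos)
    have A: "A \<in> sets lebesgue" using base(1) by auto
    obtain U where U: "open U" "A \<subseteq> U" "U - A \<in> lmeasurable" "emeasure lebesgue (U - A) < ennreal d"
      using sets_lebesgue_outer_open[OF A d] by blast
    obtain T where T: "closed T" "T \<subseteq> A" "A - T \<in> lmeasurable" "emeasure lebesgue (A - T) < ennreal d"
      using sets_lebesgue_inner_closed[OF A d] by blast
    have "closed (- U)" "T \<inter> - U = {}" using T U by auto
    then obtain k :: "'a \<Rightarrow> real" where k: "continuous_on UNIV k" "\<And>x. k x \<in> closed_segment 1 0"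
      "\<And>x. x \<in> T \<Longrightarrow> k x = 1" "\<And>x. x \<in> - U \<Longrightarrow> k x = 0"
      using Urysohn[OF T(1), of "- U" 1 0] by blast
    have k01: "0 \<le> k x" "k x \<le> 1" for x
      using k(2)[of x] by (auto simp: closed_segment_eq_real_ivl)
    have UT: "U - T \<in> sets borel" using U(1) T(1) by auto
    have emd: "emeasure lborel (U - T) \<le> ennreal (2 * d)"
    proof -
      have "emeasure lborel (U - T) = emeasure lebesgue (U - T)" using UT by simp
      also have "\<dots> \<le> emeasure lebesgue ((U - A) \<union> (A - T))"
        using U(3) T(3) by (intro emeasure_mono) (auto simp: fmeasurable_def)
      also have "\<dots> \<le> emeasure lebesgue (U - A) + emeasure lebesgue (A - T)"
        using U(3) T(3) by (intro emeasure_subadditive) (auto simp: fmeasurable_def)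
      also have "\<dots> \<le> ennreal d + ennreal d"
        using U(4) T(4) by (intro add_mono) auto
      finally show ?thesis using d by (simp flip: ennreal_plus)
    qed
    have iUT: "integrable lborel (indicat_real (U - T))"
      using UT emd by (intro integrable_real_indicator) (auto intro: le_less_trans)
    have le: "\<bar>indicat_real A x - k x\<bar> \<le> indicat_real (U - T) x" for x
      using k01[of x] k(3,4)[of x] U(2) T(2) by (auto simp: indicator_def)
    have mk: "k \<in> borel_measurable borel" by (rule borel_measurable_continuous_onI[OF k(1)])
    have i1: "integrable lborel (\<lambda>x. indicat_real A x - k x)"
      by (rule Bochner_Integration.integrable_bound[OF iUT]) (use mk base(1) le in auto)
    have ik: "integrable lborel k"
      using Bochner_Integration.integrable_diff[OF integrable_real_indicator[of A lborel] i1] base by simp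
    have "(LINT x|lborel. norm (indicator A x *\<^sub>R c - k x *\<^sub>R c)) = (LINT x|lborel. \<bar>indicat_real A x - k x\<bar>) * norm c"
      by (simp flip: scaleR_diff_left)
    also have "\<dots> \<le> (LINT x|lborel. indicat_real (U - T) x) * norm c"
      using i1 iUT le by (intro mult_right_mono integral_mono) auto
    also have "\<dots> \<le> 2 * d * norm c"
      using emd UT d by (intro mult_right_mono) (auto simp: measure_def enn2real_leI)
    also have "\<dots> = e * (norm c / (norm c + 1))"
    proof -
      have "2 * d = e / (norm c + 1)" unfolding d_def using add_nonneg_pos[of "norm c" 1] by (simp add: field_simps)
      then show ?thesis by simp
    qed
    also have "\<dots> < e * 1"
      using \<open>e > 0\<close> by (intro mult_strict_left_mono) (auto simp: divide_simps add_nonneg_pos)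
    finally show "\<exists>k. continuous_on UNIV k \<and> integrable lborel k \<and> (LINT x|lborel. norm (indicator A x *\<^sub>R c - k x)) < e"
      using k(1) ik by (intro exI[of _ "\<lambda>x. k x *\<^sub>R c"]) (auto intro!: continuous_intros)
  qed
next
  case (add f g)
  show ?case
  proof (intro allI impI)
    fix e :: real assume "e > 0"
    then have e2: "e / 2 > 0" by simp
    obtain k where k: "continuous_on UNIV k" "integrable lborel k" "(LINT x|lborel. norm (f x - k x)) < e / 2"
      using add(3)[rule_format, OF e2] by blast
    obtain l where l: "continuous_on UNIV l" "integrable lborel l" "(LINT x|lborel. norm (g x - l x)) < e / 2"
      using add(4)[rule_format, OF e2] by blast
    have "(LINT x|lborel. norm (f x + g x - (k x + l x))) \<le> (LINT x|lborel. norm (f x - k x) + norm (g x - l x))"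
      using add k l by (intro integral_mono) (auto intro: norm_triangle_ineq simp: add_diff_add)
    also have "\<dots> < e" using add k l by simp
    finally show "\<exists>k. continuous_on UNIV k \<and> integrable lborel k \<and> (LINT x|lborel. norm (f x + g x - k x)) < e"
      using k l by (intro exI[of _ "\<lambda>x. k x + l x"]) (auto intro!: continuous_intros)
  qed
next
  case (lim f s)
  have "(\<lambda>i. LINT x|lborel. norm (f x - s i x)) \<longlonglongrightarrow> (LINT (x::'a)|lborel. 0)"
  \<comment> \<open>The induction rule supplies approximants bounded by
    \<open>2 * norm (f x)\<close>, hence the factor 3.\<close>
  proof (rule integral_dominated_convergence[where w="\<lambda>x. 3 * norm (f x)"])
    show "AE x in lborel. (\<lambda>i. norm (f x - s i x)) \<longlonglongrightarrow> 0"
    proof (rule AE_I2)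
      fix x :: 'a
      have "(\<lambda>i. norm (f x - s i x)) \<longlonglongrightarrow> norm (f x - f x)"
        using lim by (intro tendsto_intros) auto
      then show "(\<lambda>i. norm (f x - s i x)) \<longlonglongrightarrow> 0" by simp
    qed
    show "AE x in lborel. norm (norm (f x - s i x)) \<le> 3 * norm (f x)" for i
    proof (rule AE_I2)
      fix x :: 'a
      show "norm (norm (f x - s i x)) \<le> 3 * norm (f x)"
        using lim(3)[of x i] norm_triangle_ineq4[of "f x" "s i x"] by auto
    qed
  qed (use lim in \<open>auto intro!: borel_measurable_norm borel_measurable_diff\<close>)
  then have l0: "(\<lambda>i. LINT x|lborel. norm (f x - s i x)) \<longlonglongrightarrow> 0" by simp
  show ?case
  proof (intro allI impI)
    fix e :: real assume "e > 0"
    then obtain i where i: "(LINT x|lborel. norm (f x - s i x)) < e / 2"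
      using order_tendstoD(2)[OF l0, of "e/2"] by (auto dest: eventually_happens'[rotated])
    obtain k where k: "continuous_on UNIV k" "integrable lborel k" "(LINT x|lborel. norm (s i x - k x)) < e / 2"
      using lim(5)[of i, rule_format, OF half_gt_zero[OF \<open>e > 0\<close>]] by blast
    have "(LINT x|lborel. norm (f x - k x)) \<le> (LINT x|lborel. norm (f x - s i x) + norm (s i x - k x))"
      using lim k by (intro integral_mono) (auto intro: norm_diff_le_add_via)
    also have "\<dots> < e" using lim k i by simp
    finally show "\<exists>k. continuous_on UNIV k \<and> integrable lborel k \<and> (LINT x|lborel. norm (f x - k x)) < e"
      using k by blast
  qed
qed

definition mollify :: "('a::euclidean_space \<Rightarrow> real) \<Rightarrow> ('a \<Rightarrow> 'b::euclidean_space) \<Rightarrow> 'a \<Rightarrow> 'b" where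
  "mollify \<rho> f x = (LINT z|lborel. \<rho> (x - z) *\<^sub>R f z)"

text \<open>Evenness makes \<open>\<rho> (x - z)\<close> a probability density in \<open>z\<close>
  as well as in \<open>x\<close>: the first is used for averaging, the second for the L^1
  contraction.\<close>

definition mollifier :: "real \<Rightarrow> ('a::euclidean_space \<Rightarrow> real) \<Rightarrow> bool" where
  "mollifier \<epsilon> \<rho> \<longleftrightarrow> continuous_on UNIV \<rho> \<and> (\<forall>x. 0 \<le> \<rho> x \<and> \<rho> (- x) = \<rho> x \<and> (norm x > \<epsilon> \<longrightarrow> \<rho> x = 0)) \<and>
     (LINT x|lborel. \<rho> x) = 1"

lemma lborel_integral_translate:
  fixes f :: "'a::euclidean_space \<Rightarrow> 'b::euclidean_space"
  assumes "f \<in> borel_measurable borel"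
  shows "(LINT x|lborel. f (x - a)) = (LINT x|lborel. f x)"
proof -
  have "(LINT x|lborel. f x) = (LINT x|distr lborel borel ((+) (- a)). f x)"
    by (simp add: lborel_distr_plus)
  also have "\<dots> = (LINT x|lborel. f (- a + x))"
    using assms by (subst integral_distr) auto
  finally show ?thesis by simp
qed

lemma lborel_nn_integral_translate:
  fixes f :: "'a::euclidean_space \<Rightarrow> ennreal"
  assumes "f \<in> borel_measurable borel"
  shows "(\<integral>\<^sup>+x. f (x - a) \<partial>lborel) = (\<integral>\<^sup>+x. f x \<partial>lborel)"
proof -
  have "(\<integral>\<^sup>+x. f x \<partial>lborel) = (\<integral>\<^sup>+x. f x \<partial>distr lborel borel ((+) (- a)))"
    by (simp add: lborel_distr_plus)
  also have "\<dots> = (\<integral>\<^sup>+x. f (- a + x) \<partial>lborel)"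
    using assms by (subst nn_integral_distr) auto
  finally show ?thesis by simp
qed

lemma continuous_compact_support_integrable_lborel:
  fixes f :: "'a::euclidean_space \<Rightarrow> 'b::euclidean_space"
  assumes "continuous_on UNIV f" "\<And>x. norm x > R \<Longrightarrow> f x = 0"
  shows "integrable lborel f"
proof -
  have "integrable lborel (\<lambda>x. indicat_real (cball 0 R) x *\<^sub>R f x)"
    by (rule borel_integrable_compact[OF compact_cball continuous_on_subset[OF assms(1)]]) simp
  moreover have "(\<lambda>x. indicat_real (cball 0 R) x *\<^sub>R f x) = f"
    using assms(2) by (auto simp: indicator_def not_le)
  ultimately show ?thesis by simp
qed

lemma mollifierD:
  assumes "mollifier \<epsilon> \<rho>"
  shows "continuous_on UNIV \<rho>" "0 \<le> \<rho> x" "\<rho> (x - z) = \<rho> (z - x)" "norm x > \<epsilon> \<Longrightarrow> \<rho> x = 0"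
    "(LINT x|lborel. \<rho> x) = 1" "integrable lborel \<rho>" "\<rho> \<in> borel_measurable borel"
    "integrable lborel (\<lambda>z. \<rho> (x - z))" "(LINT z|lborel. \<rho> (x - z)) = 1"
    "(\<integral>\<^sup>+z. \<rho> (x - z) \<partial>lborel) = 1" "(\<integral>\<^sup>+x. \<rho> (x - z) \<partial>lborel) = 1"
proof -
  show c: "continuous_on UNIV \<rho>" and pos: "0 \<le> \<rho> x" and z: "norm x > \<epsilon> \<Longrightarrow> \<rho> x = 0"
    and 1: "(LINT x|lborel. \<rho> x) = 1" for x
    using assms unfolding mollifier_def by auto
  show sym: "\<rho> (x - z) = \<rho> (z - x)" for x z
    using assms unfolding mollifier_def by (metis minus_diff_eq)
  show i: "integrable lborel \<rho>" by (rule continuous_compact_support_integrable_lborel[OF c z])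
  show m: "\<rho> \<in> borel_measurable borel" by (rule borel_measurable_continuous_onI[OF c])
  have n: "(\<integral>\<^sup>+x. \<rho> x \<partial>lborel) = 1"
    using nn_integral_eq_integral[OF i] pos 1 by simp
  show n1: "(\<integral>\<^sup>+x. \<rho> (x - z) \<partial>lborel) = 1" for z
    using lborel_nn_integral_translate[of "\<lambda>x. ennreal (\<rho> x)" z] m n by simp
  then show n2: "(\<integral>\<^sup>+z. \<rho> (x - z) \<partial>lborel) = 1" for x
    by (subst sym) simp
  show "(LINT z|lborel. \<rho> (x - z)) = 1"
    using lborel_integral_translate[OF m, of x] 1 by (subst sym) simp
  show "integrable lborel (\<lambda>z. \<rho> (x - z))"
    using n2[of x] m pos by (auto simp: integrable_iff_bounded)
qed

lemma integrable_kernel_mult: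
  fixes f :: "'a::euclidean_space \<Rightarrow> 'b::euclidean_space"
  assumes "integrable lborel f" "k \<in> borel_measurable borel" "\<And>x. \<bar>k x\<bar> \<le> B"
  shows "integrable lborel (\<lambda>z. k z *\<^sub>R f z)"
proof (rule Bochner_Integration.integrable_bound)
  show "integrable lborel (\<lambda>z. B * norm (f z))" using assms(1) by auto
  show "AE x in lborel. norm (k x *\<^sub>R f x) \<le> norm (B * norm (f x))"
    using assms(3) by (intro AE_I2) (auto intro!: mult_right_mono intro: order_trans[OF _ abs_ge_self])
qed (use assms in auto)

lemma mollifier_bounded:
  fixes \<rho> :: "'a::euclidean_space \<Rightarrow> real"
  assumes "mollifier \<epsilon> \<rho>" obtains B where "\<And>x. \<bar>\<rho> x\<bar> \<le> B" "B \<ge> 0"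
proof -
  have "compact (\<rho> ` cball 0 \<epsilon>)"
    by (rule compact_continuous_image[OF continuous_on_subset[OF mollifierD(1)[OF assms]] compact_cball]) simp
  then have "bounded (\<rho> ` cball 0 \<epsilon>)" by (rule compact_imp_bounded)
  then obtain b where b: "\<And>x. x \<in> cball 0 \<epsilon> \<Longrightarrow> norm (\<rho> x) \<le> b"
    unfolding bounded_iff by (meson image_eqI)
  have "\<bar>\<rho> x\<bar> \<le> max 0 b" for x
    using b[of x] mollifierD(4)[OF assms, of x] by (cases "norm x \<le> \<epsilon>") (auto simp: not_le)
  then show ?thesis using that[of "max 0 b"] by simp
qed

lemma mollify_integrand_integrable:
  fixes f :: "'a::euclidean_space \<Rightarrow> 'b::euclidean_space"
  assumes "mollifier \<epsilon> \<rho>" "integrable lborel f"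
  shows "integrable lborel (\<lambda>z. \<rho> (x - z) *\<^sub>R f z)"
proof -
  obtain B where "\<And>x. \<bar>\<rho> x\<bar> \<le> B" using mollifier_bounded[OF assms(1)] by blast
  then show ?thesis
    using mollifierD(7)[OF assms(1)] by (intro integrable_kernel_mult[OF assms(2)]) auto
qed

lemma mollify_diff:
  assumes "mollifier \<epsilon> \<rho>" "integrable lborel f" "integrable lborel g"
  shows "mollify \<rho> (\<lambda>x. f x - g x) x = mollify \<rho> f x - mollify \<rho> g x"
  unfolding mollify_def
  using mollify_integrand_integrable[OF assms(1,2)] mollify_integrand_integrable[OF assms(1,3)]
  by (simp add: scaleR_diff_right)

text \<open>Tonelli: after exchanging the integrals, the kernel integrates to one in
  \<open>x\<close> for every fixed \<open>z\<close>.\<close>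

lemma mollify_L1:
  fixes f :: "'a::euclidean_space \<Rightarrow> 'b::euclidean_space"
  assumes \<rho>: "mollifier \<epsilon> \<rho>" and f: "integrable lborel f"
  shows "integrable lborel (mollify \<rho> f)"
    and "(LINT x|lborel. norm (mollify \<rho> f x)) \<le> (LINT x|lborel. norm (f x))"
proof -
  note [measurable] = mollifierD(7)[OF \<rho>]
  have [measurable]: "f \<in> borel_measurable borel" using f by auto
  have m[measurable]: "mollify \<rho> f \<in> borel_measurable borel"
  proof -
    have "(\<lambda>(x, z). \<rho> (x - z) *\<^sub>R f z) \<in> borel_measurable (lborel \<Otimes>\<^sub>M lborel)"
      by measurable
    then have "(\<lambda>x. LINT z|lborel. \<rho> (x - z) *\<^sub>R f z) \<in> borel_measurable lborel"
      by (rule lborel.borel_measurable_lebesgue_integral)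
    then show ?thesis unfolding mollify_def[abs_def] by simp
  qed
  have "(\<integral>\<^sup>+x. norm (mollify \<rho> f x) \<partial>lborel) \<le> (\<integral>\<^sup>+x. \<integral>\<^sup>+z. ennreal (\<rho> (x - z)) * norm (f z) \<partial>lborel \<partial>lborel)"
  proof (rule nn_integral_mono)
    fix x
    show "ennreal (norm (mollify \<rho> f x)) \<le> (\<integral>\<^sup>+z. ennreal (\<rho> (x - z)) * norm (f z) \<partial>lborel)"
      using integral_norm_bound_ennreal[OF mollify_integrand_integrable[OF \<rho> f, of x]] mollifierD(2)[OF \<rho>]
      unfolding mollify_def by (simp add: ennreal_mult)
  qed
  also have "\<dots> = (\<integral>\<^sup>+z. \<integral>\<^sup>+x. ennreal (\<rho> (x - z)) * norm (f z) \<partial>lborel \<partial>lborel)"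
    by (rule lborel_pair.Fubini'[symmetric]) measurable
  also have "\<dots> = (\<integral>\<^sup>+z. norm (f z) \<partial>lborel)"
  proof (rule nn_integral_cong)
    fix z
    have "(\<integral>\<^sup>+x. ennreal (\<rho> (x - z)) * norm (f z) \<partial>lborel) = (\<integral>\<^sup>+x. ennreal (\<rho> (x - z)) \<partial>lborel) * norm (f z)"
      by (rule nn_integral_multc) measurable
    then show "(\<integral>\<^sup>+x. ennreal (\<rho> (x - z)) * norm (f z) \<partial>lborel) = norm (f z)"
      using mollifierD(11)[OF \<rho>] by simp
  qed
  finally have le: "(\<integral>\<^sup>+x. norm (mollify \<rho> f x) \<partial>lborel) \<le> (\<integral>\<^sup>+z. norm (f z) \<partial>lborel)" .
  moreover have fin: "(\<integral>\<^sup>+z. norm (f z) \<partial>lborel) < \<infinity>" using f by (auto simp: integrable_iff_bounded)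
  ultimately show i: "integrable lborel (mollify \<rho> f)"
    using m by (auto simp: integrable_iff_bounded)
  have "ennreal (LINT x|lborel. norm (mollify \<rho> f x)) \<le> ennreal (LINT x|lborel. norm (f x))"
    using le i f by (simp add: nn_integral_eq_integral)
  then show "(LINT x|lborel. norm (mollify \<rho> f x)) \<le> (LINT x|lborel. norm (f x))"
    by (simp add: Bochner_Integration.integral_nonneg)
qed

text \<open>An average of values within distance \<open>e\<close> of \<open>c\<close> stays within
  \<open>e\<close> of \<open>c\<close>. With \<open>c = f x\<close> this measures the mollification
  error; with \<open>c = 0\<close> it yields both the support of a mollification and Lipschitz
  bounds.\<close>

lemma norm_mollify_diff_le:
  fixes f :: "'a::euclidean_space \<Rightarrow> 'b::euclidean_space"
  assumes \<rho>: "mollifier \<epsilon> \<rho>" and f: "integrable lborel f"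
    and e: "\<And>z. norm (x - z) \<le> \<epsilon> \<Longrightarrow> norm (f z - c) \<le> e" and "e \<ge> 0"
  shows "norm (mollify \<rho> f x - c) \<le> e"
proof -
  note i = mollify_integrand_integrable[OF \<rho> f, of x]
  have i2: "integrable lborel (\<lambda>z. \<rho> (x - z) *\<^sub>R c)"
    using mollifierD(8)[OF \<rho>] by auto
  have "mollify \<rho> f x - c = (LINT z|lborel. \<rho> (x - z) *\<^sub>R f z) - (LINT z|lborel. \<rho> (x - z) *\<^sub>R c)"
    unfolding mollify_def using mollifierD(8,9)[OF \<rho>] by simp
  also have "\<dots> = (LINT z|lborel. \<rho> (x - z) *\<^sub>R (f z - c))"
    using i i2 by (simp add: scaleR_diff_right)
  finally have "norm (mollify \<rho> f x - c) \<le> (LINT z|lborel. norm (\<rho> (x - z) *\<^sub>R (f z - c)))"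
    by (simp only: integral_norm_bound)
  also have "\<dots> \<le> (LINT z|lborel. \<rho> (x - z) * e)"
  proof (rule integral_mono)
    show "integrable lborel (\<lambda>z. norm (\<rho> (x - z) *\<^sub>R (f z - c)))"
      using i i2 by (intro integrable_norm) (simp add: scaleR_diff_right)
    show "integrable lborel (\<lambda>z. \<rho> (x - z) * e)" using mollifierD(8)[OF \<rho>] by auto
    fix z
    show "norm (\<rho> (x - z) *\<^sub>R (f z - c)) \<le> \<rho> (x - z) * e"
      using e[of z] mollifierD(2,4)[OF \<rho>, of "x - z"]
      by (cases "norm (x - z) \<le> \<epsilon>") (auto intro: mult_left_mono simp: not_le)
  qed
  also have "\<dots> = e" using mollifierD(8,9)[OF \<rho>, of x] by simp
  finally show ?thesis .
qed

text \<open>For a compactly supported continuous \<open>k\<close> the convergence is uniform on a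
  fixed ball. The remainder \<open>f - k\<close> is small in L^1, and mollification does not
  increase its norm. The three contributions are each below \<open>e / 4\<close>.\<close>

lemma mollify_tendsto_L1:
  fixes f :: "'a::euclidean_space \<Rightarrow> 'b::euclidean_space"
  assumes f: "integrable lborel f" and R: "\<And>x. norm x > R \<Longrightarrow> f x = 0"
    and \<rho>: "\<And>i::nat. mollifier (\<epsilon> i) (\<rho> i)" and \<epsilon>: "\<epsilon> \<longlonglongrightarrow> 0"
  shows "(\<lambda>i. LINT x|lborel. norm (mollify (\<rho> i) f x - f x)) \<longlonglongrightarrow> 0"
proof (rule LIMSEQ_I)
  fix e :: real assume "0 < e"
  then have e3: "e / 4 > 0" by simp
  obtain k0 where k0: "continuous_on UNIV k0" "integrable lborel k0" "(LINT x|lborel. norm (f x - k0 x)) < e / 4"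
    using L1_approx_continuous[OF f, rule_format, OF e3] by blast
  \<comment> \<open>Cutting \<open>k0\<close> off outside radius R + 1 gives compact support without
    increasing the L^1 error, because \<open>f\<close> vanishes beyond R.\<close>
  define \<kappa> where "\<kappa> x = max 0 (min 1 (R + 1 - norm x))" for x :: 'a
  have \<kappa>: "continuous_on UNIV \<kappa>" "0 \<le> \<kappa> x" "\<kappa> x \<le> 1" for x
    unfolding \<kappa>_def by (auto intro!: continuous_intros)
  define k where "k x = \<kappa> x *\<^sub>R k0 x" for x
  have kc: "continuous_on UNIV k" unfolding k_def by (intro continuous_intros \<kappa> k0)
  have kR: "k x = 0" if "norm x > R + 1" for x using that by (simp add: k_def \<kappa>_def)
  have ki: "integrable lborel k"
    by (rule continuous_compact_support_integrable_lborel[OF kc kR])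
  have fk: "norm (f x - k x) \<le> norm (f x - k0 x)" for x
  proof (cases "norm x > R")
    case True
    then show ?thesis using R[OF True] \<kappa>(2,3)[of x] by (simp add: k_def mult_left_le_one_le)
  next
    case False
    then have "\<kappa> x = 1" unfolding \<kappa>_def by auto
    then show ?thesis by (simp add: k_def)
  qed
  have fk4: "(LINT x|lborel. norm (f x - k x)) < e / 4"
    using integral_mono[of lborel "\<lambda>x. norm (f x - k x)" "\<lambda>x. norm (f x - k0 x)"] fk k0 ki f by fastforce
  define V where "V = measure lborel (cball (0::'a) (R + 2))"
  \<comment> \<open>Uniform error allowed on the ball of radius R + 2, which contains the supports
    of \<open>k\<close> and of its mollifications once \<open>\<epsilon> i < 1\<close>; its total is
    \<open>\<eta> * V < e / 4\<close>.\<close>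
  define \<eta> where "\<eta> = e / (4 * (V + 1))"
  have V: "V \<ge> 0" "\<eta> > 0" unfolding V_def \<eta>_def using \<open>0 < e\<close> by (auto intro!: divide_pos_pos add_nonneg_pos)
  have uc: "uniformly_continuous_on (cball 0 (R + 3)) k"
    by (rule compact_uniformly_continuous[OF continuous_on_subset[OF kc]]) auto
  then obtain d where d: "d > 0" "\<And>x y. x \<in> cball 0 (R + 3) \<Longrightarrow> y \<in> cball 0 (R + 3) \<Longrightarrow> dist y x < d \<Longrightarrow> dist (k y) (k x) < \<eta>"
    unfolding uniformly_continuous_on_def using V(2) by metis
  have ev: "eventually (\<lambda>i. \<epsilon> i < min d 1) sequentially"
    using order_tendstoD(2)[OF \<epsilon>, of "min d 1"] d by simp
  have "(LINT x|lborel. norm (mollify (\<rho> i) f x - f x)) < e" if i: "\<epsilon> i < min d 1" for i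
  proof -
    note mi = mollify_L1(1)[OF \<rho>[of i]]
    have pt: "norm (mollify (\<rho> i) k x - k x) \<le> \<eta> * indicat_real (cball 0 (R + 2)) x" for x
    proof (cases "x \<in> cball 0 (R + 2)")
      case True
      have "norm (mollify (\<rho> i) k x - k x) \<le> \<eta>"
      proof (rule norm_mollify_diff_le[OF \<rho> ki])
        fix z assume z: "norm (x - z) \<le> \<epsilon> i"
        have "norm z \<le> norm x + norm (x - z)" by (metis norm_triangle_sub norm_minus_commute)
        then have "z \<in> cball 0 (R + 3)" "x \<in> cball 0 (R + 3)" using True z i by auto
        then show "norm (k z - k x) \<le> \<eta>"
          using d(2)[of x z] z i by (simp add: dist_norm norm_minus_commute)
      qed (use V in auto)
      then show ?thesis using True by simp
    next
      case False
      have "norm (mollify (\<rho> i) k x - 0) \<le> 0"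
      proof (rule norm_mollify_diff_le[OF \<rho> ki])
        fix z assume z: "norm (x - z) \<le> \<epsilon> i"
        have "norm x \<le> norm z + norm (x - z)" by (metis norm_triangle_sub)
        then have "norm z > R + 1" using False z i by auto
        then show "norm (k z - 0) \<le> 0" using kR by simp
      qed simp
      then show ?thesis using False kR[of x] by simp
    qed
    have iB: "integrable lborel (\<lambda>x. \<eta> * indicat_real (cball 0 (R + 2)) (x::'a))"
      by (intro integrable_mult_right integrable_real_indicator)
         (auto intro: emeasure_bounded_finite[OF bounded_cball, unfolded infinity_ennreal_def])
    have s2: "(LINT x|lborel. norm (mollify (\<rho> i) k x - k x)) \<le> \<eta> * V"
    proof -
      have "(LINT x|lborel. norm (mollify (\<rho> i) k x - k x)) \<le> (LINT x|lborel. \<eta> * indicat_real (cball 0 (R + 2)) (x::'a))"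
        using mi[OF ki] ki iB pt by (intro integral_mono) auto
      also have "\<dots> = \<eta> * V" unfolding V_def by simp
      finally show ?thesis .
    qed
    have "\<eta> * V < e / 4"
    proof -
      have "\<eta> * V < \<eta> * (V + 1)" using V by simp
      also have "\<dots> = e / 4" using V(1) unfolding \<eta>_def by (simp add: field_simps add_nonneg_eq_0_iff)
      finally show ?thesis .
    qed
    have s1: "(LINT x|lborel. norm (mollify (\<rho> i) (\<lambda>x. f x - k x) x)) \<le> (LINT x|lborel. norm (f x - k x))"
      by (rule mollify_L1(2)[OF \<rho>]) (use f ki in auto)
    have j: "integrable lborel (\<lambda>x. norm (mollify (\<rho> i) (\<lambda>x. f x - k x) x))"
      "integrable lborel (\<lambda>x. norm (mollify (\<rho> i) k x - k x))"
      "integrable lborel (\<lambda>x. norm (f x - k x))"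
      "integrable lborel (\<lambda>x. norm (mollify (\<rho> i) f x - f x))"
      by (intro Bochner_Integration.integrable_diff integrable_norm mi f ki)+
    have "(LINT x|lborel. norm (mollify (\<rho> i) f x - f x))
        \<le> (LINT x|lborel. norm (mollify (\<rho> i) (\<lambda>x. f x - k x) x) + norm (mollify (\<rho> i) k x - k x) + norm (f x - k x))"
    proof (rule integral_mono)
      fix x
      have eq: "mollify (\<rho> i) f x - f x = mollify (\<rho> i) (\<lambda>x. f x - k x) x + (mollify (\<rho> i) k x - k x) - (f x - k x)"
        by (simp add: mollify_diff[OF \<rho> f ki])
      show "norm (mollify (\<rho> i) f x - f x) \<le> norm (mollify (\<rho> i) (\<lambda>x. f x - k x) x) + norm (mollify (\<rho> i) k x - k x) + norm (f x - k x)"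
        using norm_triangle_ineq[of "mollify (\<rho> i) (\<lambda>x. f x - k x) x" "mollify (\<rho> i) k x - k x"]
          norm_triangle_ineq4[of "mollify (\<rho> i) (\<lambda>x. f x - k x) x + (mollify (\<rho> i) k x - k x)" "f x - k x"]
        unfolding eq by linarith
    qed (intro Bochner_Integration.integrable_add j)+
    also have "\<dots> = (LINT x|lborel. norm (mollify (\<rho> i) (\<lambda>x. f x - k x) x)) + (LINT x|lborel. norm (mollify (\<rho> i) k x - k x)) + (LINT x|lborel. norm (f x - k x))"
      using j by simp
    also have "\<dots> < e" using s1 s2 fk4 \<open>\<eta> * V < e / 4\<close> \<open>0 < e\<close> by linarith
    finally show ?thesis .
  qed
  then have "eventually (\<lambda>i. norm ((LINT x|lborel. norm (mollify (\<rho> i) f x - f x)) - 0) < e) sequentially"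
    using ev by (auto elim!: eventually_mono)
  then show "\<exists>no. \<forall>n\<ge>no. norm ((LINT x|lborel. norm (mollify (\<rho> n) f x - f x)) - 0) < e"
    by (simp add: eventually_sequentially)
qed

section \<open>Smooth kernels of compact support from the flat exponential\<close>

section \<open>A smooth bump function\<close>

lemma frechet_derivative_eqI: "(f has_derivative D) (at x) \<Longrightarrow> frechet_derivative f (at x) = D"
  using frechet_derivative_at by metis

lemma Ck_on_SucD: "Ck_on (Suc k) UNIV f \<Longrightarrow> Ck_on k UNIV f"
proof (induction k arbitrary: f)
  case 0
  then show ?case
    by (auto intro!: continuous_at_imp_continuous_on differentiable_imp_continuous_within)
next
  case (Suc k)
  then show ?case using Ck_on.simps(2) by blast
qed

lemma Ck_on_const: "Ck_on k UNIV (\<lambda>x. c)"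
  by (induction k arbitrary: c) (auto simp: frechet_derivative_const)

lemma Ck_on_inner: "Ck_on k UNIV (\<lambda>x. (x - c) \<bullet> v)"
proof (cases k)
  case (Suc j)
  have "frechet_derivative (\<lambda>x. (x - c) \<bullet> v) (at x) = (\<lambda>w. w \<bullet> v)" for x
    by (rule frechet_derivative_eqI) (auto intro!: derivative_eq_intros)
  then show ?thesis using Suc by (simp add: Ck_on_const)
qed (auto intro!: continuous_intros)

lemma Ck_on_add: "Ck_on k UNIV f \<Longrightarrow> Ck_on k UNIV g \<Longrightarrow> Ck_on k UNIV (\<lambda>x. f x + g x)"
proof (induction k arbitrary: f g)
  case (Suc k)
  have d: "f differentiable (at x)" "g differentiable (at x)" for x using Suc.prems by auto
  have "frechet_derivative (\<lambda>x. f x + g x) (at x) = (\<lambda>v. frechet_derivative f (at x) v + frechet_derivative g (at x) v)" for x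
    using d by (intro frechet_derivative_eqI has_derivative_add) (auto simp: frechet_derivative_works[symmetric])
  then show ?case using Suc by simp
qed (auto intro: continuous_intros)

lemma Ck_on_mult: "Ck_on k UNIV f \<Longrightarrow> Ck_on k UNIV g \<Longrightarrow> Ck_on k UNIV (\<lambda>x. f x * g x)"
proof (induction k arbitrary: f g)
  case (Suc k)
  have d: "f differentiable (at x)" "g differentiable (at x)" for x using Suc.prems by auto
  have "frechet_derivative (\<lambda>x. f x * g x) (at x) = (\<lambda>v. f x * frechet_derivative g (at x) v + frechet_derivative f (at x) v * g x)" for x
    using d by (intro frechet_derivative_eqI has_derivative_mult) (auto simp: frechet_derivative_works[symmetric])
  then show ?case
    using Suc.prems Ck_on_SucD[OF Suc.prems(1)] Ck_on_SucD[OF Suc.prems(2)] by (auto intro!: Ck_on_add Suc.IH)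
qed (auto intro: continuous_intros)

text \<open>The recursion reads off d/dt [P(1/t) exp(-1/t)] = (1/t)^2 (P - P')(1/t)
  exp(-1/t).\<close>

primrec flat_poly :: "nat \<Rightarrow> real poly" where
  "flat_poly 0 = 1"
| "flat_poly (Suc j) = monom 1 2 * (flat_poly j - pderiv (flat_poly j))"

text \<open>The \<open>j\<close>-th derivative of \<open>t \<mapsto> exp (-1/t)\<close>, extended by zero to \<open>t \<le> 0\<close>.\<close>
definition flat_exp :: "nat \<Rightarrow> real \<Rightarrow> real" where
  "flat_exp j t = (if t \<le> 0 then 0 else poly (flat_poly j) (1 / t) * exp (- (1 / t)))"

lemma poly_times_exp_tendsto_0: "((\<lambda>s::real. poly p s * exp (- s)) \<longlongrightarrow> 0) at_top"
proof -
  have "((\<lambda>s. \<Sum>i\<le>degree p. coeff p i * (s ^ i / exp s)) \<longlongrightarrow> (\<Sum>i\<le>degree p. coeff p i * 0)) at_top"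
    by (intro tendsto_sum tendsto_mult tendsto_const tendsto_power_div_exp_0)
  then show ?thesis
    by (simp add: poly_altdef sum_distrib_right exp_minus divide_inverse mult.assoc)
qed

lemma flat_exp_DERIV: "(flat_exp j has_real_derivative flat_exp (Suc j) t) (at t)"
proof (cases t "0::real" rule: linorder_cases)
  case less
  have "((\<lambda>t. 0) has_real_derivative 0) (at t)" by simp
  then have "(flat_exp j has_real_derivative 0) (at t)"
    by (rule has_field_derivative_transform_within_open[where S="{..<0}"]) (use less in \<open>auto simp: flat_exp_def\<close>)
  then show ?thesis using less by (simp add: flat_exp_def)
next
  case greater
  have "((\<lambda>t. poly (flat_poly j) (1 / t) * exp (- (1 / t))) has_real_derivative
     (poly (flat_poly j) (1 / t) * (exp (- (1 / t)) * (1 / t^2)) + poly (pderiv (flat_poly j)) (1 / t) * (- 1 / t^2) * exp (- (1 / t)))) (at t)"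
    using greater
    by (auto intro!: derivative_eq_intros DERIV_chain2[where f="poly (flat_poly j)", OF poly_DERIV] simp: power2_eq_square field_simps)
  also have "(poly (flat_poly j) (1 / t) * (exp (- (1 / t)) * (1 / t^2)) + poly (pderiv (flat_poly j)) (1 / t) * (- 1 / t^2) * exp (- (1 / t)))
     = flat_exp (Suc j) t"
    using greater by (simp add: flat_exp_def poly_monom field_simps)
  finally show ?thesis
    by (rule has_field_derivative_transform_within_open[where S="{0<..}"]) (use greater in \<open>auto simp: flat_exp_def\<close>)
next
  case equal
  have "((\<lambda>h. (flat_exp j h - flat_exp j 0) / h) \<longlongrightarrow> 0) (at 0)"
  proof (rule filterlim_split_at)
    have "eventually (\<lambda>h. (flat_exp j h - flat_exp j 0) / h = 0) (at_left 0)"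
      by (auto simp: flat_exp_def eventually_at_filter)
    then show "((\<lambda>h. (flat_exp j h - flat_exp j 0) / h) \<longlongrightarrow> 0) (at_left 0)"
      by (rule tendsto_eventually)
    \<comment> \<open>Dividing by \<open>h\<close> multiplies the polynomial in 1/h by its variable,
      so the right-hand quotient is again a polynomial times a decaying exponential, in the variable
      s = 1/h.\<close>
    have "((\<lambda>h. poly ([:0, 1:] * flat_poly j) (inverse h) * exp (- inverse h)) \<longlongrightarrow> 0) (at_right 0)"
      by (rule filterlim_compose[OF poly_times_exp_tendsto_0 filterlim_inverse_at_top_right])
    moreover have "eventually (\<lambda>h. poly ([:0, 1:] * flat_poly j) (inverse h) * exp (- inverse h) = (flat_exp j h - flat_exp j 0) / h) (at_right 0)"
      by (auto simp: flat_exp_def eventually_at_filter field_simps)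
    ultimately show "((\<lambda>h. (flat_exp j h - flat_exp j 0) / h) \<longlongrightarrow> 0) (at_right 0)"
      by (rule Lim_transform_eventually)
  qed
  then show ?thesis using equal by (simp add: DERIV_def flat_exp_def)
qed

lemma continuous_flat_exp: "continuous_on UNIV (flat_exp j)"
  using flat_exp_DERIV DERIV_continuous by (blast intro: continuous_at_imp_continuous_on)

lemma flat_exp_0: "flat_exp 0 t = (if t \<le> 0 then 0 else exp (- (1 / t)))"
  by (simp add: flat_exp_def)

text \<open>Keeping \<open>j\<close> arbitrary closes the induction: a derivative is
  \<open>flat_exp (Suc j)\<close> of the same argument times an affine function.\<close>

lemma Ck_on_flat_exp_ball: "Ck_on k UNIV (\<lambda>x::'a::euclidean_space. flat_exp j (r\<^sup>2 - (norm (x - c))\<^sup>2))"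
proof (induction k arbitrary: j)
  case 0
  show ?case
    by (auto intro!: continuous_on_compose2[OF continuous_flat_exp] continuous_intros)
next
  case (Suc k)
  have hd: "((\<lambda>x::'a. flat_exp j (r\<^sup>2 - (norm (x - c))\<^sup>2)) has_derivative
      (\<lambda>v. flat_exp (Suc j) (r\<^sup>2 - (norm (x - c))\<^sup>2) * (- 2 * ((x - c) \<bullet> v)))) (at x)" for x
  proof -
    have "((\<lambda>x. r\<^sup>2 - (norm (x - c))\<^sup>2) has_derivative (\<lambda>v. - 2 * ((x - c) \<bullet> v))) (at x)"
      unfolding power2_norm_eq_inner by (auto intro!: derivative_eq_intros simp: inner_commute)
    from has_derivative_compose[OF this flat_exp_DERIV[unfolded has_field_derivative_def]]
    show ?thesis by simp
  qed
  then have fd: "frechet_derivative (\<lambda>x::'a. flat_exp j (r\<^sup>2 - (norm (x - c))\<^sup>2)) (at x) v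
      = flat_exp (Suc j) (r\<^sup>2 - (norm (x - c))\<^sup>2) * (- 2 * ((x - c) \<bullet> v))" for x v
    using frechet_derivative_eqI by metis
  have "Ck_on k UNIV (\<lambda>x::'a. flat_exp (Suc j) (r\<^sup>2 - (norm (x - c))\<^sup>2) * (- 2 * ((x - c) \<bullet> v)))" for v
    by (intro Ck_on_mult Suc.IH Ck_on_const Ck_on_inner)
  then show ?case
    using hd by (auto simp: fd differentiable_def)
qed

text \<open>Nonempty open sets are not null; this converts almost everywhere statements about
  continuous functions into pointwise ones.\<close>

lemma AE_open_False:
  fixes U :: "'a::euclidean_space set"
  assumes "open U" "AE x in lebesgue. x \<notin> U" shows "U = {}"
proof -
  have "U \<in> null_sets lebesgue"
    using assms AE_iff_null_sets[of U lebesgue] by auto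
  then show ?thesis
    using open_not_negligible[OF assms(1)] by (auto simp: negligible_iff_null_sets)
qed

definition std_bump :: "real \<Rightarrow> 'a::euclidean_space \<Rightarrow> real" where
  "std_bump r x = flat_exp 0 (r\<^sup>2 - (norm x)\<^sup>2) / (LINT y|lborel. flat_exp 0 (r\<^sup>2 - (norm (y::'a))\<^sup>2))"

lemma flat_exp_ball_integral_pos:
  assumes "r > 0"
  shows "(LINT y|lborel. flat_exp 0 (r\<^sup>2 - (norm (y::'a::euclidean_space))\<^sup>2)) > 0" (is "integral\<^sup>L _ ?f > 0")
proof -
  have c: "continuous_on UNIV ?f"
    by (auto intro!: continuous_on_compose2[OF continuous_flat_exp] continuous_intros)
  have i: "integrable lborel ?f"
  proof (rule continuous_compact_support_integrable_lborel[OF c])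
    fix y :: 'a assume "norm y > r"
    then show "?f y = 0" using assms power_strict_mono[of r "norm y" 2] by (simp add: flat_exp_0)
  qed
  have nn: "?f y \<ge> 0" for y by (simp add: flat_exp_0)
  have "integral\<^sup>L lborel ?f \<noteq> 0"
  proof
    assume "integral\<^sup>L lborel ?f = 0"
    then have "AE y in lborel. ?f y = 0"
      using integral_nonneg_eq_0_iff_AE[OF i] nn by auto
    then have ae: "AE y in lebesgue. ?f y = 0" by (rule AE_completion)
    have pos: "?f y > 0" if "y \<in> ball 0 r" for y
    proof -
      have "(norm y)\<^sup>2 < r\<^sup>2" using that by (intro power_strict_mono) auto
      then show ?thesis by (simp add: flat_exp_0)
    qed
    have "AE y in lebesgue. y \<notin> ball (0::'a) r"
      by (rule eventually_mono[OF ae]) (metis less_irrefl pos)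
    then have "ball (0::'a) r = {}" by (intro AE_open_False) auto
    then show False using assms by simp
  qed
  moreover have "integral\<^sup>L lborel ?f \<ge> 0" using nn by (simp add: Bochner_Integration.integral_nonneg)
  ultimately show ?thesis by linarith
qed

lemma std_bump_eq_0:
  assumes "r > 0" "norm x \<ge> r" shows "std_bump r x = 0"
  using power_mono[OF assms(2), of 2] assms(1) by (simp add: std_bump_def flat_exp_0)

lemma mollifier_std_bump:
  assumes "r > 0" shows "mollifier r (std_bump r :: 'a::euclidean_space \<Rightarrow> real)"
proof -
  have "continuous_on UNIV (std_bump r :: 'a \<Rightarrow> real)"
    unfolding std_bump_def
    by (intro continuous_on_divide continuous_on_compose2[OF continuous_flat_exp] continuous_intros)
       (use flat_exp_ball_integral_pos[OF assms, where 'a='a] in auto)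
  moreover have "0 \<le> std_bump r x" for x :: 'a
    using flat_exp_ball_integral_pos[OF assms, where 'a='a] unfolding std_bump_def
    by (intro divide_nonneg_pos) (auto simp: flat_exp_0)
  moreover have "std_bump r (- x) = std_bump r x" for x :: 'a by (simp add: std_bump_def)
  moreover have "(LINT x|lborel. std_bump r (x::'a)) = 1"
    using flat_exp_ball_integral_pos[OF assms, where 'a='a] unfolding std_bump_def by simp
  moreover have "std_bump r x = 0" if "norm x > r" for x :: 'a
    using that by (intro std_bump_eq_0[OF assms]) auto
  ultimately show ?thesis unfolding mollifier_def by auto
qed

lemma smooth_on_std_bump: "smooth_on UNIV (\<lambda>z::'a::euclidean_space. std_bump r (x - z))"
proof -
  have "Ck_on k UNIV (\<lambda>z::'a. flat_exp 0 (r\<^sup>2 - (norm (z - x))\<^sup>2) * (1 / (LINT y|lborel. flat_exp 0 (r\<^sup>2 - (norm (y::'a))\<^sup>2))))" for k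
    by (intro Ck_on_mult Ck_on_flat_exp_ball Ck_on_const)
  then show ?thesis unfolding smooth_on_def std_bump_def by (simp add: norm_minus_commute)
qed

lemma std_bump_test_function:
  assumes "r > 0" "cball x r \<subseteq> \<Omega>" shows "(\<lambda>z. std_bump r (x - z)) \<in> Cinf_0 \<Omega>"
proof -
  have "{z. std_bump r (x - z) \<noteq> 0} \<subseteq> cball x r"
    using std_bump_eq_0[OF assms(1)] by (force simp: dist_norm)
  then have sub: "closure {z. std_bump r (x - z) \<noteq> 0} \<subseteq> cball x r"
    by (rule closure_minimal) auto
  then have "compact (closure {z. std_bump r (x - z) \<noteq> 0})"
    using bounded_subset[OF bounded_cball] compact_eq_bounded_closed by blast
  then show ?thesis
    unfolding Cinf_0_def compactly_supported_in_def using smooth_on_std_bump sub assms(2) by auto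
qed

lemma C1_grad_std_bump: "C1_grad UNIV (std_bump r) (gradient (std_bump r :: 'a::euclidean_space \<Rightarrow> real))"
proof -
  have "Ck_on 1 UNIV (\<lambda>x::'a. flat_exp 0 (r\<^sup>2 - (norm (x - 0))\<^sup>2) * (1 / (LINT y|lborel. flat_exp 0 (r\<^sup>2 - (norm (y::'a))\<^sup>2))))"
    by (intro Ck_on_mult Ck_on_flat_exp_ball Ck_on_const)
  then show ?thesis unfolding Ck_on_1_iff_C1_grad[symmetric] std_bump_def by simp
qed

lemma gradient_std_bump_shift:
  "gradient (\<lambda>z. std_bump r (x - z)) z = - gradient (std_bump r) (x - z :: 'a::euclidean_space)"
proof (rule gradient_eqI)
  have "((\<lambda>z. x - z) has_derivative (\<lambda>v. - v)) (at z)"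
    by (auto intro!: derivative_eq_intros)
  from has_derivative_compose[OF this C1_gradD(1)[OF C1_grad_std_bump UNIV_I]]
  show "((\<lambda>z. std_bump r (x - z)) has_derivative (\<lambda>v. - gradient (std_bump r) (x - z) \<bullet> v)) (at z)"
    by (simp add: inner_minus_right inner_minus_left)
qed

section \<open>Mollified Lipschitz functions, and pointwise bounds from distributional
  gradients\<close>

section \<open>Lipschitz functions and their mollifications\<close>

text \<open>The infimum of the cones of slope L over the data. The constant is preserved, and a
  globally Lipschitz function can be mollified up to and across the boundary of \<Omega>.\<close>

lemma McShane_extension:
  fixes g :: "'a::metric_space \<Rightarrow> real"
  assumes "L-lipschitz_on S g" "S \<noteq> {}"
  obtains h where "L-lipschitz_on UNIV h" "\<And>x. x \<in> S \<Longrightarrow> h x = g x"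
proof -
  have L0: "L \<ge> 0" and L: "\<And>x y. x \<in> S \<Longrightarrow> y \<in> S \<Longrightarrow> \<bar>g x - g y\<bar> \<le> L * dist x y"
    using assms(1) unfolding lipschitz_on_def by (auto simp: dist_real_def)
  define h where "h x = (INF y\<in>S. g y + L * dist x y)" for x
  have bdd: "bdd_below ((\<lambda>y. g y + L * dist x y) ` S)" for x
  proof -
    obtain y0 where y0: "y0 \<in> S" using assms(2) by auto
    have "g y0 - L * dist x y0 \<le> g y + L * dist x y" if "y \<in> S" for y
    proof -
      have "g y0 - g y \<le> L * dist y0 y" using L[OF y0 that] by linarith
      also have "\<dots> \<le> L * (dist x y0 + dist x y)"
        using dist_triangle3[of y0 y x] by (intro mult_left_mono L0) (auto simp: dist_commute)
      finally show ?thesis by (simp add: algebra_simps)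
    qed
    then show ?thesis unfolding bdd_below_def by blast
  qed
  have le: "h x \<le> h x' + L * dist x x'" for x x'
  proof -
    have "h x - L * dist x x' \<le> h x'"
      unfolding h_def[of x']
    proof (rule cINF_greatest[OF assms(2)])
      fix y assume y: "y \<in> S"
      have "h x \<le> g y + L * dist x y" unfolding h_def by (rule cINF_lower[OF bdd y])
      also have "\<dots> \<le> g y + L * (dist x x' + dist x' y)"
        using dist_triangle[of x y x'] by (intro add_left_mono mult_left_mono L0) auto
      finally show "h x - L * dist x x' \<le> g y + L * dist x' y" by (simp add: algebra_simps)
    qed
    then show ?thesis by simp
  qed
  show ?thesis
  proof (rule that[of h])
    show "L-lipschitz_on UNIV h"
    proof (rule lipschitz_onI)
      fix x y show "dist (h x) (h y) \<le> L * dist x y"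
        using le[of x y] le[of y x] by (simp add: dist_real_def dist_commute abs_le_iff)
    qed (rule L0)
    fix x assume x: "x \<in> S"
    have "h x \<le> g x" using cINF_lower[OF bdd x, of x] by (simp add: h_def)
    moreover have "g x \<le> h x"
      unfolding h_def
    proof (rule cINF_greatest[OF assms(2)])
      fix y assume "y \<in> S"
      then show "g x \<le> g y + L * dist x y" using L[OF x] by fastforce
    qed
    ultimately show "h x = g x" by simp
  qed
qed

text \<open>The difference quotient in the direction of \<open>w\<close> itself detects
  \<open>norm w\<close>, up to an arbitrarily small error.\<close>

lemma norm_derivative_le_lipschitz:
  fixes f :: "'a::euclidean_space \<Rightarrow> real"
  assumes d: "(f has_derivative (\<lambda>v. w \<bullet> v)) (at x)" and "r > 0" "C \<ge> 0"
    and L: "\<And>y. norm (y - x) < r \<Longrightarrow> \<bar>f y - f x\<bar> \<le> C * norm (y - x)"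
  shows "norm w \<le> C"
proof (rule field_le_epsilon)
  fix e :: real assume "e > 0"
  show "norm w \<le> C + e"
  proof (cases "w = 0")
    case True
    then show ?thesis using \<open>C \<ge> 0\<close> \<open>e > 0\<close> by simp
  next
    case False
    obtain s where s: "s > 0" "\<And>y. norm (y - x) < s \<Longrightarrow> norm (f y - f x - w \<bullet> (y - x)) \<le> e * norm (y - x)"
      using d \<open>e > 0\<close> unfolding has_derivative_at_alt by blast
    define t where "t = min r s / (2 * norm w)"
    have t: "t > 0" unfolding t_def using s(1) \<open>r > 0\<close> False by simp
    define y where "y = x + t *\<^sub>R w"
    have ny: "norm (y - x) = min r s / 2" unfolding y_def t_def using s(1) \<open>r > 0\<close> False by simp
    have "norm (y - x) < s" "norm (y - x) < r" using s(1) \<open>r > 0\<close> unfolding ny by auto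
    then have "\<bar>w \<bullet> (y - x)\<bar> \<le> (C + e) * norm (y - x)"
      using s(2)[of y] L[of y] by (simp add: distrib_right)
    moreover have "w \<bullet> (y - x) = t * (norm w * norm w)" "norm (y - x) = t * norm w"
      using t unfolding y_def by (auto simp: power2_eq_square[symmetric] power2_norm_eq_inner)
    ultimately show ?thesis using t False by (simp add: abs_mult)
  qed
qed

lemma C1_compact_support_uniform:
  assumes "C1_grad UNIV f F" "\<And>x. norm x > r \<Longrightarrow> f x = (0::real)" "e > 0"
  obtains d where "d > 0" "\<And>x y. norm (x - y) < d \<Longrightarrow> norm (F x - F y) \<le> e"
proof -
  have F0: "F x = 0" if "norm x > r" for x
    by (rule C1_grad_zero_off[OF assms(1), of "cball 0 r"]) (use assms(2) that in \<open>auto simp: not_le\<close>)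
  have "uniformly_continuous_on (cball 0 (r + 1)) F"
    by (rule compact_uniformly_continuous[OF continuous_on_subset[OF C1_gradD(2)[OF assms(1)]]]) auto
  then obtain d where d: "d > 0" "\<And>x y. x \<in> cball 0 (r + 1) \<Longrightarrow> y \<in> cball 0 (r + 1) \<Longrightarrow> dist y x < d \<Longrightarrow> dist (F y) (F x) < e"
    unfolding uniformly_continuous_on_def using assms(3) by meson
  show ?thesis
  proof (rule that[of "min d 1"])
    fix x y :: 'a assume xy: "norm (x - y) < min d 1"
    show "norm (F x - F y) \<le> e"
    proof (cases "x \<in> cball 0 (r + 1) \<and> y \<in> cball 0 (r + 1)")
      case True
      then show ?thesis using d(2)[of y x] xy by (simp add: dist_norm)
    next
      case False
      have "norm x \<le> norm y + norm (x - y)" "norm y \<le> norm x + norm (x - y)"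
        by (metis norm_triangle_sub, metis norm_triangle_sub norm_minus_commute)
      then have "norm x > r" "norm y > r" using False xy by auto
      then show ?thesis using F0 assms(3) by simp
    qed
  qed (use d in auto)
qed

text \<open>The derivative falls on the kernel, so \<open>w\<close> need only be integrable. Uniform
  continuity of the kernel's gradient makes its Taylor remainder at most
  \<open>e' * norm (y - x)\<close> uniformly in \<open>z\<close>; integrating against |w| costs the
  factor \<open>W\<close>. The same radius \<open>d\<close> gives differentiability and continuity
  of the derivative.\<close>

lemma mollify_C1_grad:
  fixes w :: "'a::euclidean_space \<Rightarrow> real"
  assumes r: "r > 0" and w: "integrable lborel w"
  shows "C1_grad UNIV (mollify (std_bump r) w)
           (\<lambda>x. LINT z|lborel. w z *\<^sub>R gradient (std_bump r) (x - z))" (is "C1_grad _ ?M ?F")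
proof -
  define \<rho> :: "'a \<Rightarrow> real" where "\<rho> = std_bump r"
  define G where "G = gradient \<rho>"
  have \<rho>: "C1_grad UNIV \<rho> G" unfolding \<rho>_def G_def by (rule C1_grad_std_bump)
  have m: "mollifier r \<rho>" unfolding \<rho>_def by (rule mollifier_std_bump[OF r])
  have z: "\<rho> x = 0" if "norm x > r" for x using mollifierD(4)[OF m that] .
  obtain B where B: "B \<ge> 0" "\<And>x. \<bar>\<rho> x\<bar> \<le> B" "\<And>x. norm (G x) \<le> B"
    using C1_compact_support_bounds[OF \<rho> compact_cball[of 0 r]] z by (auto simp: not_le)
  note [measurable] = borel_measurable_continuous_onI[OF C1_gradD(2)[OF \<rho>]] borel_measurable_integrable[OF w]
  have iG: "integrable lborel (\<lambda>z. w z *\<^sub>R G (x - z))" for x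
  proof (rule Bochner_Integration.integrable_bound)
    show "integrable lborel (\<lambda>z. B * norm (w z))" using w by auto
    show "AE z in lborel. norm (w z *\<^sub>R G (x - z)) \<le> norm (B * norm (w z))"
    proof (rule AE_I2)
      fix z
      show "norm (w z *\<^sub>R G (x - z)) \<le> norm (B * norm (w z))"
        using mult_right_mono[OF B(3)[of "x - z"] abs_ge_zero[of "w z"]] B(1) by (simp add: mult.commute abs_mult)
    qed
  qed measurable
  have i\<rho>: "integrable lborel (\<lambda>z. \<rho> (x - z) *\<^sub>R w z)" for x
    by (rule mollify_integrand_integrable[OF m w])
  define W where "W = (LINT z|lborel. \<bar>w z\<bar>)"
  have W: "W \<ge> 0" unfolding W_def by simp
  have key: "\<exists>d>0. \<forall>y. norm (y - x) < d \<longrightarrow> norm (?M y - ?M x - ?F x \<bullet> (y - x)) \<le> e * norm (y - x)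
      \<and> norm (?F y - ?F x) \<le> e" if "e > 0" for e x
  proof -
    define e' where "e' = e / (W + 1)"
    have e': "e' > 0" unfolding e'_def using that W by simp
    have e'W: "e' * W \<le> e" unfolding e'_def using W that by (simp add: field_simps)
    obtain d where d: "d > 0" "\<And>x y. norm (x - y) < d \<Longrightarrow> norm (G x - G y) \<le> e'"
      using C1_compact_support_uniform[OF \<rho> z e'] by blast
    have "norm (?M y - ?M x - ?F x \<bullet> (y - x)) \<le> e * norm (y - x) \<and> norm (?F y - ?F x) \<le> e"
      if y: "norm (y - x) < d" for y
    proof
      have pt: "\<bar>\<rho> (y - z) - \<rho> (x - z) - G (x - z) \<bullet> (y - x)\<bar> \<le> e' * norm (y - x)" for z
      proof -
        \<comment> \<open>The mean value inequality for the kernel minus its linearisation at x - z,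
          whose gradient has norm at most \<open>e'\<close> on this ball.\<close>
        have "C1_grad (ball (x - z) d) (\<lambda>t. \<rho> t - (t - 0) \<bullet> G (x - z)) (\<lambda>t. G t - G (x - z))"
          by (intro C1_grad_diff C1_grad_inner C1_grad_subset[OF \<rho>]) auto
        from mean_value_C1_grad[OF this convex_ball, of "y - z" "x - z" e']
        have "\<bar>\<rho> (y - z) - (y - z - 0) \<bullet> G (x - z) - (\<rho> (x - z) - (x - z - 0) \<bullet> G (x - z))\<bar> \<le> e' * norm (y - z - (x - z))"
          using y d by (auto simp: dist_norm norm_minus_commute)
        moreover have "\<rho> (y - z) - (y - z - 0) \<bullet> G (x - z) - (\<rho> (x - z) - (x - z - 0) \<bullet> G (x - z))
            = \<rho> (y - z) - \<rho> (x - z) - G (x - z) \<bullet> (y - x)"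
          by (simp add: inner_diff_left inner_diff_right inner_commute)
        ultimately show ?thesis by simp
      qed
      have "?M y - ?M x - ?F x \<bullet> (y - x)
          = (LINT z|lborel. \<rho> (y - z) *\<^sub>R w z) - (LINT z|lborel. \<rho> (x - z) *\<^sub>R w z) - (LINT z|lborel. (w z *\<^sub>R G (x - z)) \<bullet> (y - x))"
        unfolding mollify_def \<rho>_def[symmetric] G_def[symmetric] integral_inner_left[OF iG] ..
      also have "\<dots> = (LINT z|lborel. \<rho> (y - z) *\<^sub>R w z - \<rho> (x - z) *\<^sub>R w z - (w z *\<^sub>R G (x - z)) \<bullet> (y - x))"
        using i\<rho>[of x] i\<rho>[of y] integrable_inner_left[OF iG[of x], of "y - x"] by simp
      finally have eq1: "?M y - ?M x - ?F x \<bullet> (y - x) = (LINT z|lborel. \<rho> (y - z) *\<^sub>R w z - \<rho> (x - z) *\<^sub>R w z - (w z *\<^sub>R G (x - z)) \<bullet> (y - x))" .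
      have "norm (?M y - ?M x - ?F x \<bullet> (y - x)) \<le> (LINT z|lborel. norm (\<rho> (y - z) *\<^sub>R w z - \<rho> (x - z) *\<^sub>R w z - (w z *\<^sub>R G (x - z)) \<bullet> (y - x)))"
        unfolding eq1 by (rule integral_norm_bound)
      also have "\<dots> \<le> (LINT z|lborel. e' * norm (y - x) * \<bar>w z\<bar>)"
      proof (rule integral_mono)
        show "integrable lborel (\<lambda>z. norm (\<rho> (y - z) *\<^sub>R w z - \<rho> (x - z) *\<^sub>R w z - (w z *\<^sub>R G (x - z)) \<bullet> (y - x)))"
          by (intro integrable_norm Bochner_Integration.integrable_diff i\<rho> integrable_inner_left iG)
        fix z
        have "\<rho> (y - z) *\<^sub>R w z - \<rho> (x - z) *\<^sub>R w z - (w z *\<^sub>R G (x - z)) \<bullet> (y - x)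
            = (\<rho> (y - z) - \<rho> (x - z) - G (x - z) \<bullet> (y - x)) * w z"
          by (simp add: algebra_simps)
        then show "norm (\<rho> (y - z) *\<^sub>R w z - \<rho> (x - z) *\<^sub>R w z - (w z *\<^sub>R G (x - z)) \<bullet> (y - x)) \<le> e' * norm (y - x) * \<bar>w z\<bar>"
          using mult_right_mono[OF pt[of z], of "\<bar>w z\<bar>"] by (simp add: abs_mult)
      qed (use w in auto)
      also have "\<dots> = (e' * W) * norm (y - x)" unfolding W_def by simp
      also have "\<dots> \<le> e * norm (y - x)" using e'W by (intro mult_right_mono) auto
      finally show "norm (?M y - ?M x - ?F x \<bullet> (y - x)) \<le> e * norm (y - x)" .
      have eq2: "?F y - ?F x = (LINT z|lborel. w z *\<^sub>R G (y - z) - w z *\<^sub>R G (x - z))"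
        using iG unfolding \<rho>_def[symmetric] G_def[symmetric] by simp
      have "norm (?F y - ?F x) \<le> (LINT z|lborel. norm (w z *\<^sub>R G (y - z) - w z *\<^sub>R G (x - z)))"
        unfolding eq2 by (rule integral_norm_bound)
      also have "\<dots> \<le> (LINT z|lborel. e' * \<bar>w z\<bar>)"
      proof (rule integral_mono)
        show "integrable lborel (\<lambda>z. norm (w z *\<^sub>R G (y - z) - w z *\<^sub>R G (x - z)))"
          using iG by (intro integrable_norm Bochner_Integration.integrable_diff)
        fix z
        have "norm (G (y - z) - G (x - z)) \<le> e'" by (rule d(2)) (use y in simp)
        then show "norm (w z *\<^sub>R G (y - z) - w z *\<^sub>R G (x - z)) \<le> e' * \<bar>w z\<bar>"
          using mult_right_mono[of "norm (G (y - z) - G (x - z))" e' "\<bar>w z\<bar>"]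
          by (simp flip: scaleR_diff_right add: mult.commute)
      qed (use w in auto)
      also have "\<dots> = e' * W" unfolding W_def by simp
      finally show "norm (?F y - ?F x) \<le> e" using e'W by linarith
    qed
    then show ?thesis using d(1) by blast
  qed
  have "(?M has_derivative (\<lambda>v. ?F x \<bullet> v)) (at x)" for x
    unfolding has_derivative_at_alt using key[of _ x] by (meson bounded_linear_inner_right)
  moreover have "continuous_on UNIV ?F"
  proof (rule continuous_at_imp_continuous_on, rule ballI, rule continuous_at_eps_delta[THEN iffD2], intro allI impI)
    fix x and e :: real assume "e > 0"
    then obtain d where "d > 0" "\<forall>y. norm (y - x) < d \<longrightarrow> norm (?F y - ?F x) \<le> e / 2"
      using key[of "e/2" x] by (meson half_gt_zero)
    then show "\<exists>d>0. \<forall>x'. dist x' x < d \<longrightarrow> dist (?F x') (?F x) < e"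
      using \<open>e > 0\<close> unfolding dist_norm by (intro exI[of _ d]) fastforce
  qed
  ultimately show ?thesis unfolding C1_grad_def by blast
qed

text \<open>Weak gradients are only Lebesgue measurable, whereas \<open>mollify\<close> integrates
  over \<open>lborel\<close>; a Borel representative is chosen coordinate by coordinate.\<close>

lemma lebesgue_integrable_borel_version:
  fixes f :: "'a::euclidean_space \<Rightarrow> 'b::euclidean_space"
  assumes f: "integrable lebesgue f"
  obtains f' where "integrable lborel f'" "AE x in lebesgue. f' x = f x"
proof -
  have "\<exists>g. g \<in> borel_measurable lborel \<and> (AE x in lborel. f x \<bullet> b = g x)" for b
    using completion_ex_borel_measurable_real[of "\<lambda>x. f x \<bullet> b" lborel] f by auto
  then obtain g where g: "\<And>b. g b \<in> borel_measurable lborel" "\<And>b. AE x in lborel. f x \<bullet> b = g b x"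
    by metis
  define f' where "f' x = (\<Sum>b\<in>Basis. g b x *\<^sub>R b)" for x
  have m: "f' \<in> borel_measurable lborel"
    unfolding f'_def by (rule borel_measurable_sum, rule borel_measurable_scaleR[OF g(1) borel_measurable_const])
  have "AE x in lborel. \<forall>b\<in>Basis. f x \<bullet> b = g b x"
    by (rule AE_finite_allI[OF finite_Basis g(2)])
  then have ae: "AE x in lborel. f' x = f x"
  proof eventually_elim
    case (elim x)
    then have "f' x = (\<Sum>b\<in>Basis. (f x \<bullet> b) *\<^sub>R b)"
      unfolding f'_def by (intro sum.cong) auto
    then show ?case by (simp only: euclidean_representation)
  qed
  then have ae': "AE x in lebesgue. f' x = f x" by (rule AE_completion)
  have "integrable lebesgue f'"
    by (rule integrable_cong_AE_imp[OF f]) (use m ae' in \<open>auto intro: measurable_completion\<close>)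
  then have "integrable lborel f'" using m integrable_completion[of f' lborel] by auto
  then show ?thesis using ae' that by blast
qed

text \<open>\<open>w\<close> cuts \<open>h\<close> off to make it integrable;
  \<open>norm x + r < R\<close> ensures that the mollification at \<open>x\<close> sees only
  \<open>h\<close>. Mollification commutes with translations, so its increment from \<open>x\<close>
  to \<open>y\<close> is the mollification of \<open>w (z + a) - w z\<close> with
  \<open>a = y - x\<close>, bounded by \<open>C * norm a\<close> as long as all arguments stay in
  the ball of radius R. Hence the gradient bound is \<open>C\<close> itself, without loss.\<close>

lemma mollify_lipschitz:
  fixes h :: "'a::euclidean_space \<Rightarrow> real"
  assumes r: "r > 0" and h: "C-lipschitz_on UNIV h" and x: "norm x + r < R"
    and w_def: "w = (\<lambda>x. indicat_real (cball 0 R) x *\<^sub>R h x)"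
  shows "integrable lborel w" "\<bar>mollify (std_bump r) w x - h x\<bar> \<le> C * r"
    "norm (LINT z|lborel. w z *\<^sub>R gradient (std_bump r) (x - z)) \<le> C"
proof -
  note m = mollifier_std_bump[OF r, where 'a='a]
  have C0: "C \<ge> 0" and L: "\<And>x y. \<bar>h x - h y\<bar> \<le> C * norm (x - y)"
    using h unfolding lipschitz_on_def by (auto simp: dist_norm)
  have hc: "continuous_on UNIV h" using lipschitz_on_continuous_on[OF h] .
  show w: "integrable lborel w"
    unfolding w_def by (rule borel_integrable_compact[OF compact_cball continuous_on_subset[OF hc]]) simp
  have wh: "w z = h z" if "norm z \<le> R" for z using that by (simp add: w_def)
  have "norm (mollify (std_bump r) w x - h x) \<le> C * r"
  proof (rule norm_mollify_diff_le[OF m w])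
    fix z assume z: "norm (x - z) \<le> r"
    have "norm z \<le> norm x + norm (x - z)" by (metis norm_triangle_sub norm_minus_commute)
    then have "w z = h z" using x z by (intro wh) simp
    moreover have "C * norm (z - x) \<le> C * r" using z C0 by (intro mult_left_mono) (auto simp: norm_minus_commute)
    ultimately show "norm (w z - h x) \<le> C * r" using L[of z x] by simp
  qed (use C0 r in simp)
  then show "\<bar>mollify (std_bump r) w x - h x\<bar> \<le> C * r" by simp
  show "norm (LINT z|lborel. w z *\<^sub>R gradient (std_bump r) (x - z)) \<le> C"
  proof (rule norm_derivative_le_lipschitz[OF C1_gradD(1)[OF mollify_C1_grad[OF r w] UNIV_I]])
    show "R - r - norm x > 0" using x by simp
    fix y assume y: "norm (y - x) < R - r - norm x"
    define a where "a = y - x"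
    have wi: "integrable lborel (\<lambda>z. w (z + a))"
    proof -
      have "integrable (distr lborel borel ((+) a)) w" using w by (simp add: lborel_distr_plus)
      then have "integrable lborel (\<lambda>z. w (a + z))"
        using w by (subst (asm) integrable_distr_eq) auto
      then show ?thesis by (simp add: add.commute)
    qed
    have "mollify (std_bump r) w y = (LINT z|lborel. std_bump r (y - (z - (- a))) *\<^sub>R w (z - (- a)))"
      unfolding mollify_def
      by (rule lborel_integral_translate[symmetric]) (use mollifierD(7)[OF m] w in measurable)
    also have "\<dots> = mollify (std_bump r) (\<lambda>z. w (z + a)) x"
      unfolding mollify_def a_def by (simp add: algebra_simps)
    finally have "mollify (std_bump r) w y - mollify (std_bump r) w x = mollify (std_bump r) (\<lambda>z. w (z + a) - w z) x"
      by (simp add: mollify_diff[OF m wi w])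
    moreover have "norm (mollify (std_bump r) (\<lambda>z. w (z + a) - w z) x - 0) \<le> C * norm (y - x)"
    proof (rule norm_mollify_diff_le[OF m])
      fix z assume z: "norm (x - z) \<le> r"
      have "norm z \<le> norm x + norm (x - z)" by (metis norm_triangle_sub norm_minus_commute)
      moreover have "norm (z + a) \<le> norm z + norm a" by (rule norm_triangle_ineq)
      ultimately have "w z = h z" "w (z + a) = h (z + a)" using z y x by (auto intro!: wh simp: a_def)
      then show "norm (w (z + a) - w z - 0) \<le> C * norm (y - x)"
        using L[of "z + a" z] by (simp add: a_def)
    qed (use wi w C0 in auto)
    ultimately show "\<bar>mollify (std_bump r) w y - mollify (std_bump r) w x\<bar> \<le> C * norm (y - x)" by simp
  qed (rule C0)
qed

lemma std_bump_gradient_measurable: "gradient (std_bump r :: 'a::euclidean_space \<Rightarrow> real) \<in> borel_measurable borel"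
  by (rule borel_measurable_continuous_onI[OF C1_gradD(2)[OF C1_grad_std_bump]])

lemma std_bump_gradient_eq_0:
  assumes "r > 0" "norm x > r" shows "gradient (std_bump r) (x::'a::euclidean_space) = 0"
proof (rule C1_grad_zero_off[OF C1_grad_std_bump])
  show "std_bump r y = 0" if "y \<notin> cball 0 r" for y :: 'a
    using that by (intro std_bump_eq_0 assms(1)) auto
qed (use assms in auto)

text \<open>\<open>z \<mapsto> std_bump r (x - z)\<close> serves as the test function: the gradient
  of a mollification at \<open>x\<close> is the weak pairing with it. The sign comes from the
  reflection of the argument.\<close>

lemma mollify_gradient_inner:
  fixes w :: "'a::euclidean_space \<Rightarrow> real"
  assumes r: "r > 0" and x: "cball x r \<subseteq> \<Omega>" and w: "integrable lborel w" and wh: "\<And>z. z \<in> \<Omega> \<Longrightarrow> w z = h z"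
  shows "(LINT z|lborel. w z *\<^sub>R gradient (std_bump r) (x - z)) \<bullet> b
     = - (LINT z:\<Omega>|lebesgue. h z * (gradient (\<lambda>z. std_bump r (x - z)) z \<bullet> b))"
proof -
  note [measurable] = std_bump_gradient_measurable[of r, where 'a='a] borel_measurable_integrable[OF w]
  obtain B where B: "\<And>x. norm (gradient (std_bump r) (x::'a)) \<le> B"
  proof -
    have "\<And>x::'a. x \<notin> cball 0 r \<Longrightarrow> std_bump r x = 0" by (intro std_bump_eq_0[OF r]) auto
    then show ?thesis using C1_compact_support_bounds[OF C1_grad_std_bump compact_cball[of "0::'a" r]] that by metis
  qed
  have i: "integrable lborel (\<lambda>z. w z *\<^sub>R gradient (std_bump r) (x - z))"
  proof (rule Bochner_Integration.integrable_bound)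
    show "integrable lborel (\<lambda>z. B * norm (w z))" using w by auto
    show "AE z in lborel. norm (w z *\<^sub>R gradient (std_bump r) (x - z)) \<le> norm (B * norm (w z))"
    proof (rule AE_I2)
      fix z
      have "B \<ge> 0" using B[of 0] norm_ge_zero order_trans by blast
      then show "norm (w z *\<^sub>R gradient (std_bump r) (x - z)) \<le> norm (B * norm (w z))"
        using mult_right_mono[OF B[of "x - z"] abs_ge_zero[of "w z"]] by (simp add: mult.commute abs_mult)
    qed
  qed measurable
  have "(LINT z|lborel. w z *\<^sub>R gradient (std_bump r) (x - z)) \<bullet> b = (LINT z|lborel. w z * (gradient (std_bump r) (x - z) \<bullet> b))"
    using i by (simp flip: integral_inner_left)
  also have "\<dots> = (LINT z|lebesgue. w z * (gradient (std_bump r) (x - z) \<bullet> b))"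
    by (rule integral_completion[symmetric]) measurable
  also have "\<dots> = (LINT z|lebesgue. - (indicat_real \<Omega> z *\<^sub>R (h z * (gradient (\<lambda>z. std_bump r (x - z)) z \<bullet> b))))"
  proof (rule Bochner_Integration.integral_cong[OF refl])
    fix z
    show "w z * (gradient (std_bump r) (x - z) \<bullet> b) = - (indicat_real \<Omega> z *\<^sub>R (h z * (gradient (\<lambda>z. std_bump r (x - z)) z \<bullet> b)))"
    proof (cases "z \<in> \<Omega>")
      case False
      then have "norm (x - z) > r" using x by (force simp: dist_norm)
      then show ?thesis using False by (simp add: std_bump_gradient_eq_0[OF r])
    qed (simp add: wh gradient_std_bump_shift)
  qed
  finally show ?thesis unfolding set_lebesgue_integral_def by simp
qed

lemma mollify_gradient_eq_mollify_weak:
  fixes w :: "'a::euclidean_space \<Rightarrow> real"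
  assumes r: "r > 0" and x: "cball x r \<subseteq> \<Omega>" and w: "integrable lborel w" and wh: "\<And>z. z \<in> \<Omega> \<Longrightarrow> w z = h z"
    and weak: "\<And>\<phi> b. \<phi> \<in> Cinf_0 \<Omega> \<Longrightarrow> b \<in> Basis \<Longrightarrow>
        (LINT x:\<Omega>|lebesgue. h x * (gradient \<phi> x \<bullet> b)) = - (LINT x:\<Omega>|lebesgue. (D x \<bullet> b) * \<phi> x)"
    and D': "integrable lborel D'" "AE x in lebesgue. D' x = indicat_real \<Omega> x *\<^sub>R D x"
  shows "(LINT z|lborel. w z *\<^sub>R gradient (std_bump r) (x - z)) = mollify (std_bump r) D' x"
proof (rule euclidean_eqI)
  fix b :: 'a assume b: "b \<in> Basis"
  note m = mollifier_std_bump[OF r, where 'a='a]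
  note [measurable] = mollifierD(7)[OF m] borel_measurable_integrable[OF D'(1)]
  have i: "integrable lborel (\<lambda>z. std_bump r (x - z) *\<^sub>R D' z)"
    by (rule mollify_integrand_integrable[OF m D'(1)])
  then have i': "integrable lebesgue (\<lambda>z. (std_bump r (x - z) *\<^sub>R D' z) \<bullet> b)"
    by (intro integrable_completion[THEN iffD2] integrable_inner_left) measurable
  have "(LINT z|lborel. w z *\<^sub>R gradient (std_bump r) (x - z)) \<bullet> b = (LINT z:\<Omega>|lebesgue. (D z \<bullet> b) * std_bump r (x - z))"
    using mollify_gradient_inner[OF r x w wh, of b] weak[OF std_bump_test_function[OF r x] b] by simp
  also have "\<dots> = (LINT z|lebesgue. (std_bump r (x - z) *\<^sub>R D' z) \<bullet> b)"
    unfolding set_lebesgue_integral_def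
  proof (rule integral_cong_AE[symmetric])
    show eq: "AE z in lebesgue. (std_bump r (x - z) *\<^sub>R D' z) \<bullet> b = indicat_real \<Omega> z *\<^sub>R ((D z \<bullet> b) * std_bump r (x - z))"
      using D'(2) by eventually_elim (simp add: mult_ac)
    show m1: "(\<lambda>z. (std_bump r (x - z) *\<^sub>R D' z) \<bullet> b) \<in> borel_measurable lebesgue"
      using i' by (rule borel_measurable_integrable)
    show "(\<lambda>z. indicat_real \<Omega> z *\<^sub>R ((D z \<bullet> b) * std_bump r (x - z))) \<in> borel_measurable lebesgue"
      by (rule borel_measurable_AE[OF m1]) (use eq in auto)
  qed
  also have "\<dots> = (LINT z|lborel. (std_bump r (x - z) *\<^sub>R D' z) \<bullet> b)"
    by (rule integral_completion) measurable
  also have "\<dots> = mollify (std_bump r) D' x \<bullet> b"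
    unfolding mollify_def by (rule integral_inner_left[OF i])
  finally show "(LINT z|lborel. w z *\<^sub>R gradient (std_bump r) (x - z)) \<bullet> b = mollify (std_bump r) D' x \<bullet> b" .
qed

text \<open>A distributional gradient controlled by the L^1 norm of test functions is bounded by
  \<open>K\<close> in each coordinate. Testing with a mollifier, whose L^1 norm is one, shows this
  for the gradients of the mollifications of \<open>W\<close>; the sum over coordinates gives the
  dimension factor. Continuity of \<open>W\<close> then allows the radius to tend to zero at the two
  given points.\<close>

lemma weak_bound_lipschitz:
  fixes W :: "'a::euclidean_space \<Rightarrow> real" and K :: real
  assumes op: "open \<Omega>" "bounded \<Omega>" and W: "continuous_on \<Omega> W" "\<And>x. x \<in> \<Omega> \<Longrightarrow> \<bar>W x\<bar> \<le> M" and K: "K \<ge> 0"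
    and weak: "\<And>\<phi> b. \<phi> \<in> C1_0 \<Omega> \<Longrightarrow> b \<in> Basis \<Longrightarrow>
        \<bar>LINT x:\<Omega>|lebesgue. W x * (gradient \<phi> x \<bullet> b)\<bar> \<le> K * (LINT x:\<Omega>|lebesgue. \<bar>\<phi> x\<bar>)"
    and ball: "ball c R \<subseteq> \<Omega>" and x: "x \<in> ball c R" and y: "y \<in> ball c R"
  shows "\<bar>W x - W y\<bar> \<le> DIM('a) * K * norm (x - y)"
proof -
  define w where "w = (\<lambda>x. indicat_real \<Omega> x *\<^sub>R W x)"
  have [measurable]: "w \<in> borel_measurable borel"
    unfolding w_def by (rule borel_measurable_continuous_on_indicator) (use op W in auto)
  have w: "integrable lborel w"
    by (rule integrableI_bounded_set[where A=\<Omega> and B=M])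
       (use op W emeasure_bounded_finite[OF op(2)] \<open>w \<in> borel_measurable borel\<close> in \<open>auto simp: w_def\<close>)
  have ww: "w z = W z" if "z \<in> \<Omega>" for z using that by (simp add: w_def)
  \<comment> \<open>A smaller concentric ball still containing \<open>x\<close> and
    \<open>y\<close>; the margin R - R' leaves room for the kernels.\<close>
  define R' where "R' = (R + max (dist c x) (dist c y)) / 2"
  have R': "dist c x < R'" "dist c y < R'" "R' < R" using x y unfolding R'_def by auto
  define s where "s n = (R - R') / 2 * inverse (real (Suc n))" for n
  have s: "s n > 0" "s n < R - R'" for n using R'(3) unfolding s_def by (auto simp: divide_simps add_pos_nonneg)
  have s0: "s \<longlonglongrightarrow> 0" unfolding s_def
    using tendsto_mult[OF tendsto_const[of "(R - R') / 2"] LIMSEQ_inverse_real_of_nat] by simp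
  have sub: "cball z (s n) \<subseteq> \<Omega>" if "z \<in> ball c R'" for z n
  proof
    fix t assume "t \<in> cball z (s n)"
    then have "dist c t < R" using that s(2)[of n] dist_triangle[of c t z] by auto
    then show "t \<in> \<Omega>" using ball by auto
  qed
  have bd: "norm (LINT z|lborel. w z *\<^sub>R gradient (std_bump (s n)) (t - z)) \<le> DIM('a) * K" (is "norm ?F \<le> _")
    if t: "t \<in> ball c R'" for t n
  proof -
    note m = mollifier_std_bump[OF s(1)[of n], where 'a='a]
    have \<phi>: "(\<lambda>z. std_bump (s n) (t - z)) \<in> C1_0 \<Omega>"
      using std_bump_test_function[OF s(1) sub[OF t]] Cinf_0_subset_C1_0 by blast
    have one: "(LINT z:\<Omega>|lebesgue. \<bar>std_bump (s n) (t - z)\<bar>) = 1"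
    proof -
      note [measurable] = mollifierD(7)[OF m]
      have "(LINT z:\<Omega>|lebesgue. \<bar>std_bump (s n) (t - z)\<bar>) = (LINT z|lebesgue. std_bump (s n) (t - z))"
        unfolding set_lebesgue_integral_def
      proof (rule Bochner_Integration.integral_cong[OF refl])
        fix z
        show "indicat_real \<Omega> z *\<^sub>R \<bar>std_bump (s n) (t - z)\<bar> = std_bump (s n) (t - z)"
        proof (cases "z \<in> \<Omega>")
          case False
          then have "norm (t - z) \<ge> s n" using sub[OF t, of n] by (force simp: dist_norm)
          then show ?thesis using False std_bump_eq_0[OF s(1)] by simp
        qed (use mollifierD(2)[OF m] in auto)
      qed
      also have "\<dots> = (LINT z|lborel. std_bump (s n) (t - z))" by (rule integral_completion) measurable
      finally show ?thesis using mollifierD(9)[OF m] by simp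
    qed
    have "\<bar>?F \<bullet> b\<bar> \<le> K" if "b \<in> Basis" for b
      using mollify_gradient_inner[OF s(1) sub[OF t] w ww, of n b] weak[OF \<phi> that] one by simp
    then have "(\<Sum>b\<in>Basis. \<bar>?F \<bullet> b\<bar>) \<le> (\<Sum>b\<in>(Basis::'a set). K)" by (rule sum_mono)
    then show ?thesis using norm_le_l1[of ?F] by simp
  qed
  have lip: "\<bar>mollify (std_bump (s n)) w x - mollify (std_bump (s n)) w y\<bar> \<le> DIM('a) * K * norm (x - y)" for n
    by (rule mean_value_C1_grad[OF C1_grad_subset[OF mollify_C1_grad[OF s(1) w] subset_UNIV] convex_ball[of c R']])
       (use R' bd in auto)
  have lim: "(\<lambda>n. mollify (std_bump (s n)) w t) \<longlonglongrightarrow> W t" if t: "t \<in> ball c R'" for t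
  proof (rule LIMSEQ_I)
    fix e :: real assume "e > 0"
    have t\<Omega>: "t \<in> \<Omega>" using sub[OF t, of 0] s(1)[of 0] by auto
    then obtain d where d: "d > 0" "\<And>z. z \<in> \<Omega> \<Longrightarrow> dist z t < d \<Longrightarrow> dist (W z) (W t) < e / 2"
      using W(1) \<open>e > 0\<close> unfolding continuous_on_iff by (meson half_gt_zero)
    obtain N where N: "\<And>n. n \<ge> N \<Longrightarrow> s n < d"
      using order_tendstoD(2)[OF s0 d(1)] unfolding eventually_sequentially by blast
    have "norm (mollify (std_bump (s n)) w t - W t) < e" if "n \<ge> N" for n
    proof -
      have "norm (mollify (std_bump (s n)) w t - W t) \<le> e / 2"
      proof (rule norm_mollify_diff_le[OF mollifier_std_bump[OF s(1)] w])
        fix z assume z: "norm (t - z) \<le> s n"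
        then have "z \<in> \<Omega>" using sub[OF t, of n] by (auto simp: dist_norm)
        then show "norm (w z - W t) \<le> e / 2"
          using d(2)[of z] z N[OF that] ww[of z] by (simp add: dist_norm norm_minus_commute)
      qed (use \<open>e > 0\<close> in simp)
      then show ?thesis using \<open>e > 0\<close> by simp
    qed
    then show "\<exists>no. \<forall>n\<ge>no. norm (mollify (std_bump (s n)) w t - W t) < e" by blast
  qed
  have "(\<lambda>n. \<bar>mollify (std_bump (s n)) w x - mollify (std_bump (s n)) w y\<bar>) \<longlonglongrightarrow> \<bar>W x - W y\<bar>"
    using R' by (intro tendsto_intros lim) auto
  then show ?thesis by (rule LIMSEQ_le_const2) (use lip in blast)
qed

section \<open>Approximation of weak gradients in the weight of the p-flux\<close>

section \<open>Strong approximation of weak solutions\<close>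

lemma set_integral_lebesgue_on:
  fixes f :: "'a::euclidean_space \<Rightarrow> 'b::euclidean_space"
  assumes "\<Omega> \<in> sets lebesgue"
  shows "(LINT x:\<Omega>|lebesgue. f x) = integral\<^sup>L (lebesgue_on \<Omega>) f"
    "set_integrable lebesgue \<Omega> f \<longleftrightarrow> integrable (lebesgue_on \<Omega>) f"
    "set_borel_measurable lebesgue \<Omega> f \<longleftrightarrow> f \<in> borel_measurable (lebesgue_on \<Omega>)"
  using assms
  by (auto simp: set_lebesgue_integral_def set_integrable_def set_borel_measurable_def
      integral_restrict_space integrable_restrict_space borel_measurable_restrict_space_iff)

lemma Lp_onD:
  fixes f :: "'a::euclidean_space \<Rightarrow> 'b::euclidean_space"
  assumes "\<Omega> \<in> sets lebesgue" "Lp_on p \<Omega> f"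
  shows "f \<in> borel_measurable (lebesgue_on \<Omega>)" "integrable (lebesgue_on \<Omega>) (\<lambda>x. norm (f x) powr p)"
  using assms(2) set_integral_lebesgue_on(2,3)[OF assms(1)] unfolding Lp_on_def by blast+

lemma finite_measure_lebesgue_on_bounded:
  fixes \<Omega> :: "'a::euclidean_space set"
  assumes "\<Omega> \<in> sets lebesgue" "bounded \<Omega>" shows "finite_measure (lebesgue_on \<Omega>)"
proof (rule finite_measure_lebesgue_on)
  show "\<Omega> \<in> lmeasurable" using assms bounded_set_imp_lmeasurable by blast
qed

lemma powr_le_1_plus:
  fixes t :: real assumes "0 \<le> t" "q \<le> p" "q > 0" shows "t powr q \<le> 1 + t powr p"
proof (cases "t \<le> 1")
  case True
  then have "t powr q \<le> 1" using assms by (intro powr_le1) auto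
  then show ?thesis by (simp add: add_increasing2)
next
  case False
  then have "t powr q \<le> t powr p" using assms by (intro powr_mono) auto
  then show ?thesis by simp
qed

lemma Lp_integrable_powr:
  fixes f :: "'a::euclidean_space \<Rightarrow> 'b::euclidean_space"
  assumes \<Omega>: "\<Omega> \<in> sets lebesgue" "bounded \<Omega>" and f: "Lp_on p \<Omega> f" and q: "0 < q" "q \<le> p"
  shows "integrable (lebesgue_on \<Omega>) (\<lambda>x. norm (f x) powr q)"
proof (rule Bochner_Integration.integrable_bound)
  interpret finite_measure "lebesgue_on \<Omega>" by (rule finite_measure_lebesgue_on_bounded[OF \<Omega>])
  show "integrable (lebesgue_on \<Omega>) (\<lambda>x. 1 + norm (f x) powr p)"
    using Lp_onD[OF \<Omega>(1) f] by auto
  show "(\<lambda>x. norm (f x) powr q) \<in> borel_measurable (lebesgue_on \<Omega>)"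
    using Lp_onD(1)[OF \<Omega>(1) f] by measurable
  show "AE x in lebesgue_on \<Omega>. norm (norm (f x) powr q) \<le> norm (1 + norm (f x) powr p)"
    using powr_le_1_plus[OF norm_ge_zero q(2,1)] by (intro AE_I2) (simp add: add_nonneg_nonneg)
qed

lemma Lp_integrable:
  fixes f :: "'a::euclidean_space \<Rightarrow> 'b::euclidean_space"
  assumes \<Omega>: "\<Omega> \<in> sets lebesgue" "bounded \<Omega>" and f: "Lp_on p \<Omega> f" and p: "1 < p"
  shows "integrable (lebesgue_on \<Omega>) f"
proof -
  have "integrable (lebesgue_on \<Omega>) (\<lambda>x. norm (f x) powr 1)"
    by (rule Lp_integrable_powr[OF \<Omega> f]) (use p in auto)
  then have "integrable (lebesgue_on \<Omega>) (\<lambda>x. norm (f x))" by simp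
  then show ?thesis using Lp_onD(1)[OF \<Omega>(1) f] integrable_norm_cancel by blast
qed

lemma integrable_bounded_mult:
  fixes f :: "'a \<Rightarrow> real"
  assumes "integrable M f" "k \<in> borel_measurable M" "AE x in M. \<bar>k x\<bar> \<le> B"
  shows "integrable M (\<lambda>x. f x * k x)"
proof (rule Bochner_Integration.integrable_bound)
  show "integrable M (\<lambda>x. B * f x)" using assms(1) by auto
  show "AE x in M. norm (f x * k x) \<le> norm (B * f x)"
    using assms(3)
  proof eventually_elim
    case (elim x)
    then show ?case
      using mult_left_mono[OF elim abs_ge_zero[of "f x"]] by (simp add: abs_mult mult.commute)
  qed
qed (use assms in auto)

text \<open>The comparison of \<open>t\<close> with \<open>\<tau> * s\<close> decides which term
  dominates. The point is that the coefficient of \<open>s powr p\<close> is arbitrarily small,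
  while that of \<open>t powr p\<close> depends on \<tau> and \<open>p\<close> alone.\<close>

lemma young_weight:
  fixes s t \<tau> p :: real
  assumes "s \<ge> 0" "t \<ge> 0" "\<tau> > 0" "p > 1"
  shows "s powr (p - 1) * t \<le> \<tau> * s powr p + \<tau> powr (1 - p) * t powr p"
proof (cases "t \<le> \<tau> * s")
  case True
  have "s powr (p - 1) * t \<le> s powr (p - 1) * (\<tau> * s)" using True by (intro mult_left_mono) auto
  also have "\<dots> = \<tau> * s powr p"
    using assms by (cases "s = 0") (auto simp: powr_diff)
  finally show ?thesis by (simp add: add_increasing2)
next
  case False
  then have "s \<le> t / \<tau>" using assms by (simp add: field_simps)
  then have "s powr (p - 1) * t \<le> (t / \<tau>) powr (p - 1) * t"
    using assms by (intro mult_right_mono powr_mono2) auto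
  also have "\<dots> = \<tau> powr (1 - p) * t powr p"
    using assms by (cases "t = 0") (auto simp: powr_divide powr_diff)
  finally show ?thesis using assms by (simp add: add_increasing)
qed

text \<open>Upgrades L^p convergence to L^1 convergence with the weight that bounds the p-flux of
  \<open>G\<close>. The weighted Young inequality leaves \<tau> times a fixed integral plus a
  multiple of the L^p error, so \<tau> is chosen first and the index afterwards.\<close>

lemma weighted_L1_convergence:
  fixes G H :: "'a::euclidean_space \<Rightarrow> 'b::euclidean_space" and A :: "nat \<Rightarrow> 'a \<Rightarrow> 'b"
  assumes \<Omega>: "\<Omega> \<in> sets lebesgue" "bounded \<Omega>" and p: "1 < p"
    and G: "Lp_on p \<Omega> G" and H: "H \<in> borel_measurable (lebesgue_on \<Omega>)"
    and A: "\<And>n. A n \<in> borel_measurable (lebesgue_on \<Omega>)"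
    and i: "\<And>n. integrable (lebesgue_on \<Omega>) (\<lambda>x. norm (H x - A n x) powr p)"
    and lim: "(\<lambda>n. LINT x|lebesgue_on \<Omega>. norm (H x - A n x) powr p) \<longlonglongrightarrow> 0"
  shows "integrable (lebesgue_on \<Omega>) (\<lambda>x. (1 + norm (G x) powr (p - 1)) * norm (A n x - H x))"
    "(\<lambda>n. LINT x|lebesgue_on \<Omega>. (1 + norm (G x) powr (p - 1)) * norm (A n x - H x)) \<longlonglongrightarrow> 0"
proof -
  interpret finite_measure "lebesgue_on \<Omega>" by (rule finite_measure_lebesgue_on_bounded[OF \<Omega>])
  let ?M = "lebesgue_on \<Omega>"
  let ?q = "\<lambda>n x. (1 + norm (G x) powr (p - 1)) * norm (A n x - H x)"
  note [measurable] = Lp_onD(1)[OF \<Omega>(1) G] H A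
  have iG: "integrable ?M (\<lambda>x. 1 + norm (G x) powr p)" using Lp_onD(2)[OF \<Omega>(1) G] by auto
  \<comment> \<open>Young is applied with s = |G| and with s = 1, one for each summand of the
    weight; this accounts for the factor 2.\<close>
  have pt: "?q n x \<le> \<tau> * (1 + norm (G x) powr p) + 2 * \<tau> powr (1 - p) * norm (H x - A n x) powr p" if "\<tau> > 0" for \<tau> n x
    using young_weight[OF norm_ge_zero[of "G x"] norm_ge_zero[of "H x - A n x"] that p]
      young_weight[OF zero_le_one norm_ge_zero[of "H x - A n x"] that p]
    by (simp add: norm_minus_commute algebra_simps)
  have ib: "integrable ?M (\<lambda>x. \<tau> * (1 + norm (G x) powr p) + 2 * \<tau> powr (1 - p) * norm (H x - A n x) powr p)" for \<tau> n
    by (intro Bochner_Integration.integrable_add[OF integrable_mult_right[OF iG] integrable_mult_right[OF i]])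
  have nn: "?q n x \<ge> 0" for n x by (intro mult_nonneg_nonneg) (auto simp: add_nonneg_nonneg)
  show iq: "integrable ?M (?q n)" for n
  proof (rule Bochner_Integration.integrable_bound[OF ib[of 1 n]])
    show "AE x in ?M. norm (?q n x) \<le> norm (1 * (1 + norm (G x) powr p) + 2 * 1 powr (1 - p) * norm (H x - A n x) powr p)"
    proof (rule AE_I2)
      fix x
      show "norm (?q n x) \<le> norm (1 * (1 + norm (G x) powr p) + 2 * 1 powr (1 - p) * norm (H x - A n x) powr p)"
        unfolding real_norm_def using pt[of 1 x n] nn[of x n] by linarith
    qed
  qed measurable
  define a where "a = (LINT x|?M. 1 + norm (G x) powr p)"
  have a: "a \<ge> 0" unfolding a_def by (intro Bochner_Integration.integral_nonneg) (auto simp: add_nonneg_nonneg)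
  have bd: "(LINT x|?M. ?q n x) \<le> \<tau> * a + 2 * \<tau> powr (1 - p) * (LINT x|?M. norm (H x - A n x) powr p)" if "\<tau> > 0" for \<tau> n
  proof -
    have "(LINT x|?M. ?q n x) \<le> (LINT x|?M. \<tau> * (1 + norm (G x) powr p) + 2 * \<tau> powr (1 - p) * norm (H x - A n x) powr p)"
      by (rule integral_mono[OF iq ib]) (rule pt[OF that])
    also have "\<dots> = \<tau> * a + 2 * \<tau> powr (1 - p) * (LINT x|?M. norm (H x - A n x) powr p)"
      unfolding a_def Bochner_Integration.integral_add[OF integrable_mult_right[OF iG] integrable_mult_right[OF i]]
      by (simp only: integral_mult_right_zero)
    finally show ?thesis .
  qed
  show "(\<lambda>n. LINT x|?M. ?q n x) \<longlonglongrightarrow> 0"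
  proof (rule LIMSEQ_I)
    fix e :: real assume "e > 0"
    define \<tau> where "\<tau> = e / (2 * (a + 1))"
    have \<tau>: "\<tau> > 0" unfolding \<tau>_def using \<open>e > 0\<close> a by simp
    have "\<tau> * a \<le> \<tau> * (a + 1)" using \<tau> by simp
    also have "\<dots> = e / 2" unfolding \<tau>_def using a by (simp add: field_simps)
    finally have ta: "\<tau> * a \<le> e / 2" .
    have "(\<lambda>n. 2 * \<tau> powr (1 - p) * (LINT x|?M. norm (H x - A n x) powr p)) \<longlonglongrightarrow> 2 * \<tau> powr (1 - p) * 0"
      by (intro tendsto_mult tendsto_const lim)
    then have "eventually (\<lambda>n. 2 * \<tau> powr (1 - p) * (LINT x|?M. norm (H x - A n x) powr p) < e / 2) sequentially"
      using \<open>e > 0\<close> by (intro order_tendstoD) auto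
    then obtain N where N: "\<And>n. n \<ge> N \<Longrightarrow> 2 * \<tau> powr (1 - p) * (LINT x|?M. norm (H x - A n x) powr p) < e / 2"
      unfolding eventually_sequentially by blast
    have "norm ((LINT x|?M. ?q n x) - 0) < e" if "n \<ge> N" for n
    proof -
      have "(LINT x|?M. ?q n x) \<ge> 0" using nn by (intro Bochner_Integration.integral_nonneg) auto
      then show ?thesis using bd[OF \<tau>, of n] N[OF that] ta by simp
    qed
    then show "\<exists>no. \<forall>n\<ge>no. norm ((LINT x|?M. ?q n x) - 0) < e" by blast
  qed
qed

lemma lipschitz_weak_gradient_approx:
  fixes h :: "'a::euclidean_space \<Rightarrow> real"
  assumes op: "open \<Omega>" "bounded \<Omega>" and h: "C-lipschitz_on UNIV h"
    and D: "integrable (lebesgue_on \<Omega>) D"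
    and weak: "\<And>\<phi> b. \<phi> \<in> Cinf_0 \<Omega> \<Longrightarrow> b \<in> Basis \<Longrightarrow>
        (LINT x:\<Omega>|lebesgue. h x * (gradient \<phi> x \<bullet> b)) = - (LINT x:\<Omega>|lebesgue. (D x \<bullet> b) * \<phi> x)"
  obtains f F where "\<And>i::nat. C1_grad UNIV (f i) (F i)" "\<And>i x. x \<in> \<Omega> \<Longrightarrow> norm (F i x) \<le> C"
    "\<And>e. e > 0 \<Longrightarrow> \<forall>\<^sub>F i in sequentially. \<forall>x\<in>closure \<Omega>. \<bar>f i x - h x\<bar> < e"
    "AE x in lebesgue_on \<Omega>. (\<lambda>i. F i x) \<longlonglongrightarrow> D x"
proof -
  have sl: "\<Omega> \<in> sets lebesgue" using op(1) by auto
  have C0: "C \<ge> 0" using h by (rule lipschitz_on_nonneg)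
  obtain R0 where R0: "\<And>x. x \<in> closure \<Omega> \<Longrightarrow> norm x \<le> R0"
    using bounded_closure[OF op(2)] unfolding bounded_iff by blast
  define R where "R = R0 + 2"
  have R: "norm x + 1 < R" if "x \<in> closure \<Omega>" for x using R0[OF that] by (simp add: R_def)
  have R\<Omega>: "norm x + 1 < R" if "x \<in> \<Omega>" for x using R that closure_subset by blast
  define s where "s i = inverse (real (Suc i))" for i
  have s: "0 < s i" "s i \<le> 1" for i unfolding s_def by (auto simp: inverse_le_1_iff)
  have s0: "s \<longlonglongrightarrow> 0" unfolding s_def by (rule LIMSEQ_inverse_real_of_nat)
  define w where "w = (\<lambda>x. indicat_real (cball 0 R) x *\<^sub>R h x)"
  have rs: "norm x + s i < R" if "x \<in> closure \<Omega>" for x i using R[OF that] s(2)[of i] by linarith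
  note ml = mollify_lipschitz[OF s(1) h rs w_def]
  have D1: "integrable lebesgue (\<lambda>x. indicat_real \<Omega> x *\<^sub>R D x)"
    using D sl by (simp add: integrable_restrict_space)
  obtain D0 where D0: "integrable lborel D0" "AE x in lebesgue. D0 x = indicat_real \<Omega> x *\<^sub>R D x"
    using lebesgue_integrable_borel_version[OF D1] by blast
  \<comment> \<open>The Borel version vanishes outside \<Omega> only almost everywhere; the cut-off
    makes it vanish at every point outside the ball, as the convergence lemma demands.\<close>
  define D' where "D' x = indicat_real (cball 0 R) x *\<^sub>R D0 x" for x
  have D': "integrable lborel D'" unfolding D'_def by (rule integrable_kernel_mult[where B=1, OF D0(1) borel_measurable_indicator]) auto
  have D'ae: "AE x in lebesgue. D' x = indicat_real \<Omega> x *\<^sub>R D x"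
    using D0(2)
  proof eventually_elim
    case (elim x)
    then show ?case unfolding D'_def using R\<Omega>[of x] by (auto simp: indicator_def)
  qed
  have L1: "(\<lambda>i. LINT x|lborel. norm (mollify (std_bump (s i)) D' x - D' x)) \<longlonglongrightarrow> 0"
    by (rule mollify_tendsto_L1[OF D' _ mollifier_std_bump[OF s(1)] s0, of R]) (auto simp: D'_def)
  obtain r where r: "strict_mono r" "AE x in lborel. (\<lambda>i. mollify (std_bump (s (r i))) D' x - D' x) \<longlonglongrightarrow> 0"
    using tendsto_L1_AE_subseq[OF _ L1] mollify_L1(1)[OF mollifier_std_bump[OF s(1)] D'] D' by blast
  define f where "f i = mollify (std_bump (s (r i))) w" for i
  define F where "F i x = (LINT z|lborel. w z *\<^sub>R gradient (std_bump (s (r i))) (x - z))" for i x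
  have sr0: "(\<lambda>i. s (r i)) \<longlonglongrightarrow> 0" using LIMSEQ_subseq_LIMSEQ[OF s0 r(1)] by (simp add: o_def)
  have wh: "w z = h z" if "z \<in> \<Omega>" for z using R\<Omega>[OF that] by (simp add: w_def)
  have wi: "integrable lborel w"
    unfolding w_def
    by (rule borel_integrable_compact[OF compact_cball continuous_on_subset[OF lipschitz_on_continuous_on[OF h]]]) simp
  show ?thesis
  proof (rule that[of f F])
    show "C1_grad UNIV (f i) (F i)" for i
      unfolding f_def F_def by (rule mollify_C1_grad[OF s(1) wi])
    show "norm (F i x) \<le> C" if "x \<in> \<Omega>" for i x
      unfolding F_def by (rule ml(3)) (use that closure_subset in blast)
    show "\<forall>\<^sub>F i in sequentially. \<forall>x\<in>closure \<Omega>. \<bar>f i x - h x\<bar> < e" if "e > 0" for e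
    proof -
      have "(\<lambda>i. C * s (r i)) \<longlonglongrightarrow> C * 0" by (intro tendsto_intros sr0)
      then have "eventually (\<lambda>i. C * s (r i) < e) sequentially" using that by (intro order_tendstoD) auto
      then show ?thesis
      proof eventually_elim
        case (elim i)
        then show ?case using ml(2)[of _ "r i"] unfolding f_def by (meson order_le_less_trans)
      qed
    qed
    have "AE x in lebesgue. x \<in> \<Omega> \<longrightarrow> (\<lambda>i. F i x) \<longlonglongrightarrow> D x"
      using D'ae AE_completion[OF r(2)]
    proof eventually_elim
      case (elim x)
      show ?case
      proof
        assume x: "x \<in> \<Omega>"
        obtain d where d: "d > 0" "cball x d \<subseteq> \<Omega>" using op(1) x open_contains_cball by blast
        have "eventually (\<lambda>i. s (r i) < d) sequentially" using order_tendstoD(2)[OF sr0 d(1)] .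
        then have ev: "eventually (\<lambda>i. mollify (std_bump (s (r i))) D' x = F i x) sequentially"
        proof eventually_elim
          case (elim i)
          then have "cball x (s (r i)) \<subseteq> \<Omega>" using d(2) by auto
          then show ?case
            unfolding F_def using mollify_gradient_eq_mollify_weak[OF s(1) _ wi wh weak D' D'ae] by simp
        qed
        have "(\<lambda>i. mollify (std_bump (s (r i))) D' x - D' x + D' x) \<longlonglongrightarrow> 0 + D' x"
          by (intro tendsto_add tendsto_const elim(2))
        then have "(\<lambda>i. mollify (std_bump (s (r i))) D' x) \<longlonglongrightarrow> D x"
          using elim(1) x by simp
        then show "(\<lambda>i. F i x) \<longlonglongrightarrow> D x"
          by (rule Lim_transform_eventually[OF _ ev])
      qed
    qed
    then show "AE x in lebesgue_on \<Omega>. (\<lambda>i. F i x) \<longlonglongrightarrow> D x"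
      using sl by (simp add: AE_restrict_space_iff)
  qed
qed


lemma tendsto_of_powr_tendsto:
  fixes a :: "nat \<Rightarrow> real"
  assumes "(\<lambda>n. \<bar>a n\<bar> powr p) \<longlonglongrightarrow> 0" "p > 0" shows "a \<longlonglongrightarrow> 0"
proof -
  have "(\<lambda>n. (\<bar>a n\<bar> powr p) powr (1 / p)) \<longlonglongrightarrow> 0"
    by (rule tendsto_zero_powrI[OF assms(1) tendsto_const]) (use assms in auto)
  then have "(\<lambda>n. \<bar>a n\<bar>) \<longlonglongrightarrow> 0" using assms(2) by (simp add: powr_powr)
  then show ?thesis by (simp add: tendsto_rabs_zero_iff)
qed

lemma C1_0_integrable_mult:
  fixes f :: "'a::euclidean_space \<Rightarrow> real"
  assumes \<Omega>: "\<Omega> \<in> sets lebesgue" and f: "integrable (lebesgue_on \<Omega>) f" and \<phi>: "\<phi> \<in> C1_0 \<Omega>"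
  shows "integrable (lebesgue_on \<Omega>) (\<lambda>x. f x * \<phi> x)"
    "integrable (lebesgue_on \<Omega>) (\<lambda>x. f x * (gradient \<phi> x \<bullet> b))"
proof -
  obtain K where K: "compact K" "\<And>x. x \<notin> K \<Longrightarrow> \<phi> x = 0" using C1_0_D(2)[OF \<phi>] by blast
  note C1 = C1_0_D(1)[OF \<phi>]
  obtain B where B: "B \<ge> 0" "\<And>x. \<bar>\<phi> x\<bar> \<le> B" "\<And>x. norm (gradient \<phi> x) \<le> B"
    using C1_compact_support_bounds[OF C1 K] by blast
  have c: "continuous_on \<Omega> \<phi>" "continuous_on \<Omega> (gradient \<phi>)"
    using C1_grad_continuous[OF C1] C1_gradD(2)[OF C1] continuous_on_subset by blast+
  show "integrable (lebesgue_on \<Omega>) (\<lambda>x. f x * \<phi> x)"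
    by (rule integrable_bounded_mult[OF f continuous_imp_measurable_on_sets_lebesgue[OF c(1) \<Omega>]]) (use B in auto)
  show "integrable (lebesgue_on \<Omega>) (\<lambda>x. f x * (gradient \<phi> x \<bullet> b))"
  proof (rule integrable_bounded_mult[OF f])
    show "(\<lambda>x. gradient \<phi> x \<bullet> b) \<in> borel_measurable (lebesgue_on \<Omega>)"
      by (rule continuous_imp_measurable_on_sets_lebesgue[OF _ \<Omega>]) (intro continuous_intros c)
    show "AE x in lebesgue_on \<Omega>. \<bar>gradient \<phi> x \<bullet> b\<bar> \<le> B * norm b"
    proof (rule AE_I2)
      fix x
      show "\<bar>gradient \<phi> x \<bullet> b\<bar> \<le> B * norm b"
        using Cauchy_Schwarz_ineq2[of "gradient \<phi> x" b] mult_right_mono[OF B(3)[of x] norm_ge_zero[of b]] by linarith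
    qed
  qed
qed

text \<open>The two parts of the approximation converge for different reasons: the test functions in
  the L^p norm, by the definition of \<open>W1p_0\<close>, and the mollified extension almost
  everywhere with bounded gradients. Both imply convergence in the weighted L^1 sense. Since the
  test functions have compact support, the approximants equal the mollified extension near the
  boundary and are uniformly close to \<open>h\<close> there.\<close>

lemma weak_solution_approximation:
  fixes u :: "'a::euclidean_space \<Rightarrow> real"
  assumes op: "open \<Omega>" "bounded \<Omega>" "\<Omega> \<noteq> {}" and p: "p > 1"
    and uG: "W1p_grad p \<Omega> u G" and bv: "has_boundary_value p \<Omega> u g"
  obtains v V h where "\<And>i::nat. C1_grad UNIV (v i) (V i)"
    "AE x in lebesgue_on \<Omega>. (\<lambda>i. v i x) \<longlonglongrightarrow> u x"
    "\<And>i. integrable (lebesgue_on \<Omega>) (\<lambda>x. (1 + norm (G x) powr (p - 1)) * norm (V i x - G x))"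
    "(\<lambda>i. LINT x|lebesgue_on \<Omega>. (1 + norm (G x) powr (p - 1)) * norm (V i x - G x)) \<longlonglongrightarrow> 0"
    "continuous_on (closure \<Omega>) h" "\<And>x. x \<in> frontier \<Omega> \<Longrightarrow> h x = g x"
    "\<And>e. e > 0 \<Longrightarrow> \<forall>\<^sub>F i in sequentially. \<exists>K. compact K \<and> K \<subseteq> \<Omega> \<and> (\<forall>x\<in>closure \<Omega> - K. \<bar>v i x - h x\<bar> < e)"
proof -
  have sl: "\<Omega> \<in> sets lebesgue" using op(1) by auto
  let ?M = "lebesgue_on \<Omega>"
  interpret finite_measure ?M by (rule finite_measure_lebesgue_on_bounded[OF sl op(2)])
  obtain h0 C where h0: "C-lipschitz_on (closure \<Omega>) h0" "\<And>x. x \<in> frontier \<Omega> \<Longrightarrow> h0 x = g x"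
    and w0: "(\<lambda>x. u x - h0 x) \<in> W1p_0 p \<Omega>"
    using bv unfolding has_boundary_value_def by blast
  obtain h where h: "C-lipschitz_on UNIV h" "\<And>x. x \<in> closure \<Omega> \<Longrightarrow> h x = h0 x"
    using McShane_extension[OF h0(1)] op(3) closure_eq_empty by metis
  have h\<Omega>: "h x = h0 x" if "x \<in> \<Omega>" for x using h(2) that closure_subset by blast
  obtain H \<phi> where H: "W1p_grad p \<Omega> (\<lambda>x. u x - h0 x) H" and \<phi>: "\<And>n::nat. \<phi> n \<in> Cinf_0 \<Omega>"
    and l1: "(\<lambda>n. LINT x:\<Omega>|lebesgue. \<bar>(u x - h0 x) - \<phi> n x\<bar> powr p) \<longlonglongrightarrow> 0"
    and l2: "(\<lambda>n. LINT x:\<Omega>|lebesgue. norm (H x - gradient (\<phi> n) x) powr p) \<longlonglongrightarrow> 0"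
    using w0 unfolding W1p_0_def by blast
  have Lp: "Lp_on p \<Omega> u" "Lp_on p \<Omega> G" "Lp_on p \<Omega> (\<lambda>x. u x - h0 x)" "Lp_on p \<Omega> H"
    using uG H unfolding W1p_grad_def by auto
  have int: "integrable ?M u" "integrable ?M G" "integrable ?M (\<lambda>x. u x - h0 x)" "integrable ?M H"
    using Lp by (auto intro: Lp_integrable[OF sl op(2) _ p])
  have mes: "u \<in> borel_measurable ?M" "G \<in> borel_measurable ?M" "(\<lambda>x. u x - h0 x) \<in> borel_measurable ?M" "H \<in> borel_measurable ?M"
    using int by auto
  have \<phi>1: "\<phi> n \<in> C1_0 \<Omega>" for n using \<phi> Cinf_0_subset_C1_0 by blast
  note C\<phi> = C1_0_D(1)[OF \<phi>1]
  have m\<phi>: "\<phi> n \<in> borel_measurable ?M" "gradient (\<phi> n) \<in> borel_measurable ?M" for n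
    using continuous_on_subset[OF C1_grad_continuous[OF C\<phi>] subset_UNIV]
      continuous_on_subset[OF C1_gradD(2)[OF C\<phi>] subset_UNIV]
    by (auto intro!: continuous_imp_measurable_on_sets_lebesgue[OF _ sl])
  \<comment> \<open>Subtracting the weak identities of \<open>u\<close> and of \<open>u - h0\<close>
    shows that this difference is the weak gradient of the extension \<open>h\<close>.\<close>
  define D where "D x = G x - H x" for x
  have D: "integrable ?M D" unfolding D_def using int by auto
  have weak: "(LINT x:\<Omega>|lebesgue. h x * (gradient \<psi> x \<bullet> b)) = - (LINT x:\<Omega>|lebesgue. (D x \<bullet> b) * \<psi> x)"
    if \<psi>: "\<psi> \<in> Cinf_0 \<Omega>" and b: "b \<in> Basis" for \<psi> b
  proof -
    have \<psi>1: "\<psi> \<in> C1_0 \<Omega>" using \<psi> Cinf_0_subset_C1_0 by blast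
    note i1 = C1_0_integrable_mult[OF sl _ \<psi>1]
    have eq1: "(LINT x|?M. u x * (gradient \<psi> x \<bullet> b)) = - (LINT x|?M. (G x \<bullet> b) * \<psi> x)"
      and eq2: "(LINT x|?M. (u x - h0 x) * (gradient \<psi> x \<bullet> b)) = - (LINT x|?M. (H x \<bullet> b) * \<psi> x)"
      using uG H \<psi> b unfolding W1p_grad_def set_integral_lebesgue_on(1)[OF sl] by blast+
    have "(LINT x|?M. h x * (gradient \<psi> x \<bullet> b)) = (LINT x|?M. u x * (gradient \<psi> x \<bullet> b) - (u x - h0 x) * (gradient \<psi> x \<bullet> b))"
      by (rule Bochner_Integration.integral_cong) (auto simp: h\<Omega> algebra_simps)
    also have "\<dots> = (LINT x|?M. u x * (gradient \<psi> x \<bullet> b)) - (LINT x|?M. (u x - h0 x) * (gradient \<psi> x \<bullet> b))"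
      by (rule Bochner_Integration.integral_diff[OF i1(2)[OF int(1)] i1(2)[OF int(3)]])
    also have "\<dots> = - ((LINT x|?M. (G x \<bullet> b) * \<psi> x) - (LINT x|?M. (H x \<bullet> b) * \<psi> x))"
      unfolding eq1 eq2 by simp
    also have "(LINT x|?M. (G x \<bullet> b) * \<psi> x) - (LINT x|?M. (H x \<bullet> b) * \<psi> x) = (LINT x|?M. (G x \<bullet> b) * \<psi> x - (H x \<bullet> b) * \<psi> x)"
      by (rule Bochner_Integration.integral_diff[symmetric, OF i1(1) i1(1)]) (use int in auto)
    also have "\<dots> = (LINT x|?M. (D x \<bullet> b) * \<psi> x)"
      unfolding D_def by (simp add: algebra_simps)
    finally show ?thesis unfolding set_integral_lebesgue_on(1)[OF sl] .
  qed
  obtain f F where f: "\<And>i::nat. C1_grad UNIV (f i) (F i)" "\<And>i x. x \<in> \<Omega> \<Longrightarrow> norm (F i x) \<le> C"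
    "\<And>e. e > 0 \<Longrightarrow> \<forall>\<^sub>F i in sequentially. \<forall>x\<in>closure \<Omega>. \<bar>f i x - h x\<bar> < e"
    "AE x in ?M. (\<lambda>i. F i x) \<longlonglongrightarrow> D x"
    using lipschitz_weak_gradient_approx[OF op(1,2) h(1) D weak] by blast
  have bound\<phi>: "\<exists>B\<ge>0. (\<forall>x. \<bar>\<phi> n x\<bar> \<le> B) \<and> (\<forall>x. norm (gradient (\<phi> n) x) \<le> B)" for n
  proof -
    obtain K where "compact K" "\<And>x. x \<notin> K \<Longrightarrow> \<phi> n x = 0" using C1_0_D(2)[OF \<phi>1[of n]] by blast
    then show ?thesis using C1_compact_support_bounds[OF C\<phi>[of n]] by metis
  qed
  have ip: "integrable ?M (\<lambda>x. norm (X x - Y x) powr p)"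
    if X: "Lp_on p \<Omega> X" and Y: "Y \<in> borel_measurable ?M" "\<And>x. norm (Y x) \<le> B"
    for X Y :: "'a \<Rightarrow> 'c::euclidean_space" and B
  proof (rule Bochner_Integration.integrable_bound)
    note [measurable] = Lp_onD(1)[OF sl X] Y(1)
    show "integrable ?M (\<lambda>x. 2 powr p * (norm (X x) powr p + B powr p))"
      using Lp_onD(2)[OF sl X] by (intro integrable_mult_right Bochner_Integration.integrable_add) auto
    show "(\<lambda>x. norm (X x - Y x) powr p) \<in> borel_measurable ?M" by measurable
    show "AE x in ?M. norm (norm (X x - Y x) powr p) \<le> norm (2 powr p * (norm (X x) powr p + B powr p))"
    proof (rule AE_I2)
      fix x
      have B0: "B \<ge> 0" using Y(2)[of x] norm_ge_zero order_trans by blast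
      have "norm (X x - Y x) \<le> 2 * max (norm (X x)) B"
        using norm_triangle_ineq4[of "X x" "Y x"] Y(2)[of x] by linarith
      then have "norm (X x - Y x) powr p \<le> (2 * max (norm (X x)) B) powr p"
        using p by (intro powr_mono2) auto
      also have "\<dots> = 2 powr p * max (norm (X x)) B powr p" using B0 by (simp add: powr_mult max_def)
      also have "\<dots> \<le> 2 powr p * (norm (X x) powr p + B powr p)"
        by (intro mult_left_mono) (auto simp: max_def)
      finally show "norm (norm (X x - Y x) powr p) \<le> norm (2 powr p * (norm (X x) powr p + B powr p))" by simp
    qed
  qed
  have ip1: "integrable ?M (\<lambda>x. \<bar>(u x - h0 x) - \<phi> n x\<bar> powr p)" for n
  proof -
    obtain B where "\<And>x. \<bar>\<phi> n x\<bar> \<le> B" using bound\<phi>[of n] by blast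
    then show ?thesis using ip[OF Lp(3) m\<phi>(1)[of n], of B] by simp
  qed
  have ip2: "integrable ?M (\<lambda>x. norm (H x - gradient (\<phi> n) x) powr p)" for n
  proof -
    obtain B where "\<And>x. norm (gradient (\<phi> n) x) \<le> B" using bound\<phi>[of n] by blast
    then show ?thesis using ip[OF Lp(4) m\<phi>(2)[of n], of B] by simp
  qed
  have l1': "(\<lambda>n. LINT x|?M. norm (\<bar>(u x - h0 x) - \<phi> n x\<bar> powr p)) \<longlonglongrightarrow> 0"
    using l1 unfolding set_integral_lebesgue_on(1)[OF sl] by simp
  obtain q where q: "strict_mono q" "AE x in ?M. (\<lambda>n. \<bar>(u x - h0 x) - \<phi> (q n) x\<bar> powr p) \<longlonglongrightarrow> 0"
    using tendsto_L1_AE_subseq[OF ip1 l1'] by blast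
  have l2': "(\<lambda>n. LINT x|?M. norm (H x - gradient (\<phi> (q n)) x) powr p) \<longlonglongrightarrow> 0"
    using LIMSEQ_subseq_LIMSEQ[OF l2 q(1)] unfolding set_integral_lebesgue_on(1)[OF sl] o_def .
  note w1 = weighted_L1_convergence[OF sl op(2) p Lp(2) mes(4) m\<phi>(2) ip2 l2']
  define v where "v i x = \<phi> (q i) x + f i x" for i x
  define V where "V i x = gradient (\<phi> (q i)) x + F i x" for i x
  let ?\<omega> = "\<lambda>x. 1 + norm (G x) powr (p - 1)"
  have \<omega>: "integrable ?M ?\<omega>"
    using Lp_integrable_powr[OF sl op(2) Lp(2), of "p - 1"] p by auto
  have mF: "F i \<in> borel_measurable ?M" for i
    by (intro continuous_imp_measurable_on_sets_lebesgue[OF _ sl] continuous_on_subset[OF C1_gradD(2)[OF f(1)] subset_UNIV])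
  have aeD: "AE x in ?M. norm (D x) \<le> C"
    using f(4) AE_space
  proof eventually_elim
    case (elim x)
    then show ?case using f(2) by (intro LIMSEQ_le_const2[OF tendsto_norm[OF elim(1)]]) auto
  qed
  have mD: "D \<in> borel_measurable ?M" using D by auto
  have mw: "?\<omega> \<in> borel_measurable ?M" using \<omega> by auto
  \<comment> \<open>For the Lipschitz part dominated convergence suffices: the gradients and their
    limit are bounded by \<open>C\<close>, and the weight is integrable.\<close>
  have w2: "(\<lambda>i. LINT x|?M. ?\<omega> x * norm (F i x - D x)) \<longlonglongrightarrow> (LINT x|?M. ?\<omega> x * 0)"
    and iw2: "\<And>i. integrable ?M (\<lambda>x. ?\<omega> x * norm (F i x - D x))"
  proof -
    have A: "(\<lambda>x. ?\<omega> x * 0) \<in> borel_measurable ?M" by simp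
    have B: "(\<lambda>x. ?\<omega> x * norm (F i x - D x)) \<in> borel_measurable ?M" for i
      using mw mF[of i] mD by measurable
    have E: "integrable ?M (\<lambda>x. ?\<omega> x * (2 * C))" using \<omega> by auto
    have lim: "AE x in ?M. (\<lambda>i. ?\<omega> x * norm (F i x - D x)) \<longlonglongrightarrow> ?\<omega> x * 0"
      using f(4)
    proof eventually_elim
      case (elim x)
      have "(\<lambda>i. norm (F i x - D x)) \<longlonglongrightarrow> 0" using elim by (simp add: LIM_zero_iff tendsto_norm_zero)
      then show ?case by (intro tendsto_mult tendsto_const)
    qed
    have bd: "AE x in ?M. norm (?\<omega> x * norm (F i x - D x)) \<le> ?\<omega> x * (2 * C)" for i
      using aeD AE_space
    proof eventually_elim
      case (elim x)
      have "norm (F i x - D x) \<le> 2 * C"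
        using f(2)[of x i] elim norm_triangle_ineq4[of "F i x" "D x"] by auto
      then have "?\<omega> x * norm (F i x - D x) \<le> ?\<omega> x * (2 * C)"
        by (intro mult_left_mono) (auto simp: add_nonneg_nonneg)
      moreover have "?\<omega> x \<ge> 0" by (auto simp: add_nonneg_nonneg)
      ultimately show ?case by (simp add: abs_mult)
    qed
    show "(\<lambda>i. LINT x|?M. ?\<omega> x * norm (F i x - D x)) \<longlonglongrightarrow> (LINT x|?M. ?\<omega> x * 0)"
      by (rule integral_dominated_convergence[OF A B E lim bd])
    show "integrable ?M (\<lambda>x. ?\<omega> x * norm (F i x - D x))" for i
      by (rule Bochner_Integration.integrable_bound[OF E B]) (use bd[of i] in \<open>auto elim!: eventually_mono\<close>)
  qed
  have Vle: "?\<omega> x * norm (V i x - G x) \<le> ?\<omega> x * norm (gradient (\<phi> (q i)) x - H x) + ?\<omega> x * norm (F i x - D x)" for i x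
  proof -
    have "V i x - G x = (gradient (\<phi> (q i)) x - H x) + (F i x - D x)" unfolding V_def D_def by simp
    then have "norm (V i x - G x) \<le> norm (gradient (\<phi> (q i)) x - H x) + norm (F i x - D x)" using norm_triangle_ineq by metis
    then have "?\<omega> x * norm (V i x - G x) \<le> ?\<omega> x * (norm (gradient (\<phi> (q i)) x - H x) + norm (F i x - D x))"
      by (intro mult_left_mono) (auto simp: add_nonneg_nonneg)
    then show ?thesis by (simp add: distrib_left)
  qed
  have \<omega>0: "0 \<le> ?\<omega> x * norm y" for x and y :: 'a by (intro mult_nonneg_nonneg) (auto simp: add_nonneg_nonneg)
  have mV: "V i \<in> borel_measurable ?M" for i
    unfolding V_def using m\<phi>(2)[of "q i"] mF[of i] by measurable
  have iV: "integrable ?M (\<lambda>x. ?\<omega> x * norm (V i x - G x))" for i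
  proof (rule Bochner_Integration.integrable_bound[OF Bochner_Integration.integrable_add[OF w1(1)[of i] iw2[of i]]])
    show "(\<lambda>x. ?\<omega> x * norm (V i x - G x)) \<in> borel_measurable ?M" using mw mV[of i] mes(2) by measurable
    show "AE x in ?M. norm (?\<omega> x * norm (V i x - G x)) \<le> norm (?\<omega> x * norm (gradient (\<phi> (q i)) x - H x) + ?\<omega> x * norm (F i x - D x))"
    proof (rule AE_I2)
      fix x
      show "norm (?\<omega> x * norm (V i x - G x)) \<le> norm (?\<omega> x * norm (gradient (\<phi> (q i)) x - H x) + ?\<omega> x * norm (F i x - D x))"
        unfolding real_norm_def using Vle[of x i] \<omega>0[of x "V i x - G x"] by linarith
    qed
  qed
  show ?thesis
  proof (rule that[of v V h])
    show "C1_grad UNIV (v i) (V i)" for i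
      unfolding v_def V_def by (rule C1_grad_add[OF C\<phi> f(1)])
    show "AE x in ?M. (\<lambda>i. v i x) \<longlonglongrightarrow> u x"
      using q(2) AE_space
    proof eventually_elim
      case (elim x)
      then have x: "x \<in> \<Omega>" by simp
      then have xc: "x \<in> closure \<Omega>" using closure_subset by blast
      have a: "(\<lambda>n. (u x - h0 x) - \<phi> (q n) x) \<longlonglongrightarrow> 0"
        using tendsto_of_powr_tendsto[OF elim(1)] p by simp
      have b: "(\<lambda>i. f i x) \<longlonglongrightarrow> h x"
      proof (rule LIMSEQ_I)
        fix e :: real assume "e > 0"
        from f(3)[OF this] show "\<exists>no. \<forall>n\<ge>no. norm (f n x - h x) < e"
          unfolding eventually_sequentially using xc by auto
      qed
      have "(\<lambda>n. (u x - h0 x) - ((u x - h0 x) - \<phi> (q n) x) + f n x) \<longlonglongrightarrow> (u x - h0 x) - 0 + h x"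
        by (intro tendsto_intros a b)
      then show ?case unfolding v_def using h\<Omega>[OF x] by simp
    qed
    show "integrable ?M (\<lambda>x. ?\<omega> x * norm (V i x - G x))" for i by (rule iV)
    show "(\<lambda>i. LINT x|?M. ?\<omega> x * norm (V i x - G x)) \<longlonglongrightarrow> 0"
    proof (rule tendsto_sandwich[OF _ _ tendsto_const])
      show "\<forall>\<^sub>F i in sequentially. 0 \<le> (LINT x|?M. ?\<omega> x * norm (V i x - G x))"
        using \<omega>0 by (intro always_eventually allI Bochner_Integration.integral_nonneg) auto
      show "\<forall>\<^sub>F i in sequentially. (LINT x|?M. ?\<omega> x * norm (V i x - G x))
          \<le> (LINT x|?M. ?\<omega> x * norm (gradient (\<phi> (q i)) x - H x)) + (LINT x|?M. ?\<omega> x * norm (F i x - D x))"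
      proof (intro always_eventually allI)
        fix i
        have "(LINT x|?M. ?\<omega> x * norm (V i x - G x)) \<le> (LINT x|?M. ?\<omega> x * norm (gradient (\<phi> (q i)) x - H x) + ?\<omega> x * norm (F i x - D x))"
          by (rule integral_mono[OF iV Bochner_Integration.integrable_add[OF w1(1) iw2]]) (rule Vle)
        then show "(LINT x|?M. ?\<omega> x * norm (V i x - G x))
          \<le> (LINT x|?M. ?\<omega> x * norm (gradient (\<phi> (q i)) x - H x)) + (LINT x|?M. ?\<omega> x * norm (F i x - D x))"
          unfolding Bochner_Integration.integral_add[OF w1(1) iw2] .
      qed
      show "(\<lambda>i. (LINT x|?M. ?\<omega> x * norm (gradient (\<phi> (q i)) x - H x)) + (LINT x|?M. ?\<omega> x * norm (F i x - D x))) \<longlonglongrightarrow> 0"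
        using tendsto_add[OF w1(2) w2] by simp
    qed
    show "continuous_on (closure \<Omega>) h" using lipschitz_on_continuous_on[OF h(1)] continuous_on_subset by blast
    show "h x = g x" if "x \<in> frontier \<Omega>" for x
      using that h0(2) h(2)[of x] by (simp add: frontier_def)
    show "\<forall>\<^sub>F i in sequentially. \<exists>K. compact K \<and> K \<subseteq> \<Omega> \<and> (\<forall>x\<in>closure \<Omega> - K. \<bar>v i x - h x\<bar> < e)" if "e > 0" for e
      using f(3)[OF that]
    proof eventually_elim
      case (elim i)
      obtain K where "compact K" "K \<subseteq> \<Omega>" "\<And>x. x \<notin> K \<Longrightarrow> \<phi> (q i) x = 0" using C1_0_D(2)[OF \<phi>1] by blast
      then show ?case using elim unfolding v_def by (intro exI[of _ K]) auto
    qed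
  qed
qed

section \<open>A nonlinear chain rule for weak equations, and the profiles used in it\<close>

section \<open>Testing the equation\<close>

text \<open>The weight is the growth of the p-flux of \<open>G\<close>, so a flux paired with V i -
  G tends to zero in the mean; this is all that the limit passage in \<open>weak_identity\<close>
  uses about the gradients.\<close>

definition strong_approx ::
  "real \<Rightarrow> 'a::euclidean_space set \<Rightarrow> ('a \<Rightarrow> real) \<Rightarrow> ('a \<Rightarrow> 'a) \<Rightarrow> (nat \<Rightarrow> 'a \<Rightarrow> real) \<Rightarrow> (nat \<Rightarrow> 'a \<Rightarrow> 'a) \<Rightarrow> bool"
where
  "strong_approx p \<Omega> u G v V \<longleftrightarrow> (\<forall>i. C1_grad UNIV (v i) (V i)) \<and>
     (AE x in lebesgue_on \<Omega>. (\<lambda>i. v i x) \<longlonglongrightarrow> u x) \<and>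
     (\<forall>i. integrable (lebesgue_on \<Omega>) (\<lambda>x. (1 + norm (G x) powr (p - 1)) * norm (V i x - G x))) \<and>
     (\<lambda>i. LINT x|lebesgue_on \<Omega>. (1 + norm (G x) powr (p - 1)) * norm (V i x - G x)) \<longlonglongrightarrow> 0"

lemma continuous_on_open_measurable:
  fixes f :: "'a::euclidean_space \<Rightarrow> 'b::euclidean_space"
  shows "open \<Omega> \<Longrightarrow> continuous_on \<Omega> f \<Longrightarrow> f \<in> borel_measurable (lebesgue_on \<Omega>)"
  by (rule continuous_imp_measurable_on_sets_lebesgue) auto

text \<open>The product \<open>\<eta> * T (u - f)\<close> need not be C^1, but
  \<open>\<eta> * T (v i - f)\<close> is, and it is an admissible test function by
  \<open>supp\<close>. The field \<open>Y\<close> is left general for three uses: the p-flux of the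
  solution, a constant vector (the chain rule for truncations of \<open>u\<close>), and the explicit
  flux of the barrier.\<close>

lemma weak_identity:
  fixes u :: "'a::euclidean_space \<Rightarrow> real"
  assumes op: "open \<Omega>" "bounded \<Omega>" and p: "p > 1" and u: "u \<in> borel_measurable (lebesgue_on \<Omega>)"
    and G: "Lp_on p \<Omega> G" and sa: "strong_approx p \<Omega> u G v V"
    and Y: "Y \<in> borel_measurable (lebesgue_on \<Omega>)" "\<And>x. x \<in> \<Omega> \<Longrightarrow> norm (Y x) \<le> c * (1 + norm (G x) powr (p - 1))"
    and \<kappa>: "\<kappa> \<in> borel_measurable (lebesgue_on \<Omega>)" "\<And>x. x \<in> \<Omega> \<Longrightarrow> \<bar>\<kappa> x\<bar> \<le> c"
    and weak: "\<And>\<phi>. \<phi> \<in> C1_0 \<Omega> \<Longrightarrow> (LINT x:\<Omega>|lebesgue. Y x \<bullet> gradient \<phi> x) = - (LINT x:\<Omega>|lebesgue. \<kappa> x * \<phi> x)"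
    and f: "C1_grad \<Omega> f F" "\<And>x. x \<in> \<Omega> \<Longrightarrow> norm (F x) \<le> B"
    and \<eta>: "C1_grad \<Omega> \<eta> E" "\<And>x. x \<in> \<Omega> \<Longrightarrow> \<bar>\<eta> x\<bar> \<le> B" "\<And>x. x \<in> \<Omega> \<Longrightarrow> norm (E x) \<le> B"
    and T: "\<And>t. (T has_real_derivative T' t) (at t)" "continuous_on UNIV T'" "\<And>t. \<bar>T t\<bar> \<le> B" "\<And>t. \<bar>T' t\<bar> \<le> B"
    and supp: "\<forall>\<^sub>F i in sequentially. \<exists>K. compact K \<and> K \<subseteq> \<Omega> \<and> (\<forall>x\<in>\<Omega> - K. \<eta> x * T (v i x - f x) = 0)"
  shows "integrable (lebesgue_on \<Omega>) (\<lambda>x. Y x \<bullet> (\<eta> x *\<^sub>R (T' (u x - f x) *\<^sub>R (G x - F x)) + T (u x - f x) *\<^sub>R E x))"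
    "integrable (lebesgue_on \<Omega>) (\<lambda>x. \<kappa> x * (\<eta> x * T (u x - f x)))"
    "(LINT x|lebesgue_on \<Omega>. Y x \<bullet> (\<eta> x *\<^sub>R (T' (u x - f x) *\<^sub>R (G x - F x)) + T (u x - f x) *\<^sub>R E x))
       = - (LINT x|lebesgue_on \<Omega>. \<kappa> x * (\<eta> x * T (u x - f x)))"
proof -
  let ?M = "lebesgue_on \<Omega>"
  let ?\<omega> = "\<lambda>x. 1 + norm (G x) powr (p - 1)"
  have sl: "\<Omega> \<in> sets lebesgue" using op(1) by auto
  interpret finite_measure ?M by (rule finite_measure_lebesgue_on_bounded[OF sl op(2)])
  have v: "\<And>i. C1_grad UNIV (v i) (V i)" "AE x in ?M. (\<lambda>i. v i x) \<longlonglongrightarrow> u x"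
    "\<And>i. integrable ?M (\<lambda>x. ?\<omega> x * norm (V i x - G x))"
    "(\<lambda>i. LINT x|?M. ?\<omega> x * norm (V i x - G x)) \<longlonglongrightarrow> 0"
    using sa unfolding strong_approx_def by auto
  have Tc: "continuous_on UNIV T"
    using T(1) DERIV_continuous by (blast intro: continuous_at_imp_continuous_on)
  have Tm[measurable]: "T \<in> borel_measurable borel" "T' \<in> borel_measurable borel"
    using Tc T(2) borel_measurable_continuous_onI by auto
  have vm[measurable]: "v i \<in> borel_measurable ?M" "V i \<in> borel_measurable ?M" for i
    using continuous_on_subset[OF C1_grad_continuous[OF v(1)] subset_UNIV] continuous_on_subset[OF C1_gradD(2)[OF v(1)] subset_UNIV]
    by (auto intro!: continuous_on_open_measurable op)
  have fm[measurable]: "f \<in> borel_measurable ?M" "F \<in> borel_measurable ?M" "\<eta> \<in> borel_measurable ?M" "E \<in> borel_measurable ?M"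
    using C1_grad_continuous[OF f(1)] C1_gradD(2)[OF f(1)] C1_grad_continuous[OF \<eta>(1)] C1_gradD(2)[OF \<eta>(1)]
    by (auto intro!: continuous_on_open_measurable op)
  have Gm[measurable]: "G \<in> borel_measurable ?M" using Lp_onD(1)[OF sl G] .
  note [measurable] = u Y(1) \<kappa>(1)
  have B0: "B \<ge> 0" using T(3)[of 0] by (meson abs_ge_zero order_trans)
  have c0: "c \<ge> 0" if "x \<in> \<Omega>" for x using \<kappa>(2)[OF that] by (meson abs_ge_zero order_trans)
  have \<omega>0: "?\<omega> x \<ge> 1" for x by simp
  define \<Psi> where "\<Psi> w W x = \<eta> x *\<^sub>R (T' (w x - f x) *\<^sub>R (W x - F x)) + T (w x - f x) *\<^sub>R E x" for w W x
  have \<Psi>m: "(\<lambda>x. Y x \<bullet> \<Psi> w W x) \<in> borel_measurable ?M" if [measurable]: "w \<in> borel_measurable ?M" "W \<in> borel_measurable ?M" for w W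
    unfolding \<Psi>_def by measurable
  \<comment> \<open>The first summand contains the fixed gradient \<open>G\<close> and converges by
    domination; in the second, bounded factors multiply V i - G, so the weighted L^1 convergence
    applies.\<close>
  have split: "\<Psi> (v i) (V i) x = \<Psi> (v i) G x + (\<eta> x * T' (v i x - f x)) *\<^sub>R (V i x - G x)" for i x
    unfolding \<Psi>_def by (simp add: algebra_simps)
  \<comment> \<open>A dominating function for all approximants at once; the pairing of a flux of
    order |G|^(p-1) with \<open>G\<close> produces the term |G|^p.\<close>
  define D where "D x = c * ((B * B) * (norm (G x) powr p + norm (G x)) + (B * B + B * B * B) * ?\<omega> x)" for x
  have iD: "integrable ?M D"
  proof -
    have 1: "integrable ?M (\<lambda>x. norm (G x) powr p)" using Lp_onD(2)[OF sl G] .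
    have 2: "integrable ?M (\<lambda>x. norm (G x))" using Lp_integrable[OF sl op(2) G p] by auto
    have 3: "integrable ?M (\<lambda>x. norm (G x) powr (p - 1))"
      by (rule Lp_integrable_powr[OF sl op(2) G]) (use p in auto)
    show ?thesis unfolding D_def
      by (intro integrable_mult_right Bochner_Integration.integrable_add 1 2 3) auto
  qed
  have inner_bd: "\<bar>Y x \<bullet> z\<bar> \<le> c * ?\<omega> x * norm z" if "x \<in> \<Omega>" for x z
    using Cauchy_Schwarz_ineq2[of "Y x" z] mult_right_mono[OF Y(2)[OF that] norm_ge_zero[of z]] by linarith
  have bd: "\<bar>Y x \<bullet> \<Psi> w G x\<bar> \<le> D x" if x: "x \<in> \<Omega>" for x w
  proof -
    have "norm (\<Psi> w G x) \<le> norm (\<eta> x *\<^sub>R (T' (w x - f x) *\<^sub>R (G x - F x))) + norm (T (w x - f x) *\<^sub>R E x)"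
      unfolding \<Psi>_def by (rule norm_triangle_ineq)
    also have "\<dots> = (\<bar>\<eta> x\<bar> * \<bar>T' (w x - f x)\<bar>) * norm (G x - F x) + \<bar>T (w x - f x)\<bar> * norm (E x)"
      by (simp add: abs_mult)
    also have "\<dots> \<le> (B * B) * (norm (G x) + B) + B * B"
    proof (intro add_mono mult_mono)
      show "norm (G x - F x) \<le> norm (G x) + B" using norm_triangle_ineq4[of "G x" "F x"] f(2)[OF x] by linarith
    qed (use \<eta>(2,3)[OF x] T(3,4) B0 in auto)
    finally have "norm (\<Psi> w G x) \<le> B * B * norm (G x) + (B * B + B * B * B)" by (simp add: algebra_simps)
    then have "c * ?\<omega> x * norm (\<Psi> w G x) \<le> c * ?\<omega> x * (B * B * norm (G x) + (B * B + B * B * B))"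
      using c0[OF x] \<omega>0[of x] by (intro mult_left_mono) auto
    also have "\<dots> = c * (B * B * (norm (G x) powr (p - 1) * norm (G x) + norm (G x)) + (B * B + B * B * B) * ?\<omega> x)"
      by (simp add: algebra_simps)
    also have "norm (G x) powr (p - 1) * norm (G x) = norm (G x) powr p"
      by (cases "G x = 0") (auto simp: powr_diff)
    finally show ?thesis using inner_bd[OF x, of "\<Psi> w G x"] unfolding D_def by linarith
  qed
  have AE_\<Omega>: "AE x in ?M. x \<in> \<Omega>" using AE_space by eventually_elim simp
  have AEbd: "AE x in ?M. norm (Y x \<bullet> \<Psi> w G x) \<le> norm (D x)" for w
    using AE_\<Omega>
  proof eventually_elim
    case (elim x)
    show ?case using bd[OF elim, of w] unfolding real_norm_def by linarith
  qed
  show i1: "integrable ?M (\<lambda>x. Y x \<bullet> (\<eta> x *\<^sub>R (T' (u x - f x) *\<^sub>R (G x - F x)) + T (u x - f x) *\<^sub>R E x))"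
  proof -
    have "integrable ?M (\<lambda>x. Y x \<bullet> \<Psi> u G x)"
      by (rule Bochner_Integration.integrable_bound[OF iD \<Psi>m[OF u Gm]])
         (rule AEbd)
    then show ?thesis unfolding \<Psi>_def .
  qed
  have iG: "integrable ?M (\<lambda>x. Y x \<bullet> \<Psi> (v i) G x)" for i
    by (rule Bochner_Integration.integrable_bound[OF iD \<Psi>m[OF vm(1) Gm]])
       (rule AEbd)
  have limT: "(\<lambda>i. S (v i x - f x)) \<longlonglongrightarrow> S (u x - f x)"
    if "continuous_on UNIV S" "(\<lambda>i. v i x) \<longlonglongrightarrow> u x" for S :: "real \<Rightarrow> real" and x
    by (rule continuous_on_tendsto_compose[OF that(1)]) (auto intro!: tendsto_intros that(2))
  have lim1: "(\<lambda>i. LINT x|?M. Y x \<bullet> \<Psi> (v i) G x) \<longlonglongrightarrow> (LINT x|?M. Y x \<bullet> \<Psi> u G x)"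
  proof (rule integral_dominated_convergence[OF \<Psi>m[OF u Gm] \<Psi>m[OF vm(1) Gm] iD])
    show "AE x in ?M. (\<lambda>i. Y x \<bullet> \<Psi> (v i) G x) \<longlonglongrightarrow> Y x \<bullet> \<Psi> u G x"
      using v(2)
    proof eventually_elim
      case (elim x)
      show ?case unfolding \<Psi>_def
        by (intro tendsto_intros limT[OF Tc elim] limT[OF T(2) elim])
    qed
    show "AE x in ?M. norm (Y x \<bullet> \<Psi> (v i) G x) \<le> D x" for i
      using AE_\<Omega> by eventually_elim (use bd in auto)
  qed
  have bd2: "\<bar>Y x \<bullet> ((\<eta> x * T' (v i x - f x)) *\<^sub>R (V i x - G x))\<bar> \<le> (c * (B * B)) * (?\<omega> x * norm (V i x - G x))"
    if x: "x \<in> \<Omega>" for x i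
  proof -
    have "norm ((\<eta> x * T' (v i x - f x)) *\<^sub>R (V i x - G x)) \<le> (B * B) * norm (V i x - G x)"
      using \<eta>(2)[OF x] T(4) B0 by (simp add: abs_mult) (intro mult_right_mono mult_mono, auto)
    then have "c * ?\<omega> x * norm ((\<eta> x * T' (v i x - f x)) *\<^sub>R (V i x - G x)) \<le> c * ?\<omega> x * ((B * B) * norm (V i x - G x))"
      using c0[OF x] \<omega>0[of x] by (intro mult_left_mono) auto
    then show ?thesis using inner_bd[OF x, of "(\<eta> x * T' (v i x - f x)) *\<^sub>R (V i x - G x)"] by (simp add: mult_ac)
  qed
  have i2: "integrable ?M (\<lambda>x. Y x \<bullet> ((\<eta> x * T' (v i x - f x)) *\<^sub>R (V i x - G x)))" for i
  proof (rule Bochner_Integration.integrable_bound[OF integrable_mult_right[OF v(3)]])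
    show "AE x in ?M. norm (Y x \<bullet> ((\<eta> x * T' (v i x - f x)) *\<^sub>R (V i x - G x))) \<le> norm ((c * (B * B)) * (?\<omega> x * norm (V i x - G x)))"
      using AE_\<Omega>
    proof eventually_elim
      case (elim x)
      show ?case using bd2[OF elim, of i] unfolding real_norm_def by linarith
    qed
  qed measurable
  have lim2: "(\<lambda>i. LINT x|?M. Y x \<bullet> ((\<eta> x * T' (v i x - f x)) *\<^sub>R (V i x - G x))) \<longlonglongrightarrow> 0"
  proof (rule Lim_null_comparison)
    show "\<forall>\<^sub>F i in sequentially. norm (LINT x|?M. Y x \<bullet> ((\<eta> x * T' (v i x - f x)) *\<^sub>R (V i x - G x)))
       \<le> (c * (B * B)) * (LINT x|?M. ?\<omega> x * norm (V i x - G x))"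
    proof (intro always_eventually allI)
      fix i
      have "norm (LINT x|?M. Y x \<bullet> ((\<eta> x * T' (v i x - f x)) *\<^sub>R (V i x - G x)))
         \<le> (LINT x|?M. norm (Y x \<bullet> ((\<eta> x * T' (v i x - f x)) *\<^sub>R (V i x - G x))))"
        by (rule integral_norm_bound)
      also have "\<dots> \<le> (LINT x|?M. (c * (B * B)) * (?\<omega> x * norm (V i x - G x)))"
        by (rule integral_mono[OF integrable_norm[OF i2] integrable_mult_right[OF v(3)]])
           (use bd2 in auto)
      finally show "norm (LINT x|?M. Y x \<bullet> ((\<eta> x * T' (v i x - f x)) *\<^sub>R (V i x - G x)))
         \<le> (c * (B * B)) * (LINT x|?M. ?\<omega> x * norm (V i x - G x))" by simp
    qed
    show "(\<lambda>i. (c * (B * B)) * (LINT x|?M. ?\<omega> x * norm (V i x - G x))) \<longlonglongrightarrow> 0"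
      using tendsto_mult[OF tendsto_const v(4)] by simp
  qed
  have limY: "(\<lambda>i. LINT x|?M. Y x \<bullet> \<Psi> (v i) (V i) x) \<longlonglongrightarrow> (LINT x|?M. Y x \<bullet> \<Psi> u G x)"
  proof -
    have "(LINT x|?M. Y x \<bullet> \<Psi> (v i) (V i) x) = (LINT x|?M. Y x \<bullet> \<Psi> (v i) G x)
        + (LINT x|?M. Y x \<bullet> ((\<eta> x * T' (v i x - f x)) *\<^sub>R (V i x - G x)))" for i
      unfolding split inner_add_right by (rule Bochner_Integration.integral_add[OF iG i2])
    then show ?thesis using tendsto_add[OF lim1 lim2] by simp
  qed
  have bd3: "\<bar>\<kappa> x * (\<eta> x * T (w x - f x))\<bar> \<le> c * (B * B)" if x: "x \<in> \<Omega>" for x and w :: "'a \<Rightarrow> real"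
    unfolding abs_mult using \<kappa>(2)[OF x] \<eta>(2)[OF x] T(3) B0 c0[OF x] by (intro mult_mono) auto
  have cst: "integrable ?M (\<lambda>x. c * (B * B))" by simp
  show i3: "integrable ?M (\<lambda>x. \<kappa> x * (\<eta> x * T (u x - f x)))"
  proof (rule Bochner_Integration.integrable_bound[OF cst])
    show "AE x in ?M. norm (\<kappa> x * (\<eta> x * T (u x - f x))) \<le> norm (c * (B * B))"
      using AE_\<Omega>
    proof eventually_elim
      case (elim x)
      show ?case using bd3[OF elim, of u] unfolding real_norm_def by linarith
    qed
  qed measurable
  have lim\<kappa>: "(\<lambda>i. LINT x|?M. \<kappa> x * (\<eta> x * T (v i x - f x))) \<longlonglongrightarrow> (LINT x|?M. \<kappa> x * (\<eta> x * T (u x - f x)))"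
  proof (rule integral_dominated_convergence[OF _ _ cst])
    show "AE x in ?M. (\<lambda>i. \<kappa> x * (\<eta> x * T (v i x - f x))) \<longlonglongrightarrow> \<kappa> x * (\<eta> x * T (u x - f x))"
      using v(2)
    proof eventually_elim
      case (elim x)
      show ?case by (intro tendsto_intros limT[OF Tc elim])
    qed
    show "AE x in ?M. norm (\<kappa> x * (\<eta> x * T (v i x - f x))) \<le> c * (B * B)" for i
      using AE_\<Omega> by eventually_elim (use bd3 in auto)
  qed measurable
  have "\<forall>\<^sub>F i in sequentially. - (LINT x|?M. \<kappa> x * (\<eta> x * T (v i x - f x))) = (LINT x|?M. Y x \<bullet> \<Psi> (v i) (V i) x)"
    using supp
  proof eventually_elim
    case (elim i)
    then obtain K where K: "compact K" "K \<subseteq> \<Omega>" "\<And>x. x \<in> \<Omega> - K \<Longrightarrow> \<eta> x * T (v i x - f x) = 0" by blast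
    have C: "C1_grad \<Omega> (\<lambda>x. \<eta> x * T (v i x - f x)) (\<Psi> (v i) (V i))"
      unfolding \<Psi>_def
      by (rule C1_grad_mult[OF \<eta>(1) C1_grad_compose[OF C1_grad_diff[OF C1_grad_subset[OF v(1) subset_UNIV] f(1)] T(1,2)]])
    define \<psi> where "\<psi> x = (if x \<in> \<Omega> then \<eta> x * T (v i x - f x) else 0)" for x
    have C': "C1_grad UNIV \<psi> (\<lambda>x. if x \<in> \<Omega> then \<Psi> (v i) (V i) x else 0)"
      unfolding \<psi>_def by (rule C1_grad_extend_zero[OF op(1) K(1,2) C K(3)])
    have "\<psi> \<in> C1_0 \<Omega>"
      by (rule C1_0_I[OF C' K(1,2)]) (use K(3) in \<open>auto simp: \<psi>_def\<close>)
    note w = weak[OF this, unfolded set_integral_lebesgue_on(1)[OF sl]]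
    have "(LINT x|?M. Y x \<bullet> \<Psi> (v i) (V i) x) = (LINT x|?M. Y x \<bullet> gradient \<psi> x)"
      by (rule Bochner_Integration.integral_cong) (auto simp: C1_grad_gradient[OF C'])
    also have "\<dots> = - (LINT x|?M. \<kappa> x * \<psi> x)" by (rule w)
    also have "(LINT x|?M. \<kappa> x * \<psi> x) = (LINT x|?M. \<kappa> x * (\<eta> x * T (v i x - f x)))"
      by (rule Bochner_Integration.integral_cong) (auto simp: \<psi>_def)
    finally show ?case by simp
  qed
  then have "(\<lambda>i. LINT x|?M. Y x \<bullet> \<Psi> (v i) (V i) x) \<longlonglongrightarrow> - (LINT x|?M. \<kappa> x * (\<eta> x * T (u x - f x)))"
    by (rule Lim_transform_eventually[OF tendsto_minus[OF lim\<kappa>]])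
  then have "(LINT x|?M. Y x \<bullet> \<Psi> u G x) = - (LINT x|?M. \<kappa> x * (\<eta> x * T (u x - f x)))"
    by (rule LIMSEQ_unique[OF limY])
  then show "(LINT x|?M. Y x \<bullet> (\<eta> x *\<^sub>R (T' (u x - f x) *\<^sub>R (G x - F x)) + T (u x - f x) *\<^sub>R E x))
       = - (LINT x|?M. \<kappa> x * (\<eta> x * T (u x - f x)))" unfolding \<Psi>_def .
qed

text \<open>Squaring removes the kink of the positive part. The truncation, the saturating profile
  and the radial cut-off are all built from it, since test functions need only be C^1.\<close>

lemma DERIV_pos_part_square: "((\<lambda>s::real. (max 0 s)\<^sup>2) has_real_derivative 2 * max 0 s) (at s)"
proof (cases s "0::real" rule: linorder_cases)
  case less
  have "((\<lambda>s::real. 0) has_real_derivative 0) (at s)" by simp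
  then have "((\<lambda>s::real. (max 0 s)\<^sup>2) has_real_derivative 0) (at s)"
    by (rule has_field_derivative_transform_within_open[where S="{..<0}"]) (use less in auto)
  then show ?thesis using less by simp
next
  case greater
  have "((\<lambda>s::real. s\<^sup>2) has_real_derivative 2 * s) (at s)" by (auto intro!: derivative_eq_intros)
  then have "((\<lambda>s::real. (max 0 s)\<^sup>2) has_real_derivative 2 * s) (at s)"
    by (rule has_field_derivative_transform_within_open[where S="{0<..}"]) (use greater in auto)
  then show ?thesis using greater by simp
next
  case equal
  have "((\<lambda>h::real. (max 0 h)\<^sup>2 / h) \<longlongrightarrow> 0) (at 0)"
  proof (rule Lim_null_comparison)
    show "eventually (\<lambda>h::real. norm ((max 0 h)\<^sup>2 / h) \<le> \<bar>h\<bar>) (at 0)"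
      by (auto simp: max_def power2_eq_square)
    show "((\<lambda>h::real. \<bar>h\<bar>) \<longlongrightarrow> 0) (at 0)" by (intro tendsto_rabs_zero tendsto_ident_at)
  qed
  then show ?thesis using equal by (simp add: DERIV_def)
qed

text \<open>\<open>trunc \<delta>\<close> is a bounded, nondecreasing and nonexpansive \<open>C\<^sup>1\<close> approximation of the identity
  that vanishes near \<open>0\<close>: \<open>soft_dead\<close> removes \<open>[-\<delta>, \<delta>]\<close> and the last quotient saturates.\<close>
definition soft_pos :: "real \<Rightarrow> real \<Rightarrow> real" where
  "soft_pos \<delta> s = sqrt (\<delta>\<^sup>2 + (max 0 s)\<^sup>2) - \<delta>"

definition soft_dead :: "real \<Rightarrow> real \<Rightarrow> real" where
  "soft_dead \<delta> t = soft_pos \<delta> (t - \<delta>) - soft_pos \<delta> (- t - \<delta>)"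

definition trunc :: "real \<Rightarrow> real \<Rightarrow> real" where
  "trunc \<delta> t = soft_dead \<delta> t / sqrt (1 + \<delta>\<^sup>2 * (soft_dead \<delta> t)\<^sup>2)"

definition soft_pos' :: "real \<Rightarrow> real \<Rightarrow> real" where
  "soft_pos' \<delta> s = max 0 s / sqrt (\<delta>\<^sup>2 + (max 0 s)\<^sup>2)"

definition trunc' :: "real \<Rightarrow> real \<Rightarrow> real" where
  "trunc' \<delta> t = (soft_pos' \<delta> (t - \<delta>) + soft_pos' \<delta> (- t - \<delta>)) / (sqrt (1 + \<delta>\<^sup>2 * (soft_dead \<delta> t)\<^sup>2)) ^ 3"

lemma sum_sq_pos: "\<delta> > 0 \<Longrightarrow> \<delta>\<^sup>2 + (x::real)\<^sup>2 > 0"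
  by (simp add: add_pos_nonneg)

lemma one_plus_sq_pos: "1 + \<delta>\<^sup>2 * (x::real)\<^sup>2 > 0"
  by (simp add: add_pos_nonneg)

lemma DERIV_soft_pos:
  assumes "\<delta> > 0" shows "(soft_pos \<delta> has_real_derivative soft_pos' \<delta> s) (at s)"
proof -
  have "((\<lambda>s. sqrt (\<delta>\<^sup>2 + (max 0 s)\<^sup>2)) has_real_derivative (inverse (sqrt (\<delta>\<^sup>2 + (max 0 s)\<^sup>2)) / 2) * (2 * max 0 s)) (at s)"
    by (rule DERIV_chain2[where f=sqrt and g="\<lambda>s. \<delta>\<^sup>2 + (max 0 s)\<^sup>2", OF DERIV_real_sqrt[OF sum_sq_pos[OF assms]]])
       (use DERIV_add[OF DERIV_const DERIV_pos_part_square] in simp)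
  then have "((\<lambda>s. sqrt (\<delta>\<^sup>2 + (max 0 s)\<^sup>2) - \<delta>) has_real_derivative (inverse (sqrt (\<delta>\<^sup>2 + (max 0 s)\<^sup>2)) / 2) * (2 * max 0 s) - 0) (at s)"
    by (intro DERIV_diff DERIV_const)
  then show ?thesis unfolding soft_pos_def[abs_def] soft_pos'_def by (simp add: field_simps)
qed

lemma DERIV_trunc:
  assumes \<delta>: "\<delta> > 0" shows "(trunc \<delta> has_real_derivative trunc' \<delta> t) (at t)"
proof -
  have A: "(soft_dead \<delta> has_real_derivative (soft_pos' \<delta> (t - \<delta>) + soft_pos' \<delta> (- t - \<delta>))) (at t)"
  proof -
    have "((\<lambda>t. soft_pos \<delta> (t - \<delta>)) has_real_derivative soft_pos' \<delta> (t - \<delta>) * 1) (at t)"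
      by (rule DERIV_chain2[OF DERIV_soft_pos[OF \<delta>]]) (auto intro!: derivative_eq_intros)
    moreover have "((\<lambda>t. soft_pos \<delta> (- t - \<delta>)) has_real_derivative soft_pos' \<delta> (- t - \<delta>) * (- 1)) (at t)"
      by (rule DERIV_chain2[OF DERIV_soft_pos[OF \<delta>]]) (auto intro!: derivative_eq_intros)
    ultimately show ?thesis unfolding soft_dead_def[abs_def] using DERIV_diff by fastforce
  qed
  have B: "((\<lambda>y. y / sqrt (1 + \<delta>\<^sup>2 * y\<^sup>2)) has_real_derivative 1 / (sqrt (1 + \<delta>\<^sup>2 * y\<^sup>2)) ^ 3) (at y)" for y
  proof -
    define q where "q = sqrt (1 + \<delta>\<^sup>2 * y\<^sup>2)"
    have q: "q > 0" "q\<^sup>2 = 1 + \<delta>\<^sup>2 * y\<^sup>2" unfolding q_def using one_plus_sq_pos[of \<delta> y] by auto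
    have "((\<lambda>y. sqrt (1 + \<delta>\<^sup>2 * y\<^sup>2)) has_real_derivative (inverse q / 2) * (\<delta>\<^sup>2 * (2 * y))) (at y)"
      unfolding q_def 
      by (rule DERIV_chain2[where f=sqrt and g="\<lambda>y. 1 + \<delta>\<^sup>2 * y\<^sup>2", OF DERIV_real_sqrt[OF one_plus_sq_pos]])
         (auto intro!: derivative_eq_intros)
    from DERIV_divide[OF DERIV_ident this]
    have "((\<lambda>y. y / sqrt (1 + \<delta>\<^sup>2 * y\<^sup>2)) has_real_derivative (1 * q - y * ((inverse q / 2) * (\<delta>\<^sup>2 * (2 * y)))) / (q * q)) (at y)"
      using q(1) unfolding q_def by simp
    moreover have "(1 * q - y * ((inverse q / 2) * (\<delta>\<^sup>2 * (2 * y)))) / (q * q) = (q\<^sup>2 - \<delta>\<^sup>2 * y\<^sup>2) / q ^ 3"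
      using q(1) by (simp add: field_simps power2_eq_square power3_eq_cube)
    ultimately show ?thesis using q(2) unfolding q_def by simp
  qed
  from DERIV_chain2[OF B A] show ?thesis unfolding trunc_def[abs_def] trunc'_def by simp
qed

lemma soft_pos'_bounds: "\<delta> > 0 \<Longrightarrow> 0 \<le> soft_pos' \<delta> s" "\<delta> > 0 \<Longrightarrow> soft_pos' \<delta> s \<le> 1"
  "s \<le> 0 \<Longrightarrow> soft_pos' \<delta> s = 0"
proof -
  show "\<delta> > 0 \<Longrightarrow> 0 \<le> soft_pos' \<delta> s" unfolding soft_pos'_def by simp
  show "s \<le> 0 \<Longrightarrow> soft_pos' \<delta> s = 0" unfolding soft_pos'_def by simp
  assume \<delta>: "\<delta> > 0"
  have "max 0 s \<le> sqrt (\<delta>\<^sup>2 + (max 0 s)\<^sup>2)" by (rule real_le_rsqrt) simp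
  then show "soft_pos' \<delta> s \<le> 1"
    unfolding soft_pos'_def using sum_sq_pos[OF \<delta>, of "max 0 s"] by (simp add: divide_le_eq)
qed

lemma trunc_props:
  assumes \<delta>: "\<delta> > 0"
  shows "continuous_on UNIV (trunc' \<delta>)" "0 \<le> trunc' \<delta> t" "trunc' \<delta> t \<le> 1" "\<bar>trunc \<delta> t\<bar> \<le> 1 / \<delta>"
    "\<bar>t\<bar> \<le> \<delta> \<Longrightarrow> trunc \<delta> t = 0"
proof -
  have c: "continuous_on UNIV (soft_dead \<delta>)" "continuous_on UNIV (soft_pos' \<delta>)"
    unfolding soft_dead_def[abs_def] soft_pos_def soft_pos'_def[abs_def]
    using sum_sq_pos[OF \<delta>] by (auto intro!: continuous_intros simp: less_imp_neq[THEN not_sym])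
  have "sqrt (1 + \<delta>\<^sup>2 * (soft_dead \<delta> t)\<^sup>2) ^ 3 \<noteq> 0" for t
    using one_plus_sq_pos[of \<delta> "soft_dead \<delta> t"] by simp
  then show "continuous_on UNIV (trunc' \<delta>)"
    unfolding trunc'_def[abs_def]
    by (intro continuous_intros c continuous_on_compose2[OF c(2)]) auto
  have q: "sqrt (1 + \<delta>\<^sup>2 * (soft_dead \<delta> t)\<^sup>2) \<ge> 1" by simp
  \<comment> \<open>The arguments t - \<delta> and - t - \<delta> are never both positive, so at
    most one summand is nonzero.\<close>
  have s: "soft_pos' \<delta> (t - \<delta>) + soft_pos' \<delta> (- t - \<delta>) \<le> 1"
    using soft_pos'_bounds(2)[OF \<delta>, of "t - \<delta>"] soft_pos'_bounds(2)[OF \<delta>, of "- t - \<delta>"]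
      soft_pos'_bounds(3)[of "t - \<delta>" \<delta>] soft_pos'_bounds(3)[of "- t - \<delta>" \<delta>] \<delta> by (cases "t \<ge> 0") auto
  show "0 \<le> trunc' \<delta> t"
    unfolding trunc'_def using soft_pos'_bounds(1)[OF \<delta>] q by (intro divide_nonneg_nonneg add_nonneg_nonneg) auto
  have "1 \<le> sqrt (1 + \<delta>\<^sup>2 * (soft_dead \<delta> t)\<^sup>2) ^ 3" using one_le_power[OF q] .
  then show "trunc' \<delta> t \<le> 1"
    unfolding trunc'_def using order_trans[OF s] by (subst divide_le_eq_1_pos) (auto intro: less_le_trans[OF zero_less_one])
  have "\<bar>\<delta> * soft_dead \<delta> t\<bar> \<le> sqrt (1 + \<delta>\<^sup>2 * (soft_dead \<delta> t)\<^sup>2)"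
    by (rule real_le_rsqrt) (simp add: power_mult_distrib)
  then show "\<bar>trunc \<delta> t\<bar> \<le> 1 / \<delta>"
    unfolding trunc_def using \<delta> one_plus_sq_pos[of \<delta> "soft_dead \<delta> t"]
    by (simp add: abs_mult divide_simps mult.commute)
  show "trunc \<delta> t = 0" if "\<bar>t\<bar> \<le> \<delta>"
    using that \<delta> unfolding trunc_def soft_dead_def soft_pos_def by simp
qed

text \<open>The argument may vary with \<open>n\<close> because the C^1 replacement for the boundary
  extension changes with \<delta> as well.\<close>

lemma trunc_tendsto:
  assumes "\<And>n. \<delta> n > 0" "\<delta> \<longlonglongrightarrow> 0" "s \<longlonglongrightarrow> t"
  shows "(\<lambda>n. trunc (\<delta> n) (s n)) \<longlonglongrightarrow> t"
proof -
  have m: "(\<lambda>n. soft_pos (\<delta> n) (a n)) \<longlonglongrightarrow> max 0 b" if "a \<longlonglongrightarrow> b" for a b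
  proof -
    have "(\<lambda>n. sqrt ((\<delta> n)\<^sup>2 + (max 0 (a n))\<^sup>2) - \<delta> n) \<longlonglongrightarrow> sqrt (0\<^sup>2 + (max 0 b)\<^sup>2) - 0"
      by (intro tendsto_intros assms that)
    then show ?thesis unfolding soft_pos_def by simp
  qed
  have "(\<lambda>n. soft_dead (\<delta> n) (s n)) \<longlonglongrightarrow> max 0 (t - 0) - max 0 (- t - 0)"
    unfolding soft_dead_def by (intro tendsto_diff m tendsto_intros assms)
  then have d: "(\<lambda>n. soft_dead (\<delta> n) (s n)) \<longlonglongrightarrow> t" by (simp add: max_def split: if_splits)
  have "(\<lambda>n. soft_dead (\<delta> n) (s n) / sqrt (1 + (\<delta> n)\<^sup>2 * (soft_dead (\<delta> n) (s n))\<^sup>2)) \<longlonglongrightarrow> t / sqrt (1 + 0\<^sup>2 * t\<^sup>2)"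
    by (intro tendsto_intros d assms) auto
  then show ?thesis unfolding trunc_def by simp
qed

text \<open>The weak divergences of the two explicit vector fields to which
  \<open>weak_identity\<close> is applied: a constant field, and up to a factor the flux of the
  barrier.\<close>

lemma C1_0_integral_zero:
  assumes op: "open \<Omega>" and \<phi>: "\<phi> \<in> C1_0 \<Omega>"
  shows "(LINT x:\<Omega>|lebesgue. b \<bullet> gradient \<phi> x) = 0"
    "(LINT x:\<Omega>|lebesgue. (x - y) \<bullet> gradient \<phi> x) = - (LINT x:\<Omega>|lebesgue. real DIM('a) * \<phi> (x::'a::euclidean_space))"
proof -
  obtain K where K: "compact K" "K \<subseteq> \<Omega>" "\<And>x. x \<notin> K \<Longrightarrow> \<phi> x = 0" using C1_0_D(2)[OF \<phi>] by blast
  note C = C1_0_D(1)[OF \<phi>]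
  have g0: "gradient \<phi> x = 0" if "x \<notin> \<Omega>" for x
    using C1_grad_zero_off[OF C compact_imp_closed[OF K(1)] K(3)] that K(2) by blast
  have \<phi>0: "\<phi> x = 0" if "x \<notin> \<Omega>" for x using K that by blast
  have "(LINT x:\<Omega>|lebesgue. b \<bullet> gradient \<phi> x) = (LINT x|lebesgue. gradient \<phi> x \<bullet> b)"
    unfolding set_lebesgue_integral_def
    by (rule Bochner_Integration.integral_cong) (auto simp: g0 indicator_def inner_commute)
  then show "(LINT x:\<Omega>|lebesgue. b \<bullet> gradient \<phi> x) = 0"
    using integral_gradient_compact_support[OF C K(1,3)] by simp
  have "(LINT x:\<Omega>|lebesgue. (x - y) \<bullet> gradient \<phi> x) = (LINT x|lebesgue. (x - y) \<bullet> gradient \<phi> x)"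
    unfolding set_lebesgue_integral_def
    by (rule Bochner_Integration.integral_cong) (auto simp: g0 indicator_def)
  moreover have "(LINT x:\<Omega>|lebesgue. real DIM('a) * \<phi> x) = (LINT x|lebesgue. real DIM('a) * \<phi> x)"
    unfolding set_lebesgue_integral_def
    by (rule Bochner_Integration.integral_cong) (auto simp: \<phi>0 indicator_def)
  ultimately show "(LINT x:\<Omega>|lebesgue. (x - y) \<bullet> gradient \<phi> x) = - (LINT x:\<Omega>|lebesgue. real DIM('a) * \<phi> x)"
    using integral_position_gradient[OF C K(1,3), of y] by simp
qed

section \<open>The vector field of the p-Laplacian and its Young inequality\<close>

definition p_flux :: "real \<Rightarrow> 'a::euclidean_space \<Rightarrow> 'a" where
  "p_flux p z = norm z powr (p - 2) *\<^sub>R z"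

lemma p_flux_measurable[measurable]: "p_flux p \<in> borel_measurable borel"
  unfolding p_flux_def[abs_def] by measurable

lemma norm_p_flux: "norm (p_flux p z) = norm z powr (p - 1)"
  unfolding p_flux_def by (cases "z = 0") (auto simp: powr_diff power2_eq_square)

lemma p_flux_inner_self: "p_flux p z \<bullet> z = norm z powr p"
  unfolding p_flux_def by (cases "z = 0") (auto simp: powr_diff power2_norm_eq_inner[symmetric])

text \<open>The sharp coefficients matter. Absorbing this bound leaves exactly the fraction 1/p of
  the energy; multiplying by p then gives L^p with coefficient one, so no further exponential factor
  in p appears.\<close>

lemma young_powr:
  fixes L s p :: real
  assumes "L \<ge> 0" "s \<ge> 0" "p > 1"
  shows "L * s powr (p - 1) \<le> (1 - 1 / p) * s powr p + L powr p / p"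
proof -
  have "L * s powr (p - 1) \<le> L powr p / p + (s powr (p - 1)) powr (p / (p - 1)) / (p / (p - 1))"
    by (rule Youngs_inequality) (use assms in \<open>auto simp: field_simps\<close>)
  also have "(s powr (p - 1)) powr (p / (p - 1)) / (p / (p - 1)) = (1 - 1 / p) * s powr p"
  proof -
    have e: "(p - 1) * (p / (p - 1)) = p" using assms by simp
    show ?thesis unfolding powr_powr e using assms by (simp add: field_simps)
  qed
  finally show ?thesis by simp
qed

text \<open>Provides the support condition for testing with \<open>trunc \<delta> (v i - f)\<close>,
  since \<open>trunc \<delta>\<close> vanishes on the interval from -\<delta> to \<delta>.\<close>

lemma approx_support:
  fixes f :: "'a::euclidean_space \<Rightarrow> real"
  assumes op: "open \<Omega>" "bounded \<Omega>" and h: "continuous_on (closure \<Omega>) h" "\<And>x. x \<in> frontier \<Omega> \<Longrightarrow> h x = g x"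
    and v: "\<And>e. e > 0 \<Longrightarrow> \<forall>\<^sub>F i in sequentially. \<exists>K. compact K \<and> K \<subseteq> \<Omega> \<and> (\<forall>x\<in>closure \<Omega> - K. \<bar>v i x - h x\<bar> < e)"
    and f: "continuous_on UNIV f" "\<And>x. x \<in> frontier \<Omega> \<Longrightarrow> \<bar>f x - g x\<bar> \<le> \<delta> / 2" and \<delta>: "\<delta> > 0"
  shows "\<forall>\<^sub>F i in sequentially. \<exists>K. compact K \<and> K \<subseteq> \<Omega> \<and> (\<forall>x\<in>\<Omega> - K. \<bar>v i x - f x\<bar> \<le> \<delta>)"
proof -
  \<comment> \<open>On the boundary |f - h| is at most \<delta>/2, so this compact set lies inside
    \<Omega>; off it, a margin \<delta>/4 remains for the distance of \<open>v i\<close> from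
    \<open>h\<close>.\<close>
  define K0 where "K0 = {x \<in> closure \<Omega>. 3 * \<delta> / 4 \<le> \<bar>f x - h x\<bar>}"
  have c: "continuous_on (closure \<Omega>) (\<lambda>x. \<bar>f x - h x\<bar>)"
    using h(1) continuous_on_subset[OF f(1)] by (auto intro!: continuous_intros)
  have "closed K0"
    unfolding K0_def by (rule continuous_on_closed_Collect_le[OF continuous_on_const c closed_closure])
  then have K0: "compact K0"
    using bounded_closure[OF op(2)] bounded_subset[of "closure \<Omega>" K0] by (auto simp: compact_eq_bounded_closed K0_def)
  have K0\<Omega>: "K0 \<subseteq> \<Omega>"
  proof
    fix x assume x: "x \<in> K0"
    show "x \<in> \<Omega>"
    proof (rule ccontr)
      assume "x \<notin> \<Omega>"
      then have "x \<in> frontier \<Omega>" using x op(1) unfolding K0_def frontier_def by (simp add: interior_open)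
      then show False using f(2)[of x] h(2)[of x] x \<delta> unfolding K0_def by simp
    qed
  qed
  have "\<forall>\<^sub>F i in sequentially. \<exists>K. compact K \<and> K \<subseteq> \<Omega> \<and> (\<forall>x\<in>closure \<Omega> - K. \<bar>v i x - h x\<bar> < \<delta> / 4)"
    using v[of "\<delta>/4"] \<delta> by simp
  then show ?thesis
  proof eventually_elim
    case (elim i)
    then obtain K where K: "compact K" "K \<subseteq> \<Omega>" "\<And>x. x \<in> closure \<Omega> - K \<Longrightarrow> \<bar>v i x - h x\<bar> < \<delta> / 4" by blast
    show ?case
    proof (intro exI conjI ballI)
      show "compact (K \<union> K0)" using K K0 by auto
      show "K \<union> K0 \<subseteq> \<Omega>" using K K0\<Omega> by auto
      fix x assume "x \<in> \<Omega> - (K \<union> K0)"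
      then have "x \<in> closure \<Omega> - K" "x \<notin> K0" using closure_subset by auto
      then have "\<bar>v i x - h x\<bar> < \<delta> / 4" "\<bar>f x - h x\<bar> < 3 * \<delta> / 4"
        using K(3) unfolding K0_def by auto
      then show "\<bar>v i x - f x\<bar> \<le> \<delta>" by linarith
    qed
  qed
qed

section \<open>Energy and gradient estimates with explicit dependence on p, and their limit\<close>

section \<open>The Lipschitz bound\<close>

text \<open>Both parts of the energy bound are divided by K^p with K = 2 (L + 1); as L / K and 1 / K
  are at most one half, each quotient decays like 2^(-p).\<close>

lemma half_powr_le:
  assumes "L \<ge> 0" "p > 1"
  shows "L powr p / (2 * (L + 1)) powr p \<le> 1 / 2 powr p" "1 / (2 * (L + 1)) powr p \<le> 1 / 2 powr (p::real)"
proof -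
  have "(L / (2 * (L + 1))) powr p \<le> (1 / 2) powr p"
    using assms by (intro powr_mono2) (auto simp: divide_simps)
  then show "L powr p / (2 * (L + 1)) powr p \<le> 1 / 2 powr p"
    using assms by (simp add: powr_divide)
  have "2 powr p \<le> (2 * (L + 1)) powr p" using assms by (intro powr_mono2) auto
  then show "1 / (2 * (L + 1)) powr p \<le> 1 / 2 powr p" using assms by (intro divide_left_mono) (auto intro!: mult_pos_pos)
qed

text \<open>The test function is \<open>trunc \<delta> (u - f)\<close> without cut-off. Since
  \<open>trunc \<delta>\<close> is bounded by 1 / \<delta>, the right-hand side of the equation
  contributes at most M / \<delta> per unit of volume, and multiplication by p makes this only
  linear in p.\<close>

lemma truncated_energy_bound:
  fixes u :: "'a::euclidean_space \<Rightarrow> real"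
  assumes op: "open \<Omega>" "bounded \<Omega>" and p: "p > 1" and uG: "W1p_grad p \<Omega> u G" and sa: "strong_approx p \<Omega> u G v V"
    and weak: "\<And>\<phi>. \<phi> \<in> C1_0 \<Omega> \<Longrightarrow> (LINT x:\<Omega>|lebesgue. p_flux p (G x) \<bullet> gradient \<phi> x) =
           - (LINT x:\<Omega>|lebesgue. lam x * indicator {y. u y > 0} x * \<phi> x)"
    and lam: "lam \<in> borel_measurable (lebesgue_on \<Omega>)" "\<And>x. x \<in> \<Omega> \<Longrightarrow> \<bar>lam x\<bar> \<le> M" "M \<ge> 0"
    and f: "C1_grad \<Omega> f F" "\<And>x. x \<in> \<Omega> \<Longrightarrow> norm (F x) \<le> L" "L \<ge> 0"
    and \<delta>: "\<delta> > 0"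
    and supp: "\<forall>\<^sub>F i in sequentially. \<exists>K. compact K \<and> K \<subseteq> \<Omega> \<and> (\<forall>x\<in>\<Omega> - K. \<bar>v i x - f x\<bar> \<le> \<delta>)"
  shows "integrable (lebesgue_on \<Omega>) (\<lambda>x. trunc' \<delta> (u x - f x) * norm (G x) powr p)"
    "(LINT x|lebesgue_on \<Omega>. trunc' \<delta> (u x - f x) * norm (G x) powr p) \<le> measure (lebesgue_on \<Omega>) \<Omega> * (L powr p + p * (M / \<delta>))"
proof -
  let ?M = "lebesgue_on \<Omega>"
  have sl: "\<Omega> \<in> sets lebesgue" using op(1) by auto
  interpret finite_measure ?M by (rule finite_measure_lebesgue_on_bounded[OF sl op(2)])
  have Lp: "Lp_on p \<Omega> u" "Lp_on p \<Omega> G" using uG unfolding W1p_grad_def by auto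
  have um[measurable]: "u \<in> borel_measurable ?M" and Gm[measurable]: "G \<in> borel_measurable ?M"
    using Lp_onD(1)[OF sl] Lp by auto
  note [measurable] = lam(1)
  have fm[measurable]: "f \<in> borel_measurable ?M" "F \<in> borel_measurable ?M"
    using C1_grad_continuous[OF f(1)] C1_gradD(2)[OF f(1)] by (auto intro!: continuous_on_open_measurable op)
  have Tm[measurable]: "trunc' \<delta> \<in> borel_measurable borel"
    by (rule borel_measurable_continuous_onI[OF trunc_props(1)[OF \<delta>]])
  define \<kappa> where "\<kappa> x = lam x * indicat_real {y. u y > 0} x" for x
  have \<kappa>m[measurable]: "\<kappa> \<in> borel_measurable ?M"
  proof -
    have "(\<lambda>x. if u x > 0 then lam x else 0) \<in> borel_measurable ?M" by measurable
    also have "(\<lambda>x. if u x > 0 then lam x else 0) = \<kappa>" unfolding \<kappa>_def by auto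
    finally show ?thesis .
  qed
  have \<kappa>b: "\<bar>\<kappa> x\<bar> \<le> M" if "x \<in> \<Omega>" for x
    using lam(2)[OF that] lam(3) unfolding \<kappa>_def by (auto simp: indicator_def)
  define B where "B = max L (max 1 (1 / \<delta>))"
  have B: "L \<le> B" "1 \<le> B" "1 / \<delta> \<le> B" unfolding B_def by auto
  define t where "t x = trunc' \<delta> (u x - f x)" for x
  have t01: "0 \<le> t x" "t x \<le> 1" for x unfolding t_def using trunc_props(2,3)[OF \<delta>] by auto
  have tm[measurable]: "t \<in> borel_measurable ?M" unfolding t_def by measurable
  have id: "integrable ?M (\<lambda>x. p_flux p (G x) \<bullet> (1 *\<^sub>R (t x *\<^sub>R (G x - F x)) + trunc \<delta> (u x - f x) *\<^sub>R 0))"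
    "integrable ?M (\<lambda>x. \<kappa> x * (1 * trunc \<delta> (u x - f x)))"
    "(LINT x|?M. p_flux p (G x) \<bullet> (1 *\<^sub>R (t x *\<^sub>R (G x - F x)) + trunc \<delta> (u x - f x) *\<^sub>R 0))
       = - (LINT x|?M. \<kappa> x * (1 * trunc \<delta> (u x - f x)))"
  proof -
    have a1: "(\<lambda>x. p_flux p (G x)) \<in> borel_measurable ?M" by measurable
    \<comment> \<open>\<open>weak_identity\<close> has a single constant for the growth of the
      field, here 1, and for the bound on the right-hand side, here M.\<close>
    have a2: "norm (p_flux p (G x)) \<le> max 1 M * (1 + norm (G x) powr (p - 1))" for x
    proof -
      have "1 * (norm (G x) powr (p - 1)) \<le> max 1 M * (1 + norm (G x) powr (p - 1))" by (intro mult_mono) auto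
      then show ?thesis by (simp add: norm_p_flux)
    qed
    have a3: "\<bar>\<kappa> x\<bar> \<le> max 1 M" if "x \<in> \<Omega>" for x using \<kappa>b[OF that] by simp
    have a4: "(LINT x:\<Omega>|lebesgue. p_flux p (G x) \<bullet> gradient \<phi> x) = - (LINT x:\<Omega>|lebesgue. \<kappa> x * \<phi> x)" if "\<phi> \<in> C1_0 \<Omega>" for \<phi>
      using weak[OF that] unfolding \<kappa>_def .
    have a5: "norm (F x) \<le> B" if "x \<in> \<Omega>" for x using f(2)[OF that] B by linarith
    have a6: "\<bar>1::real\<bar> \<le> B" "norm (0::'a) \<le> B" using B by auto
    have a7: "\<bar>trunc \<delta> s\<bar> \<le> B" "\<bar>trunc' \<delta> s\<bar> \<le> B" for s
      using trunc_props(2-4)[OF \<delta>, of s] B by auto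
    have a8: "\<forall>\<^sub>F i in sequentially. \<exists>K. compact K \<and> K \<subseteq> \<Omega> \<and> (\<forall>x\<in>\<Omega> - K. 1 * trunc \<delta> (v i x - f x) = 0)"
      using supp
    proof eventually_elim
      case (elim i)
      then obtain K where "compact K" "K \<subseteq> \<Omega>" "\<forall>x\<in>\<Omega> - K. \<bar>v i x - f x\<bar> \<le> \<delta>" by blast
      then show ?case using trunc_props(5)[OF \<delta>] by (intro exI[of _ K]) auto
    qed
    note wi = weak_identity[where \<eta>="\<lambda>x. 1" and E="\<lambda>x. 0" and T="trunc \<delta>" and T'="trunc' \<delta>" and Y="\<lambda>x. p_flux p (G x)"
        and \<kappa>=\<kappa> and c="max 1 M" and B=B, OF op p um Lp(2) sa a1 a2 \<kappa>m a3 a4 f(1) a5 C1_grad_const a6 DERIV_trunc[OF \<delta>] trunc_props(1)[OF \<delta>] a7 a8]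
    show "integrable ?M (\<lambda>x. p_flux p (G x) \<bullet> (1 *\<^sub>R (t x *\<^sub>R (G x - F x)) + trunc \<delta> (u x - f x) *\<^sub>R 0))"
      unfolding t_def by (rule wi(1))
    show "integrable ?M (\<lambda>x. \<kappa> x * (1 * trunc \<delta> (u x - f x)))" by (rule wi(2))
    show "(LINT x|?M. p_flux p (G x) \<bullet> (1 *\<^sub>R (t x *\<^sub>R (G x - F x)) + trunc \<delta> (u x - f x) *\<^sub>R 0))
         = - (LINT x|?M. \<kappa> x * (1 * trunc \<delta> (u x - f x)))"
      unfolding t_def by (rule wi(3))
  qed
  have Gp: "integrable ?M (\<lambda>x. norm (G x) powr p)" using Lp_onD(2)[OF sl Lp(2)] .
  show i1: "integrable ?M (\<lambda>x. trunc' \<delta> (u x - f x) * norm (G x) powr p)"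
  proof (rule Bochner_Integration.integrable_bound[OF Gp])
    show "AE x in ?M. norm (trunc' \<delta> (u x - f x) * norm (G x) powr p) \<le> norm (norm (G x) powr p)"
      using t01 unfolding t_def by (intro AE_I2) (simp add: abs_mult mult_left_le_one_le)
  qed measurable
  have AE_\<Omega>: "AE x in ?M. x \<in> \<Omega>" using AE_space by eventually_elim simp
  \<comment> \<open>Young gives |G|^p / p - L^p / p as a lower bound for the flux paired with G - F.
    It is multiplied by the weight \<open>t x\<close>, and the negative term is then estimated with
    \<open>t x \<le> 1\<close>.\<close>
  have "(LINT x|?M. t x * (norm (G x) powr p / p) - L powr p / p)
      \<le> (LINT x|?M. p_flux p (G x) \<bullet> (1 *\<^sub>R (t x *\<^sub>R (G x - F x)) + trunc \<delta> (u x - f x) *\<^sub>R 0))"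
  proof (rule integral_mono_AE[OF _ id(1)])
    show "integrable ?M (\<lambda>x. t x * (norm (G x) powr p / p) - L powr p / p)"
      using Bochner_Integration.integrable_diff[OF integrable_divide[OF i1, of p] integrable_const[of "L powr p / p"]]
      unfolding t_def by simp
    show "AE x in ?M. t x * (norm (G x) powr p / p) - L powr p / p \<le> p_flux p (G x) \<bullet> (1 *\<^sub>R (t x *\<^sub>R (G x - F x)) + trunc \<delta> (u x - f x) *\<^sub>R 0)"
      using AE_\<Omega>
    proof eventually_elim
      case (elim x)
      have "p_flux p (G x) \<bullet> F x \<le> norm (G x) powr (p - 1) * L"
        using norm_cauchy_schwarz[of "p_flux p (G x)" "F x"] mult_left_mono[OF f(2)[OF elim], of "norm (p_flux p (G x))"]
        by (simp add: norm_p_flux)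
      also have "\<dots> \<le> (1 - 1 / p) * norm (G x) powr p + L powr p / p"
        using young_powr[OF f(3) norm_ge_zero[of "G x"] p] by (simp add: mult.commute)
      finally have "norm (G x) powr p / p - L powr p / p \<le> p_flux p (G x) \<bullet> (G x - F x)"
        unfolding inner_diff_right p_flux_inner_self by (simp add: left_diff_distrib)
      then have "t x * (norm (G x) powr p / p - L powr p / p) \<le> t x * (p_flux p (G x) \<bullet> (G x - F x))"
        using t01(1) by (rule mult_left_mono)
      moreover have "t x * (L powr p / p) \<le> L powr p / p" using t01[of x] p by (intro mult_left_le_one_le) auto
      ultimately show ?case by (simp add: right_diff_distrib)
    qed
  qed
  also have "\<dots> = (LINT x|?M. - (\<kappa> x * (1 * trunc \<delta> (u x - f x))))" unfolding id(3) by simp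
  also have "\<dots> \<le> (LINT x|?M. M / \<delta>)"
  proof (rule integral_mono_AE)
    show "AE x in ?M. - (\<kappa> x * (1 * trunc \<delta> (u x - f x))) \<le> M / \<delta>"
      using AE_\<Omega>
    proof eventually_elim
      case (elim x)
      have "\<bar>\<kappa> x * trunc \<delta> (u x - f x)\<bar> \<le> M * (1 / \<delta>)"
        unfolding abs_mult using \<kappa>b[OF elim] trunc_props(4)[OF \<delta>] lam(3) by (intro mult_mono) auto
      then show ?case by auto
    qed
  qed (use id(2) in auto)
  also have "(LINT x|?M. t x * (norm (G x) powr p / p) - L powr p / p)
     = (LINT x|?M. t x * norm (G x) powr p) / p - measure ?M \<Omega> * (L powr p / p)"
  proof -
    have "integrable ?M (\<lambda>x. t x * norm (G x) powr p / p)" using i1 unfolding t_def by simp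
    then show ?thesis by (simp add: Bochner_Integration.integral_diff)
  qed
  finally have "(LINT x|?M. t x * norm (G x) powr p) / p \<le> measure ?M \<Omega> * (L powr p / p) + measure ?M \<Omega> * (M / \<delta>)" by simp
  then have "(LINT x|?M. t x * norm (G x) powr p) \<le> (measure ?M \<Omega> * (L powr p / p) + measure ?M \<Omega> * (M / \<delta>)) * p"
    using p by (simp add: divide_le_eq)
  also have "\<dots> = measure ?M \<Omega> * (L powr p + p * (M / \<delta>))" using p by (simp add: field_simps)
  finally show "(LINT x|?M. trunc' \<delta> (u x - f x) * norm (G x) powr p) \<le> measure ?M \<Omega> * (L powr p + p * (M / \<delta>))"
    unfolding t_def .
qed


text \<open>\<open>weak_identity\<close> for the constant field \<open>b\<close> moves the
  derivative from \<phi> to the truncation. Gradients up to size \<open>K\<close> are charged to the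
  L^1 norm of \<phi>, larger ones to the energy. The sup bound \<open>A\<close> of \<phi> multiplies
  only the energy term, which disappears as p -> oo, so the limit is an estimate by the L^1 norm
  alone.\<close>

lemma truncated_gradient_bound:
  fixes u :: "'a::euclidean_space \<Rightarrow> real"
  assumes op: "open \<Omega>" "bounded \<Omega>" and p: "p > 1" and uG: "W1p_grad p \<Omega> u G" and sa: "strong_approx p \<Omega> u G v V"
    and f: "C1_grad \<Omega> f F" "\<And>x. x \<in> \<Omega> \<Longrightarrow> norm (F x) \<le> L" "L \<ge> 0"
    and \<delta>: "\<delta> > 0" and K: "K > 0"
    and \<phi>: "\<phi> \<in> C1_0 \<Omega>" "\<And>x. \<bar>\<phi> x\<bar> \<le> A" and b: "norm b \<le> 1"
    and energy: "integrable (lebesgue_on \<Omega>) (\<lambda>x. trunc' \<delta> (u x - f x) * norm (G x) powr p)"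
  shows "\<bar>LINT x|lebesgue_on \<Omega>. trunc \<delta> (u x - f x) * (gradient \<phi> x \<bullet> b)\<bar>
    \<le> (K + L) * (LINT x|lebesgue_on \<Omega>. \<bar>\<phi> x\<bar>)
      + A * K * ((LINT x|lebesgue_on \<Omega>. trunc' \<delta> (u x - f x) * norm (G x) powr p) / K powr p)"
proof -
  let ?M = "lebesgue_on \<Omega>"
  have sl: "\<Omega> \<in> sets lebesgue" using op(1) by auto
  interpret finite_measure ?M by (rule finite_measure_lebesgue_on_bounded[OF sl op(2)])
  have Lp: "Lp_on p \<Omega> u" "Lp_on p \<Omega> G" using uG unfolding W1p_grad_def by auto
  have um: "u \<in> borel_measurable ?M" using Lp_onD(1)[OF sl] Lp by auto
  obtain S where S: "compact S" "S \<subseteq> \<Omega>" "\<And>x. x \<notin> S \<Longrightarrow> \<phi> x = 0" using C1_0_D(2)[OF \<phi>(1)] by blast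
  note C\<phi> = C1_0_D(1)[OF \<phi>(1)]
  obtain A' where A': "\<And>x. norm (gradient \<phi> x) \<le> A'" using C1_compact_support_bounds[OF C\<phi> S(1,3)] by metis
  have A0: "A \<ge> 0" using \<phi>(2)[of undefined] by linarith
  define B where "B = max L (max 1 (max (1 / \<delta>) (max A A')))"
  have B: "L \<le> B" "1 \<le> B" "1 / \<delta> \<le> B" "A \<le> B" "A' \<le> B" unfolding B_def by auto
  define t where "t x = trunc' \<delta> (u x - f x)" for x
  have t01: "0 \<le> t x" "t x \<le> 1" for x unfolding t_def using trunc_props(2,3)[OF \<delta>] by auto
  have a1: "(\<lambda>x. b) \<in> borel_measurable ?M" by simp
  have a2: "norm b \<le> 1 * (1 + norm (G x) powr (p - 1))" for x using b by (simp add: add_increasing2)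
  have a3: "(\<lambda>x. 0) \<in> borel_measurable ?M" "\<bar>0::real\<bar> \<le> 1" by simp_all
  have a4: "(LINT x:\<Omega>|lebesgue. b \<bullet> gradient \<psi> x) = - (LINT x:\<Omega>|lebesgue. 0 * \<psi> x)" if "\<psi> \<in> C1_0 \<Omega>" for \<psi>
    using C1_0_integral_zero(1)[OF op(1) that, of b] by (simp add: set_lebesgue_integral_def)
  have a5: "norm (F x) \<le> B" if "x \<in> \<Omega>" for x using f(2)[OF that] B by linarith
  have a6: "\<bar>\<phi> x\<bar> \<le> B" "norm (gradient \<phi> x) \<le> B" for x using \<phi>(2)[of x] A'[of x] B by auto
  have a7: "\<bar>trunc \<delta> s\<bar> \<le> B" "\<bar>trunc' \<delta> s\<bar> \<le> B" for s
    using trunc_props(2-4)[OF \<delta>, of s] B by auto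
  have a8: "\<forall>\<^sub>F i in sequentially. \<exists>K. compact K \<and> K \<subseteq> \<Omega> \<and> (\<forall>x\<in>\<Omega> - K. \<phi> x * trunc \<delta> (v i x - f x) = 0)"
    using S by (intro always_eventually allI exI[of _ S]) auto
  note wi = weak_identity[where \<eta>=\<phi> and E="gradient \<phi>" and T="trunc \<delta>" and T'="trunc' \<delta>" and Y="\<lambda>x. b"
      and \<kappa>="\<lambda>x. 0" and c=1 and B=B, OF op p um Lp(2) sa a1 a2 a3 a4 f(1) a5 C1_grad_subset[OF C\<phi> subset_UNIV] a6
      DERIV_trunc[OF \<delta>] trunc_props(1)[OF \<delta>] a7 a8, folded t_def]
  have i\<phi>: "integrable ?M (\<lambda>x. 1 * \<phi> x)"
    by (rule C1_0_integrable_mult(1)[OF sl _ \<phi>(1)]) simp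
  then have i\<phi>': "integrable ?M (\<lambda>x. \<bar>\<phi> x\<bar>)" by simp
  have Tm[measurable]: "trunc \<delta> \<in> borel_measurable borel"
    by (rule borel_measurable_continuous_onI)
       (use DERIV_trunc[OF \<delta>] DERIV_continuous in \<open>blast intro: continuous_at_imp_continuous_on\<close>)
  have fm[measurable]: "f \<in> borel_measurable ?M"
    using C1_grad_continuous[OF f(1)] by (rule continuous_on_open_measurable[OF op(1)])
  note [measurable] = um
  have iT: "integrable ?M (\<lambda>x. trunc \<delta> (u x - f x))"
    by (rule integrable_const_bound[where B="1/\<delta>"]) (use trunc_props(4)[OF \<delta>] in \<open>auto intro!: AE_I2\<close>)
  have i1: "integrable ?M (\<lambda>x. trunc \<delta> (u x - f x) * (gradient \<phi> x \<bullet> b))"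
    by (rule C1_0_integrable_mult(2)[OF sl iT \<phi>(1)])
  have eq: "b \<bullet> (\<phi> x *\<^sub>R (t x *\<^sub>R (G x - F x)) + trunc \<delta> (u x - f x) *\<^sub>R gradient \<phi> x)
      = \<phi> x * t x * ((G x - F x) \<bullet> b) + trunc \<delta> (u x - f x) * (gradient \<phi> x \<bullet> b)" for x
    by (simp add: inner_add_right inner_commute)
  have i2: "integrable ?M (\<lambda>x. \<phi> x * t x * ((G x - F x) \<bullet> b))"
    using Bochner_Integration.integrable_diff[OF wi(1) i1] unfolding eq by simp
  have "(LINT x|?M. \<phi> x * t x * ((G x - F x) \<bullet> b)) + (LINT x|?M. trunc \<delta> (u x - f x) * (gradient \<phi> x \<bullet> b)) = 0"
    using wi(3) unfolding eq Bochner_Integration.integral_add[OF i2 i1] by simp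
  then have "\<bar>LINT x|?M. trunc \<delta> (u x - f x) * (gradient \<phi> x \<bullet> b)\<bar> = norm (LINT x|?M. \<phi> x * t x * ((G x - F x) \<bullet> b))"
    unfolding real_norm_def by linarith
  also have "\<dots> \<le> (LINT x|?M. norm (\<phi> x * t x * ((G x - F x) \<bullet> b)))" by (rule integral_norm_bound)
  also have "\<dots> \<le> (LINT x|?M. (K + L) * \<bar>\<phi> x\<bar> + A * K * ((t x * norm (G x) powr p) / K powr p))"
  proof (rule integral_mono_AE)
    show "integrable ?M (\<lambda>x. norm (\<phi> x * t x * ((G x - F x) \<bullet> b)))" using i2 by (rule integrable_norm)
    show "integrable ?M (\<lambda>x. (K + L) * \<bar>\<phi> x\<bar> + A * K * ((t x * norm (G x) powr p) / K powr p))"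
      using i\<phi>' energy unfolding t_def by (intro Bochner_Integration.integrable_add integrable_mult_right integrable_divide) auto
    have AE_\<Omega>: "AE x in ?M. x \<in> \<Omega>" using AE_space by eventually_elim simp
    then show "AE x in ?M. norm (\<phi> x * t x * ((G x - F x) \<bullet> b)) \<le> (K + L) * \<bar>\<phi> x\<bar> + A * K * ((t x * norm (G x) powr p) / K powr p)"
    proof eventually_elim
      case (elim x)
      have "\<bar>(G x - F x) \<bullet> b\<bar> \<le> norm (G x - F x) * norm b" by (rule Cauchy_Schwarz_ineq2)
      also have "\<dots> \<le> norm (G x - F x)" using b by (simp add: mult_left_le)
      also have "\<dots> \<le> norm (G x) + L" using norm_triangle_ineq4[of "G x" "F x"] f(2)[OF elim] by linarith
      finally have le: "\<bar>(G x - F x) \<bullet> b\<bar> \<le> norm (G x) + L" .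
      have "norm (\<phi> x * t x * ((G x - F x) \<bullet> b)) = (\<bar>\<phi> x\<bar> * t x) * \<bar>(G x - F x) \<bullet> b\<bar>"
        using t01(1)[of x] by (simp add: abs_mult)
      also have "\<dots> \<le> (\<bar>\<phi> x\<bar> * t x) * (norm (G x) + L)" using t01(1)[of x] by (intro mult_left_mono le) auto
      also have "\<dots> = \<bar>\<phi> x\<bar> * (t x * norm (G x)) + (\<bar>\<phi> x\<bar> * L) * t x" by (simp add: algebra_simps)
      also have "(\<bar>\<phi> x\<bar> * L) * t x \<le> \<bar>\<phi> x\<bar> * L" using t01[of x] f(3) by (intro mult_left_le) auto
      \<comment> \<open>Chebyshev: where |G| > K, also |G| \<le> K (|G| / K)^p.\<close>
      also have "\<bar>\<phi> x\<bar> * (t x * norm (G x)) \<le> K * \<bar>\<phi> x\<bar> + A * K * ((t x * norm (G x) powr p) / K powr p)"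
      proof (cases "norm (G x) \<le> K")
        case True
        have "t x * norm (G x) \<le> 1 * K" using t01[of x] True by (intro mult_mono) auto
        then have "\<bar>\<phi> x\<bar> * (t x * norm (G x)) \<le> \<bar>\<phi> x\<bar> * K" by (intro mult_left_mono) auto
        moreover have "0 \<le> A * K * ((t x * norm (G x) powr p) / K powr p)" using A0 K t01(1)[of x] by simp
        ultimately show ?thesis by (simp add: mult.commute)
      next
        case False
        then have g: "norm (G x) / K \<ge> 1" using K by simp
        have "(norm (G x) / K) powr 1 \<le> (norm (G x) / K) powr p" using g p by (intro powr_mono) auto
        then have "norm (G x) / K \<le> norm (G x) powr p / K powr p" using K by (simp add: powr_divide)
        then have "norm (G x) \<le> K * (norm (G x) powr p / K powr p)" using K by (simp add: divide_le_eq mult.commute)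
        then have "t x * norm (G x) \<le> t x * (K * (norm (G x) powr p / K powr p))" using t01(1) by (rule mult_left_mono)
        then have "\<bar>\<phi> x\<bar> * (t x * norm (G x)) \<le> A * (t x * (K * (norm (G x) powr p / K powr p)))"
          by (rule mult_mono[OF \<phi>(2) _ A0]) (use t01(1)[of x] in simp)
        then show ?thesis using K by (simp add: mult_ac add_increasing)
      qed
      finally show ?case by (simp add: algebra_simps)
    qed
  qed
  also have "\<dots> = (K + L) * (LINT x|?M. \<bar>\<phi> x\<bar>) + A * K * ((LINT x|?M. t x * norm (G x) powr p) / K powr p)"
  proof -
    have "integrable ?M (\<lambda>x. (K + L) * \<bar>\<phi> x\<bar>)" using i\<phi>' by (rule integrable_mult_right)
    moreover have "integrable ?M (\<lambda>x. A * K * ((t x * norm (G x) powr p) / K powr p))"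
      using energy unfolding t_def by (intro integrable_mult_right integrable_divide)
    ultimately show ?thesis by simp
  qed
  finally show ?thesis unfolding t_def .
qed

lemma lipschitz_C1_approx:
  fixes h :: "'a::euclidean_space \<Rightarrow> real"
  assumes "bounded \<Omega>" "C-lipschitz_on UNIV h" "e > 0"
  obtains f F where "C1_grad UNIV f F" "\<And>x. x \<in> closure \<Omega> \<Longrightarrow> norm (F x) \<le> C" "\<And>x. x \<in> closure \<Omega> \<Longrightarrow> \<bar>f x - h x\<bar> \<le> e"
proof -
  have C0: "C \<ge> 0" using assms(2) by (rule lipschitz_on_nonneg)
  obtain R0 where R0: "\<And>x. x \<in> closure \<Omega> \<Longrightarrow> norm x \<le> R0"
    using bounded_closure[OF assms(1)] unfolding bounded_iff by blast
  define r where "r = e / (C + 1)"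
  have r: "r > 0" "C * r \<le> e" unfolding r_def using C0 assms(3) by (auto simp: field_simps add_pos_nonneg)
  define w where "w = (\<lambda>x. indicat_real (cball 0 (R0 + r + 1)) x *\<^sub>R h x)"
  have x: "norm x + r < R0 + r + 1" if "x \<in> closure \<Omega>" for x using R0[OF that] by simp
  note ml = mollify_lipschitz[OF r(1) assms(2) _ w_def]
  have wi: "integrable lborel w"
    unfolding w_def
    by (rule borel_integrable_compact[OF compact_cball continuous_on_subset[OF lipschitz_on_continuous_on[OF assms(2)]]]) simp
  show ?thesis
    by (rule that[OF mollify_C1_grad[OF r(1) wi] ml(3)[OF x] order_trans[OF ml(2)[OF x] r(2)]])
qed

text \<open>For fixed \<delta>, letting k -> oo bounds each distributional partial derivative of
  \<open>trunc \<delta> (u_inf - f)\<close> by K + L = 3 L + 2, after which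
  \<open>weak_bound_lipschitz\<close> applies on the given ball. Letting \<delta> -> 0 replaces the
  truncation by \<open>u_inf - h\<close>, and adding the L-Lipschitz \<open>h\<close> back produces
  the last summand L.\<close>

lemma limit_lipschitz:
  fixes u :: "nat \<Rightarrow> 'a::euclidean_space \<Rightarrow> real"
  assumes op: "open \<Omega>" "bounded \<Omega>" "\<Omega> \<noteq> {}" "frontier \<Omega> \<noteq> {}" and g: "L-lipschitz_on (frontier \<Omega>) g"
    and lam: "lam \<in> borel_measurable (lebesgue_on \<Omega>)" "\<And>x. x \<in> \<Omega> \<Longrightarrow> \<bar>lam x\<bar> \<le> M" "M \<ge> 0"
    and p: "\<And>k. 1 < p k" "filterlim p at_top sequentially"
    and u: "\<And>k. weak_solution (p k) \<Omega> lam g (u k)" "\<And>k. continuous_on \<Omega> (u k)"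
    and lim: "uniform_limit \<Omega> u u_inf sequentially"
    and ball: "ball c R \<subseteq> \<Omega>" "x \<in> ball c R" "y \<in> ball c R"
  shows "\<bar>u_inf x - u_inf y\<bar> \<le> (real DIM('a) * (3 * L + 2) + L) * norm (x - y)"
proof -
  let ?M = "lebesgue_on \<Omega>"
  have sl: "\<Omega> \<in> sets lebesgue" using op(1) by auto
  interpret finite_measure ?M by (rule finite_measure_lebesgue_on_bounded[OF sl op(2)])
  have L0: "L \<ge> 0" using g by (rule lipschitz_on_nonneg)
  define K where "K = 2 * (L + 1)"
  have K: "K > 0" unfolding K_def using L0 by simp
  have uc: "continuous_on \<Omega> u_inf"
    by (rule uniform_limit_theorem[OF _ lim]) (use u(2) in auto)
  obtain h where h: "L-lipschitz_on UNIV h" "\<And>x. x \<in> frontier \<Omega> \<Longrightarrow> h x = g x"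
    using McShane_extension[OF g op(4)] by blast
  have xy: "x \<in> \<Omega>" "y \<in> \<Omega>" using ball by auto
  have main: "\<exists>f. (\<forall>x\<in>closure \<Omega>. \<bar>f x - h x\<bar> \<le> \<delta> / 2) \<and>
      \<bar>trunc \<delta> (u_inf x - f x) - trunc \<delta> (u_inf y - f y)\<bar> \<le> real DIM('a) * (K + L) * norm (x - y)"
    if \<delta>: "\<delta> > 0" for \<delta>
  proof -
    obtain f F where f: "C1_grad UNIV f F" "\<And>x. x \<in> closure \<Omega> \<Longrightarrow> norm (F x) \<le> L" "\<And>x. x \<in> closure \<Omega> \<Longrightarrow> \<bar>f x - h x\<bar> \<le> \<delta> / 2"
      using lipschitz_C1_approx[OF op(2) h(1), of "\<delta>/2"] \<delta> by auto
    have fF: "C1_grad \<Omega> f F" "\<And>x. x \<in> \<Omega> \<Longrightarrow> norm (F x) \<le> L"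
      using C1_grad_subset[OF f(1)] f(2) closure_subset by blast+
    have ffr: "\<bar>f x - g x\<bar> \<le> \<delta> / 2" if "x \<in> frontier \<Omega>" for x
      using f(3)[of x] h(2)[OF that] that unfolding frontier_def by auto
    have Tc: "continuous_on UNIV (trunc \<delta>)"
      using DERIV_trunc[OF \<delta>] DERIV_continuous by (blast intro: continuous_at_imp_continuous_on)
    have cT: "continuous_on \<Omega> (\<lambda>x. trunc \<delta> (w x - f x))" if "continuous_on \<Omega> w" for w
      by (rule continuous_on_compose2[OF Tc]) (auto intro!: continuous_intros that C1_grad_continuous[OF fF(1)])
    define m where "m = measure ?M \<Omega>"
    have m: "m \<ge> 0" unfolding m_def by simp
    have step: "\<bar>LINT x|?M. trunc \<delta> (u k x - f x) * (gradient \<phi> x \<bullet> b)\<bar>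
        \<le> (K + L) * (LINT x|?M. \<bar>\<phi> x\<bar>) + A * K * (m * (1 / 2 powr p k + M / \<delta> * (p k / 2 powr p k)))"
      if \<phi>: "\<phi> \<in> C1_0 \<Omega>" "\<And>x. \<bar>\<phi> x\<bar> \<le> A" and b: "b \<in> Basis" for \<phi> b k A
    proof -
      have A0: "A \<ge> 0" using \<phi>(2)[of undefined] by linarith
      obtain G where uG: "W1p_grad (p k) \<Omega> (u k) G"
        and weak: "\<And>\<phi>. \<phi> \<in> C1_0 \<Omega> \<Longrightarrow> (LINT x:\<Omega>|lebesgue. p_flux (p k) (G x) \<bullet> gradient \<phi> x) =
           - (LINT x:\<Omega>|lebesgue. lam x * indicator {y. u k y > 0} x * \<phi> x)"
        and bv: "has_boundary_value (p k) \<Omega> (u k) g"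
        using u(1)[of k] unfolding weak_solution_def p_flux_def by blast
      obtain v V h' where v: "\<And>i::nat. C1_grad UNIV (v i) (V i)"
        "AE x in ?M. (\<lambda>i. v i x) \<longlonglongrightarrow> u k x"
        "\<And>i. integrable ?M (\<lambda>x. (1 + norm (G x) powr (p k - 1)) * norm (V i x - G x))"
        "(\<lambda>i. LINT x|?M. (1 + norm (G x) powr (p k - 1)) * norm (V i x - G x)) \<longlonglongrightarrow> 0"
        and h': "continuous_on (closure \<Omega>) h'" "\<And>x. x \<in> frontier \<Omega> \<Longrightarrow> h' x = g x"
        "\<And>e. e > 0 \<Longrightarrow> \<forall>\<^sub>F i in sequentially. \<exists>K. compact K \<and> K \<subseteq> \<Omega> \<and> (\<forall>x\<in>closure \<Omega> - K. \<bar>v i x - h' x\<bar> < e)"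
        by (rule weak_solution_approximation[OF op(1-3) p(1) uG bv]) (rule that; assumption)
      have sa: "strong_approx (p k) \<Omega> (u k) G v V" unfolding strong_approx_def using v by blast
      note supp = approx_support[OF op(1,2) h' C1_grad_continuous[OF f(1)] ffr \<delta>]
      note E = truncated_energy_bound[OF op(1,2) p(1) uG sa weak lam fF L0 \<delta> supp, folded m_def]
      have nb: "norm b \<le> 1" using b by simp
      note T = truncated_gradient_bound[OF op(1,2) p(1) uG sa fF L0 \<delta> K \<phi> nb E(1)]
      have "(LINT x|?M. trunc' \<delta> (u k x - f x) * norm (G x) powr p k) / K powr p k
          \<le> m * (L powr p k + p k * (M / \<delta>)) / K powr p k"
        by (rule divide_right_mono[OF E(2) powr_ge_zero])
      also have "\<dots> = m * (L powr p k / K powr p k + M / \<delta> * p k * (1 / K powr p k))"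
        by (simp add: distrib_left add_divide_distrib mult_ac)
      also have "\<dots> \<le> m * (1 / 2 powr p k + M / \<delta> * p k * (1 / 2 powr p k))"
        using half_powr_le[OF L0 p(1)[of k]] m lam(3) \<delta> p(1)[of k] unfolding K_def
        by (intro mult_left_mono add_mono) auto
      finally have "(LINT x|?M. trunc' \<delta> (u k x - f x) * norm (G x) powr p k) / K powr p k
          \<le> m * (1 / 2 powr p k + M / \<delta> * (p k / 2 powr p k))" by simp
      then have "A * K * ((LINT x|?M. trunc' \<delta> (u k x - f x) * norm (G x) powr p k) / K powr p k)
          \<le> A * K * (m * (1 / 2 powr p k + M / \<delta> * (p k / 2 powr p k)))"
        using A0 K by (intro mult_left_mono) auto
      then show ?thesis using T by linarith
    qed
    have weakW: "\<bar>LINT x:\<Omega>|lebesgue. trunc \<delta> (u_inf x - f x) * (gradient \<phi> x \<bullet> b)\<bar> \<le> (K + L) * (LINT x:\<Omega>|lebesgue. \<bar>\<phi> x\<bar>)"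
      if \<phi>: "\<phi> \<in> C1_0 \<Omega>" and b: "b \<in> Basis" for \<phi> b
    proof -
      obtain S where S: "compact S" "S \<subseteq> \<Omega>" "\<And>x. x \<notin> S \<Longrightarrow> \<phi> x = 0" using C1_0_D(2)[OF \<phi>] by blast
      note C\<phi> = C1_0_D(1)[OF \<phi>]
      obtain A where A: "\<And>x. \<bar>\<phi> x\<bar> \<le> A" "\<And>x. norm (gradient \<phi> x) \<le> A"
        using C1_compact_support_bounds[OF C\<phi> S(1,3)] by metis
      have A0: "A \<ge> 0" using A(1)[of undefined] by linarith
      have cg: "continuous_on \<Omega> (\<lambda>x. gradient \<phi> x \<bullet> b)"
        by (intro continuous_intros continuous_on_subset[OF C1_gradD(2)[OF C\<phi>] subset_UNIV])
      have "(\<lambda>k. LINT x|?M. trunc \<delta> (u k x - f x) * (gradient \<phi> x \<bullet> b)) \<longlonglongrightarrow> (LINT x|?M. trunc \<delta> (u_inf x - f x) * (gradient \<phi> x \<bullet> b))"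
      proof (rule integral_dominated_convergence[where w="\<lambda>x. 1 / \<delta> * A"])
        show "(\<lambda>x. trunc \<delta> (u_inf x - f x) * (gradient \<phi> x \<bullet> b)) \<in> borel_measurable ?M"
          by (intro borel_measurable_times continuous_on_open_measurable[OF op(1)] cT uc cg)
        show "(\<lambda>x. trunc \<delta> (u k x - f x) * (gradient \<phi> x \<bullet> b)) \<in> borel_measurable ?M" for k
          by (intro borel_measurable_times continuous_on_open_measurable[OF op(1)] cT u(2) cg)
        show "AE x in ?M. (\<lambda>k. trunc \<delta> (u k x - f x) * (gradient \<phi> x \<bullet> b)) \<longlonglongrightarrow> trunc \<delta> (u_inf x - f x) * (gradient \<phi> x \<bullet> b)"
          using AE_space
        proof eventually_elim
          case (elim x)
          then have "(\<lambda>k. u k x) \<longlonglongrightarrow> u_inf x" using tendsto_uniform_limitI[OF lim, of x] by simp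
          then show ?case
            by (intro tendsto_intros continuous_on_tendsto_compose[OF Tc]) auto
        qed
        show "AE x in ?M. norm (trunc \<delta> (u k x - f x) * (gradient \<phi> x \<bullet> b)) \<le> 1 / \<delta> * A" for k
        proof (rule AE_I2)
          fix x
          have "\<bar>gradient \<phi> x \<bullet> b\<bar> \<le> A"
            using Basis_le_norm[OF b, of "gradient \<phi> x"] A(2)[of x] by linarith
          then show "norm (trunc \<delta> (u k x - f x) * (gradient \<phi> x \<bullet> b)) \<le> 1 / \<delta> * A"
            unfolding real_norm_def abs_mult using trunc_props(4)[OF \<delta>] \<delta> by (intro mult_mono) auto
        qed
      qed auto
      then have l1: "(\<lambda>k. \<bar>LINT x|?M. trunc \<delta> (u k x - f x) * (gradient \<phi> x \<bullet> b)\<bar>) \<longlonglongrightarrow> \<bar>LINT x|?M. trunc \<delta> (u_inf x - f x) * (gradient \<phi> x \<bullet> b)\<bar>"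
        by (rule tendsto_rabs)
      \<comment> \<open>These two decay rates remove the volume of \<Omega>, the bound on
        \<open>lam\<close> and the sup norm of \<phi>.\<close>
      have a: "((\<lambda>q::real. 1 / 2 powr q) \<longlongrightarrow> 0) at_top" "((\<lambda>q::real. q / 2 powr q) \<longlongrightarrow> 0) at_top"
        by real_asymp+
      have "(\<lambda>k. (K + L) * (LINT x|?M. \<bar>\<phi> x\<bar>) + A * K * (m * (1 / 2 powr p k + M / \<delta> * (p k / 2 powr p k))))
         \<longlonglongrightarrow> (K + L) * (LINT x|?M. \<bar>\<phi> x\<bar>) + A * K * (m * (0 + M / \<delta> * 0))"
        by (intro tendsto_intros filterlim_compose[OF a(1) p(2)] filterlim_compose[OF a(2) p(2)])
      then have l2: "(\<lambda>k. (K + L) * (LINT x|?M. \<bar>\<phi> x\<bar>) + A * K * (m * (1 / 2 powr p k + M / \<delta> * (p k / 2 powr p k))))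
         \<longlonglongrightarrow> (K + L) * (LINT x|?M. \<bar>\<phi> x\<bar>)" by simp
      show ?thesis unfolding set_integral_lebesgue_on(1)[OF sl]
        by (rule LIMSEQ_le[OF l1 l2]) (use step[OF \<phi> A(1) b] in blast)
    qed
    have "\<bar>trunc \<delta> (u_inf x - f x) - trunc \<delta> (u_inf y - f y)\<bar> \<le> real DIM('a) * (K + L) * norm (x - y)"
      by (rule weak_bound_lipschitz[OF op(1,2) cT[OF uc] trunc_props(4)[OF \<delta>] _ weakW ball]) (use K L0 in auto)
    then show ?thesis using f(3) by blast
  qed
  \<comment> \<open>Only now does \<delta> tend to zero; the terms containing M / \<delta> are
    already gone.\<close>
  define \<delta> where "\<delta> n = inverse (real (Suc n))" for n
  have \<delta>: "\<delta> n > 0" "\<delta> \<longlonglongrightarrow> 0" for n unfolding \<delta>_def using LIMSEQ_inverse_real_of_nat by auto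
  obtain f where f: "\<And>n x. x \<in> closure \<Omega> \<Longrightarrow> \<bar>f n x - h x\<bar> \<le> \<delta> n / 2"
    "\<And>n. \<bar>trunc (\<delta> n) (u_inf x - f n x) - trunc (\<delta> n) (u_inf y - f n y)\<bar> \<le> real DIM('a) * (K + L) * norm (x - y)"
    using main[OF \<delta>(1)] by metis
  have lim: "(\<lambda>n. trunc (\<delta> n) (u_inf z - f n z)) \<longlonglongrightarrow> u_inf z - h z" if "z \<in> \<Omega>" for z
  proof (rule trunc_tendsto[OF \<delta>(1,2)])
    have "(\<lambda>n. f n z - h z) \<longlonglongrightarrow> 0"
    proof (rule Lim_null_comparison)
      show "\<forall>\<^sub>F n in sequentially. norm (f n z - h z) \<le> \<delta> n / 2"
        using f(1)[of z] that closure_subset by (intro always_eventually) auto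
      show "(\<lambda>n. \<delta> n / 2) \<longlonglongrightarrow> 0" using tendsto_divide[OF \<delta>(2) tendsto_const[of 2]] by simp
    qed
    then have "(\<lambda>n. u_inf z - h z - (f n z - h z)) \<longlonglongrightarrow> u_inf z - h z - 0" by (intro tendsto_intros)
    then show "(\<lambda>n. u_inf z - f n z) \<longlonglongrightarrow> u_inf z - h z" by simp
  qed
  have "(\<lambda>n. \<bar>trunc (\<delta> n) (u_inf x - f n x) - trunc (\<delta> n) (u_inf y - f n y)\<bar>) \<longlonglongrightarrow> \<bar>(u_inf x - h x) - (u_inf y - h y)\<bar>"
    by (intro tendsto_intros lim xy)
  then have "\<bar>(u_inf x - h x) - (u_inf y - h y)\<bar> \<le> real DIM('a) * (K + L) * norm (x - y)"
    by (rule LIMSEQ_le_const2) (use f(2) in blast)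
  moreover have "\<bar>h x - h y\<bar> \<le> L * norm (x - y)"
    using lipschitz_onD[OF h(1), of x y] by (simp add: dist_norm)
  moreover have "K + L = 3 * L + 2" unfolding K_def by simp
  ultimately show ?thesis by (simp add: distrib_right)
qed

section \<open>The radial barrier and comparison with it\<close>

section \<open>Nondegeneracy\<close>

text \<open>Away from \<open>y\<close> this is the chain rule for the power q/2 of the squared norm.
  At \<open>y\<close>, where that power may fail to be differentiable, |z|^q = |z|^(q-1) |z| with q
  > 1 gives derivative zero, and the gradient, of norm q |z|^(q-1), tends to zero.\<close>

lemma C1_grad_norm_powr:
  fixes y :: "'a::euclidean_space"
  assumes q: "q > 1"
  shows "C1_grad UNIV (\<lambda>x. norm (x - y) powr q) (\<lambda>x. (q * norm (x - y) powr (q - 2)) *\<^sub>R (x - y))" (is "C1_grad _ ?f ?F")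
proof -
  have nF: "norm (?F x) = q * norm (x - y) powr (q - 1)" for x
    using q by (cases "x = y") (auto simp: abs_mult powr_diff power2_eq_square)
  have d: "(?f has_derivative (\<lambda>v. ?F x \<bullet> v)) (at x)" for x
  proof (cases "x = y")
    case False
    then have pos: "(norm (x - y))\<^sup>2 > 0" by simp
    have "((\<lambda>x. ((norm (x - y))\<^sup>2) powr (q / 2)) has_derivative (\<lambda>v. (2 *\<^sub>R (x - y) \<bullet> v) * (q / 2 * (norm (x - y))\<^sup>2 powr (q / 2 - 1)))) (at x)"
      using has_derivative_compose[OF C1_gradD(1)[OF C1_grad_norm_sq UNIV_I, of y x] has_real_derivative_powr[OF pos, of "q/2", unfolded has_field_derivative_def]]
      by (simp add: mult.commute)
    moreover have "(\<lambda>x. ((norm (x - y))\<^sup>2) powr (q / 2)) = ?f"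
    proof (rule ext)
      fix x
      show "((norm (x - y))\<^sup>2) powr (q / 2) = ?f x"
      proof (cases "x = y")
        case False
        then have "(norm (x - y))\<^sup>2 = norm (x - y) powr 2" by simp
        then have "((norm (x - y))\<^sup>2) powr (q / 2) = norm (x - y) powr (2 * (q / 2))" by (simp only: powr_powr)
        then show ?thesis by simp
      qed simp
    qed
    moreover have "(norm (x - y))\<^sup>2 powr (q / 2 - 1) = norm (x - y) powr (q - 2)"
    proof -
      have "(norm (x - y))\<^sup>2 = norm (x - y) powr 2" using False by simp
      then have "(norm (x - y))\<^sup>2 powr (q / 2 - 1) = norm (x - y) powr (2 * (q / 2 - 1))" by (simp only: powr_powr)
      moreover have "2 * (q / 2 - 1) = q - 2" by simp
      ultimately show ?thesis by (simp only:)
    qed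
    moreover have "(2 *\<^sub>R (x - y) \<bullet> v) * (q / 2 * s) = (q * s) *\<^sub>R (x - y) \<bullet> v" for v s
      by simp
    ultimately show ?thesis by (simp only:)
  next
    case True
    show ?thesis
      unfolding has_derivative_at_alt
    proof (intro conjI allI impI)
      fix e :: real assume "e > 0"
      show "\<exists>d>0. \<forall>z. norm (z - x) < d \<longrightarrow> norm (?f z - ?f x - ?F x \<bullet> (z - x)) \<le> e * norm (z - x)"
      \<comment> \<open>The radius at which |z|^(q-1) reaches \<open>e\<close>.\<close>
      proof (intro exI[of _ "e powr (1 / (q - 1))"] conjI allI impI)
        fix z assume "norm (z - x) < e powr (1 / (q - 1))"
        then have "norm (z - x) powr (q - 1) \<le> (e powr (1 / (q - 1))) powr (q - 1)"
          using q by (intro powr_mono2) auto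
        then have "norm (z - x) powr (q - 1) \<le> e" using q \<open>e > 0\<close> by (simp add: powr_powr)
        then have "norm (z - x) powr (q - 1) * norm (z - x) \<le> e * norm (z - x)" by (intro mult_right_mono) auto
        moreover have "norm (z - x) powr (q - 1) * norm (z - x) = norm (z - x) powr q"
          by (cases "z = x") (auto simp: powr_diff)
        ultimately show "norm (?f z - ?f x - ?F x \<bullet> (z - x)) \<le> e * norm (z - x)" using True by simp
      qed (use \<open>e > 0\<close> in simp)
    qed (rule bounded_linear_inner_right)
  qed
  have "isCont ?F x" for x
  proof (cases "x = y")
    case False
    then show ?thesis by (intro continuous_intros) auto
  next
    case True
    have "(?F \<longlongrightarrow> 0) (at x)"
    proof (rule Lim_null_comparison)
      show "\<forall>\<^sub>F z in at x. norm (?F z) \<le> q * norm (z - y) powr (q - 1)"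
        unfolding nF by simp
      have n0: "((\<lambda>z. norm (z - y)) \<longlongrightarrow> 0) (at x)"
        using True by (auto intro!: tendsto_eq_intros)
      have "((\<lambda>z. norm (z - y) powr (q - 1)) \<longlongrightarrow> 0) (at x)"
        by (rule tendsto_zero_powrI[OF n0 tendsto_const]) (use q in auto)
      then show "((\<lambda>z. q * norm (z - y) powr (q - 1)) \<longlongrightarrow> 0) (at x)"
        using tendsto_mult[OF tendsto_const[of q]] by fastforce
    qed
    then show ?thesis using True by (simp add: isCont_def)
  qed
  then show ?thesis unfolding C1_grad_def
    by (intro conjI ballI d continuous_at_imp_continuous_on) simp
qed

text \<open>The exponent p/(p-1) is the one for which the p-flux of a radial power is linear, so its
  divergence is constant. The argument here is the gradient of the barrier, and the two exponent
  identities \<open>e1\<close>, \<open>e2\<close> express this balance.\<close>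

lemma p_flux_barrier:
  assumes p: "p > 1" and a: "a > 0"
  shows "p_flux p ((a powr (1 / (p - 1)) * norm z powr (p / (p - 1) - 2)) *\<^sub>R z) = a *\<^sub>R z"
proof (cases "z = 0")
  case False
  define s where "s = norm z"
  have s: "s > 0" using False by (simp add: s_def)
  have n: "norm ((a powr (1 / (p - 1)) * s powr (p / (p - 1) - 2)) *\<^sub>R z) = a powr (1 / (p - 1)) * s powr (p / (p - 1) - 1)"
    using s by (simp add: abs_mult s_def[symmetric] powr_diff power2_eq_square)
  have e1: "1 / (p - 1) * (p - 2) + 1 / (p - 1) = 1" using p by (simp add: field_simps)
  have e2: "(p / (p - 1) - 1) * (p - 2) + (p / (p - 1) - 2) = 0" using p by (simp add: field_simps)
  have "(a powr (1 / (p - 1)) * s powr (p / (p - 1) - 1)) powr (p - 2) * (a powr (1 / (p - 1)) * s powr (p / (p - 1) - 2))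
      = a powr (1 / (p - 1) * (p - 2) + 1 / (p - 1)) * s powr ((p / (p - 1) - 1) * (p - 2) + (p / (p - 1) - 2))"
    unfolding powr_mult powr_powr powr_add by simp
  also have "\<dots> = a" unfolding e1 e2 using a s by simp
  finally show ?thesis unfolding p_flux_def s_def[symmetric] n by simp
qed (simp add: p_flux_def)

text \<open>Cauchy-Schwarz on the mixed terms reduces the claim to monotonicity of s^(p-1) on the
  nonnegative reals.\<close>

lemma p_flux_monotone:
  assumes "p > 1" shows "0 \<le> (p_flux p a - p_flux p b) \<bullet> (a - b)"
proof -
  have e: "norm z powr p = norm z powr (p - 1) * norm z" for z :: 'a
    by (cases "z = 0") (auto simp: powr_diff)
  have "p_flux p a \<bullet> b \<le> norm a powr (p - 1) * norm b" "p_flux p b \<bullet> a \<le> norm b powr (p - 1) * norm a"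
    using norm_cauchy_schwarz[of "p_flux p a" b] norm_cauchy_schwarz[of "p_flux p b" a] by (simp_all add: norm_p_flux)
  then have "(p_flux p a - p_flux p b) \<bullet> (a - b) \<ge> (norm a powr (p - 1) - norm b powr (p - 1)) * (norm a - norm b)"
    using e[of a] e[of b] by (simp add: inner_diff_left inner_diff_right p_flux_inner_self algebra_simps)
  moreover have "(norm a powr (p - 1) - norm b powr (p - 1)) * (norm a - norm b) \<ge> 0"
  proof (cases "norm a \<le> norm b")
    case True
    then have "norm a powr (p - 1) \<le> norm b powr (p - 1)" using assms by (intro powr_mono2) auto
    then show ?thesis using True by (intro mult_nonpos_nonpos) auto
  next
    case False
    then have "norm b powr (p - 1) \<le> norm a powr (p - 1)" using assms by (intro powr_mono2) auto
    then show ?thesis using False by (intro mult_nonneg_nonneg) auto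
  qed
  ultimately show ?thesis by linarith
qed

text \<open>A C^1 substitute for the positive part in the comparison argument: bounded,
  nondecreasing, and positive exactly for t > 0.\<close>

definition saturate :: "real \<Rightarrow> real" where
  "saturate t = (max 0 t)\<^sup>2 / (1 + (max 0 t)\<^sup>2)"

definition saturate' :: "real \<Rightarrow> real" where
  "saturate' t = 2 * max 0 t / (1 + (max 0 t)\<^sup>2)\<^sup>2"

lemma saturate_props:
  "(saturate has_real_derivative saturate' t) (at t)" "continuous_on UNIV saturate'"
  "0 \<le> saturate t" "saturate t \<le> 1" "0 \<le> saturate' t" "saturate' t \<le> 2" "t \<le> 0 \<Longrightarrow> saturate t = 0" "t > 0 \<Longrightarrow> saturate t > 0"
proof -
  have nz: "1 + (max 0 t)\<^sup>2 > 0" for t :: real by (simp add: add_pos_nonneg)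
  have D: "((\<lambda>t::real. 1 + (max 0 t)\<^sup>2) has_real_derivative (0 + 2 * max 0 t)) (at t)"
    by (intro DERIV_add DERIV_const DERIV_pos_part_square)
  show "(saturate has_real_derivative saturate' t) (at t)"
    unfolding saturate_def[abs_def] saturate'_def
    by (rule DERIV_cong[OF DERIV_divide[OF DERIV_pos_part_square D]])
       (use nz[of t] in \<open>auto simp: power2_eq_square field_simps\<close>)
  have "(1 + (max 0 t)\<^sup>2)\<^sup>2 \<noteq> 0" for t :: real using nz[of t] by simp
  then show "continuous_on UNIV saturate'"
    unfolding saturate'_def[abs_def] by (intro continuous_intros) auto
  show "0 \<le> saturate t" unfolding saturate_def by simp
  show "saturate t \<le> 1" unfolding saturate_def using nz[of t] by simp
  show "0 \<le> saturate' t" unfolding saturate'_def by simp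
  have "max 0 t \<le> (1 + (max 0 t)\<^sup>2)\<^sup>2"
  proof -
    have "max 0 t \<le> 1 + (max 0 t)\<^sup>2" using zero_le_power2[of "max 0 t - 1"] by (simp add: power2_eq_square algebra_simps)
    also have "\<dots> \<le> (1 + (max 0 t)\<^sup>2)\<^sup>2" by (rule self_le_power) auto
    finally show ?thesis .
  qed
  moreover have "(1 + (max 0 t)\<^sup>2)\<^sup>2 > 0" using nz[of t] by simp
  ultimately show "saturate' t \<le> 2" unfolding saturate'_def by (simp add: divide_le_eq)
  show "t \<le> 0 \<Longrightarrow> saturate t = 0" unfolding saturate_def by simp
  show "t > 0 \<Longrightarrow> saturate t > 0" unfolding saturate_def by (simp add: add_pos_nonneg)
qed

text \<open>In t = |x - y|^2 the cut-off is N / (N + P), where N and P are the squared positive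
  parts of b - t and t - a. As a < b they never vanish together, and where one of them is zero the
  quotient is constant.\<close>

lemma radial_cutoff:
  fixes y :: "'a::euclidean_space"
  assumes "0 \<le> r1" "r1 < r2"
  obtains \<eta> E where "C1_grad UNIV \<eta> E" "\<And>x. 0 \<le> \<eta> x" "\<And>x. norm (x - y) \<le> r1 \<Longrightarrow> \<eta> x = 1 \<and> E x = 0"
    "\<And>x. norm (x - y) \<ge> r2 \<Longrightarrow> \<eta> x = 0 \<and> E x = 0"
proof -
  define a where "a = r1\<^sup>2"
  define b where "b = r2\<^sup>2"
  have ab: "a < b" unfolding a_def b_def using assms by (intro power_strict_mono) auto
  define N where "N t = (max 0 (b - t))\<^sup>2" for t :: real
  define N' where "N' t = - (2 * max 0 (b - t))" for t :: real
  define D where "D t = N t + (max 0 (t - a))\<^sup>2" for t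
  define D' where "D' t = N' t + 2 * max 0 (t - a)" for t
  define \<kappa> where "\<kappa> t = N t / D t" for t
  define \<kappa>' where "\<kappa>' t = (N' t * D t - N t * D' t) / (D t * D t)" for t
  have Dp: "D t > 0" for t
    unfolding D_def N_def using ab by (cases "t < b") (auto intro: add_pos_nonneg add_nonneg_pos)
  have dN: "(N has_real_derivative N' t) (at t)" for t
  proof -
    have "((\<lambda>t. (max 0 (b - t))\<^sup>2) has_real_derivative (2 * max 0 (b - t)) * (0 - 1)) (at t)"
      by (rule DERIV_chain2[where f="\<lambda>s. (max 0 s)\<^sup>2" and g="\<lambda>t. b - t", OF DERIV_pos_part_square])
         (intro DERIV_diff DERIV_const DERIV_ident)
    then show ?thesis unfolding N_def[abs_def] N'_def by simp
  qed
  have dD: "(D has_real_derivative D' t) (at t)" for t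
  proof -
    have "((\<lambda>t. (max 0 (t - a))\<^sup>2) has_real_derivative (2 * max 0 (t - a)) * (1 - 0)) (at t)"
      by (rule DERIV_chain2[where f="\<lambda>s. (max 0 s)\<^sup>2" and g="\<lambda>t. t - a", OF DERIV_pos_part_square])
         (intro DERIV_diff DERIV_const DERIV_ident)
    from DERIV_add[OF dN this] show ?thesis unfolding D_def[abs_def] D'_def by simp
  qed
  have d\<kappa>: "(\<kappa> has_real_derivative \<kappa>' t) (at t)" for t
    unfolding \<kappa>_def[abs_def] \<kappa>'_def by (rule DERIV_divide[OF dN dD]) (use Dp[of t] in simp)
  have c\<kappa>: "continuous_on UNIV \<kappa>'"
  proof -
    have "D t * D t \<noteq> 0" for t using Dp[of t] by simp
    moreover have "continuous_on UNIV N" "continuous_on UNIV N'" "continuous_on UNIV D" "continuous_on UNIV D'"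
      unfolding N_def[abs_def] N'_def[abs_def] D_def[abs_def] D'_def[abs_def] by (intro continuous_intros)+
    ultimately show ?thesis unfolding \<kappa>'_def[abs_def] by (intro continuous_intros) auto
  qed
  show ?thesis
  proof (rule that)
    show "C1_grad UNIV (\<lambda>x. \<kappa> ((norm (x - y))\<^sup>2)) (\<lambda>x. \<kappa>' ((norm (x - y))\<^sup>2) *\<^sub>R (2 *\<^sub>R (x - y)))"
      by (rule C1_grad_compose[OF C1_grad_norm_sq d\<kappa> c\<kappa>])
    show "0 \<le> \<kappa> ((norm (x - y))\<^sup>2)" for x
      unfolding \<kappa>_def using Dp less_imp_le by (intro divide_nonneg_nonneg) (auto simp: N_def)
    show "\<kappa> ((norm (x - y))\<^sup>2) = 1 \<and> \<kappa>' ((norm (x - y))\<^sup>2) *\<^sub>R (2 *\<^sub>R (x - y)) = 0" if "norm (x - y) \<le> r1" for x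
    proof -
      have "(norm (x - y))\<^sup>2 \<le> a" unfolding a_def using that by (intro power_mono) auto
      then have "D ((norm (x - y))\<^sup>2) = N ((norm (x - y))\<^sup>2)" "D' ((norm (x - y))\<^sup>2) = N' ((norm (x - y))\<^sup>2)"
        unfolding D_def D'_def by auto
      then show ?thesis unfolding \<kappa>_def \<kappa>'_def using Dp[of "(norm (x - y))\<^sup>2"] by simp
    qed
    show "\<kappa> ((norm (x - y))\<^sup>2) = 0 \<and> \<kappa>' ((norm (x - y))\<^sup>2) *\<^sub>R (2 *\<^sub>R (x - y)) = 0" if "norm (x - y) \<ge> r2" for x
    proof -
      have "(norm (x - y))\<^sup>2 \<ge> b" unfolding b_def using that assms by (intro power_mono) auto
      then have "N ((norm (x - y))\<^sup>2) = 0" "N' ((norm (x - y))\<^sup>2) = 0" unfolding N_def N'_def by auto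
      then show ?thesis unfolding \<kappa>_def \<kappa>'_def by simp
    qed
  qed
qed

text \<open>The solution and the barrier are tested with the same function of \<open>u - f\<close>.
  Monotonicity of the p-flux makes the difference of the flux terms nonnegative, so the right-hand
  side of \<open>u\<close>, at least m where u > f, cannot exceed \<mu> on average there; as \<mu> <
  m, the set where u > f near \<open>y\<close> is null.\<close>

lemma barrier_comparison:
  fixes u :: "'a::euclidean_space \<Rightarrow> real"
  assumes op: "open \<Omega>" "bounded \<Omega>" and p: "p > 1" and uG: "W1p_grad p \<Omega> u G" and sa: "strong_approx p \<Omega> u G v V"
    and uc: "continuous_on \<Omega> u"
    and weak: "\<And>\<phi>. \<phi> \<in> C1_0 \<Omega> \<Longrightarrow> (LINT x:\<Omega>|lebesgue. p_flux p (G x) \<bullet> gradient \<phi> x) =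
           - (LINT x:\<Omega>|lebesgue. lam x * indicator {y. u y > 0} x * \<phi> x)"
    and lam: "lam \<in> borel_measurable (lebesgue_on \<Omega>)" "\<And>x. x \<in> \<Omega> \<Longrightarrow> m \<le> lam x" "\<And>x. x \<in> \<Omega> \<Longrightarrow> lam x \<le> M"
    and \<mu>: "0 < \<mu>" "\<mu> < m"
    and ball: "cball y r \<subseteq> \<Omega>" "r > 0"
    and sphere: "\<And>x. norm (x - y) = r \<Longrightarrow>
        u x \<le> (\<mu> / DIM('a)) powr (1 / (p - 1)) * ((p - 1) / p) * r powr (p / (p - 1))"
  shows "u y \<le> 0"
proof (rule ccontr)
  assume "\<not> u y \<le> 0"
  \<comment> \<open>Raising the barrier by \<open>d\<close> makes it positive everywhere and
    strictly larger than \<open>u\<close> on the sphere, yet its value at \<open>y\<close> is only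
    \<open>d < u y\<close>.\<close>
  define d where "d = u y / 2"
  have d: "d > 0" "u y > d" unfolding d_def using \<open>\<not> u y \<le> 0\<close> by auto
  let ?M = "lebesgue_on \<Omega>"
  have sl: "\<Omega> \<in> sets lebesgue" using op(1) by auto
  interpret finite_measure ?M by (rule finite_measure_lebesgue_on_bounded[OF sl op(2)])
  have Lp: "Lp_on p \<Omega> u" "Lp_on p \<Omega> G" using uG unfolding W1p_grad_def by auto
  have um[measurable]: "u \<in> borel_measurable ?M" and Gm[measurable]: "G \<in> borel_measurable ?M"
    using Lp_onD(1)[OF sl] Lp by auto
  note [measurable] = lam(1)
  define q where "q = p / (p - 1)"
  have q: "q > 1" unfolding q_def using p by simp
  define a where "a = \<mu> / DIM('a)"
  have a: "a > 0" unfolding a_def using \<mu>(1) by simp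
  \<comment> \<open>Normalised so that \<open>c * q\<close> is the prefactor of \<open>F\<close> for
    which the flux is \<open>a *\<^sub>R (x - y)\<close>, of divergence
    \<open>a * DIM('a) = \<mu>\<close>.\<close>
  define c where "c = a powr (1 / (p - 1)) * ((p - 1) / p)"
  have c: "c > 0" unfolding c_def using a p by simp
  have cq: "c * q = a powr (1 / (p - 1))" unfolding c_def q_def using p by simp
  define f where "f x = c * norm (x - y) powr q + d" for x
  define F where "F x = (a powr (1 / (p - 1)) * norm (x - y) powr (p / (p - 1) - 2)) *\<^sub>R (x - y)" for x
  have fF: "C1_grad UNIV f F"
  proof -
    have "C1_grad UNIV (\<lambda>x. c * norm (x - y) powr q + d) (\<lambda>x. (c *\<^sub>R ((q * norm (x - y) powr (q - 2)) *\<^sub>R (x - y)) + norm (x - y) powr q *\<^sub>R 0) + 0)"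
      by (intro C1_grad_add C1_grad_mult C1_grad_const C1_grad_norm_powr q)
    then show ?thesis unfolding f_def[abs_def] F_def[abs_def] by (simp add: cq[symmetric] q_def[symmetric] mult_ac)
  qed
  have flux: "p_flux p (F x) = a *\<^sub>R (x - y)" for x
    unfolding F_def by (rule p_flux_barrier[OF p a])
  have yO: "y \<in> \<Omega>" using ball by auto
  \<comment> \<open>The contact set. Strictness on the sphere confines it to a smaller ball of
    radius \<open>r1\<close>, so the cut-off can be constant on it.\<close>
  define S where "S = {x \<in> cball y r. f x \<le> u x}"
  have "closed S"
    unfolding S_def
    by (rule continuous_on_closed_Collect_le[OF continuous_on_subset[OF C1_grad_continuous[OF fF]] continuous_on_subset[OF uc ball(1)]]) auto
  then have S: "compact S"
    using bounded_subset[OF bounded_cball, of S y r] unfolding compact_eq_bounded_closed S_def by blast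
  have yS: "y \<in> S" unfolding S_def f_def using d(2) ball(2) by simp
  have "continuous_on S (\<lambda>x. norm (x - y))" by (intro continuous_intros)
  then obtain x1 where x1: "x1 \<in> S" "\<And>x. x \<in> S \<Longrightarrow> norm (x - y) \<le> norm (x1 - y)"
    using continuous_attains_sup[OF S] yS by blast
  define r1 where "r1 = norm (x1 - y)"
  have r1: "0 \<le> r1" "r1 < r"
  proof -
    show "0 \<le> r1" unfolding r1_def by simp
    have "r1 \<le> r" using x1(1) unfolding S_def r1_def by (simp add: dist_norm norm_minus_commute)
    moreover have "r1 \<noteq> r"
    proof
      assume "r1 = r"
      then have n: "norm (x1 - y) = r" unfolding r1_def .
      have "f x1 \<le> u x1" using x1(1) unfolding S_def by simp
      moreover have "u x1 \<le> c * r powr q" using sphere[OF n] unfolding c_def a_def q_def .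
      ultimately show False using d(1) n unfolding f_def by simp
    qed
    ultimately show "r1 < r" by simp
  qed
  define r2 where "r2 = (r1 + r) / 2"
  have r2: "r1 < r2" "r2 < r" unfolding r2_def using r1 by auto
  obtain \<eta> E where \<eta>: "C1_grad UNIV \<eta> E" "\<And>x. 0 \<le> \<eta> x" "\<And>x. norm (x - y) \<le> r1 \<Longrightarrow> \<eta> x = 1 \<and> E x = 0"
    "\<And>x. norm (x - y) \<ge> r2 \<Longrightarrow> \<eta> x = 0 \<and> E x = 0"
    using radial_cutoff[OF r1(1) r2(1)] by metis
  have \<eta>0: "\<eta> x = 0" if "x \<notin> cball y r2" for x
    using \<eta>(4)[of x] that by (simp add: dist_norm norm_minus_commute)
  obtain B1 where B1: "\<And>x. \<bar>\<eta> x\<bar> \<le> B1" "\<And>x. norm (E x) \<le> B1"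
    using C1_compact_support_bounds[OF \<eta>(1) compact_cball \<eta>0] by metis
  obtain R where R: "\<And>x. x \<in> closure \<Omega> \<Longrightarrow> norm x \<le> R"
    using bounded_closure[OF op(2)] unfolding bounded_iff by blast
  have "compact (F ` closure \<Omega>)"
    by (rule compact_continuous_image[OF continuous_on_subset[OF C1_gradD(2)[OF fF]]]) (use op(2) in auto)
  then have "bounded (F ` closure \<Omega>)" by (rule compact_imp_bounded)
  then obtain B2 where B2: "\<And>x. x \<in> closure \<Omega> \<Longrightarrow> norm (F x) \<le> B2" unfolding bounded_iff by (meson image_eqI)
  define B where "B = max B1 (max B2 2)"
  have B: "B1 \<le> B" "B2 \<le> B" "2 \<le> B" unfolding B_def by auto
  define \<kappa> where "\<kappa> x = lam x * indicat_real {y. u y > 0} x" for x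
  have \<kappa>m[measurable]: "\<kappa> \<in> borel_measurable ?M"
  proof -
    have "(\<lambda>x. if u x > 0 then lam x else 0) \<in> borel_measurable ?M" by measurable
    also have "(\<lambda>x. if u x > 0 then lam x else 0) = \<kappa>" unfolding \<kappa>_def by auto
    finally show ?thesis .
  qed
  define C where "C = max (max 1 M) (max \<mu> (a * (R + norm y)))"
  have C: "1 \<le> C" "M \<le> C" "\<mu> \<le> C" "a * (R + norm y) \<le> C" unfolding C_def by auto
  have in_cl: "x \<in> closure \<Omega>" if "x \<in> \<Omega>" for x using that closure_subset by blast
  have G1: "C \<le> C * (1 + norm (G x) powr (p - 1))" for x
    using mult_left_mono[of 1 "1 + norm (G x) powr (p - 1)" C] C(1) by simp
  have a1: "(\<lambda>x. p_flux p (G x)) \<in> borel_measurable ?M" by measurable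
  have a1': "(\<lambda>x. a *\<^sub>R (x - y)) \<in> borel_measurable ?M"
    by (rule continuous_on_open_measurable[OF op(1)]) (intro continuous_intros)
  have a2: "norm (p_flux p (G x)) \<le> C * (1 + norm (G x) powr (p - 1))" for x
  proof -
    have "1 * (norm (G x) powr (p - 1)) \<le> C * (1 + norm (G x) powr (p - 1))" using C(1) by (intro mult_mono) auto
    then show ?thesis by (simp add: norm_p_flux)
  qed
  have a2': "norm (a *\<^sub>R (x - y)) \<le> C * (1 + norm (G x) powr (p - 1))" if "x \<in> \<Omega>" for x
  proof -
    have "norm (x - y) \<le> R + norm y" using norm_triangle_ineq4[of x y] R[OF in_cl[OF that]] by linarith
    then have "norm (a *\<^sub>R (x - y)) \<le> a * (R + norm y)" using a by simp
    then show ?thesis using C(4) G1[of x] by linarith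
  qed
  have a3: "\<bar>\<kappa> x\<bar> \<le> C" if "x \<in> \<Omega>" for x
    using lam(2,3)[OF that] \<mu> C(1,2) unfolding \<kappa>_def by (auto simp: indicator_def)
  have a3': "(\<lambda>x. \<mu>) \<in> borel_measurable ?M" "\<bar>\<mu>\<bar> \<le> C" using C(3) \<mu>(1) by auto
  have a4: "(LINT x:\<Omega>|lebesgue. p_flux p (G x) \<bullet> gradient \<phi> x) = - (LINT x:\<Omega>|lebesgue. \<kappa> x * \<phi> x)" if "\<phi> \<in> C1_0 \<Omega>" for \<phi>
    using weak[OF that] unfolding \<kappa>_def .
  have a4': "(LINT x:\<Omega>|lebesgue. (a *\<^sub>R (x - y)) \<bullet> gradient \<phi> x) = - (LINT x:\<Omega>|lebesgue. \<mu> * \<phi> x)" if "\<phi> \<in> C1_0 \<Omega>" for \<phi>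
  proof -
    have "(LINT x:\<Omega>|lebesgue. (a *\<^sub>R (x - y)) \<bullet> gradient \<phi> x) = a * (LINT x:\<Omega>|lebesgue. (x - y) \<bullet> gradient \<phi> x)"
      by simp
    also have "\<dots> = - (a * DIM('a)) * (LINT x:\<Omega>|lebesgue. \<phi> x)"
      unfolding C1_0_integral_zero(2)[OF op(1) that] by simp
    finally show ?thesis unfolding a_def by simp
  qed
  have a5: "norm (F x) \<le> B" if "x \<in> \<Omega>" for x using B2[OF in_cl[OF that]] B by linarith
  have a6: "\<bar>\<eta> x\<bar> \<le> B" "norm (E x) \<le> B" for x using B1[of x] B by linarith+
  have a7: "\<bar>saturate s\<bar> \<le> B" "\<bar>saturate' s\<bar> \<le> B" for s
    using saturate_props(3-6)[of s] B by auto
  have a8: "\<forall>\<^sub>F i in sequentially. \<exists>K. compact K \<and> K \<subseteq> \<Omega> \<and> (\<forall>x\<in>\<Omega> - K. \<eta> x * saturate (v i x - f x) = 0)"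
    using \<eta>0 r2(2) ball(1) by (intro always_eventually allI exI[of _ "cball y r2"]) auto
  note C\<Omega> = C1_grad_subset[OF fF subset_UNIV] C1_grad_subset[OF \<eta>(1) subset_UNIV]
  note w1 = weak_identity[where \<eta>=\<eta> and E=E and T=saturate and T'=saturate' and Y="\<lambda>x. p_flux p (G x)" and \<kappa>=\<kappa> and c=C and B=B,
      OF op p um Lp(2) sa a1 a2 \<kappa>m a3 a4 C\<Omega>(1) a5 C\<Omega>(2) a6 saturate_props(1,2) a7 a8]
  note w2 = weak_identity[where \<eta>=\<eta> and E=E and T=saturate and T'=saturate' and Y="\<lambda>x. a *\<^sub>R (x - y)" and \<kappa>="\<lambda>x. \<mu>" and c=C and B=B,
      OF op p um Lp(2) sa a1' a2' a3' a4' C\<Omega>(1) a5 C\<Omega>(2) a6 saturate_props(1,2) a7 a8]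
  let ?Z = "\<lambda>x. \<eta> x *\<^sub>R (saturate' (u x - f x) *\<^sub>R (G x - F x)) + saturate (u x - f x) *\<^sub>R E x"
  let ?T = "\<lambda>x. \<eta> x * saturate (u x - f x)"
  have TE: "saturate (u x - f x) *\<^sub>R E x = 0" for x
  proof (cases "norm (x - y) \<le> r1 \<or> norm (x - y) \<ge> r2")
    case True
    then show ?thesis using \<eta>(3,4)[of x] by auto
  next
    case False
    then have "x \<in> cball y r" "x \<notin> S"
      using r2(2) x1(2)[of x] unfolding r1_def[symmetric] by (auto simp: dist_norm norm_minus_commute)
    then have "u x - f x \<le> 0" unfolding S_def by simp
    then show ?thesis using saturate_props(7) by simp
  qed
  have "(LINT x|?M. p_flux p (G x) \<bullet> ?Z x - (a *\<^sub>R (x - y)) \<bullet> ?Z x) = - (LINT x|?M. \<kappa> x * ?T x) + (LINT x|?M. \<mu> * ?T x)"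
  proof -
    have "(LINT x|?M. p_flux p (G x) \<bullet> ?Z x - (a *\<^sub>R (x - y)) \<bullet> ?Z x)
        = (LINT x|?M. p_flux p (G x) \<bullet> ?Z x) - (LINT x|?M. (a *\<^sub>R (x - y)) \<bullet> ?Z x)"
      by (rule Bochner_Integration.integral_diff[OF w1(1) w2(1)])
    also have "\<dots> = - (LINT x|?M. \<kappa> x * ?T x) - - (LINT x|?M. \<mu> * ?T x)"
      by (rule arg_cong2[OF w1(3) w2(3), of "(-)"])
    finally show ?thesis by linarith
  qed
  moreover have "(LINT x|?M. p_flux p (G x) \<bullet> ?Z x - (a *\<^sub>R (x - y)) \<bullet> ?Z x) \<ge> 0"
  proof (rule Bochner_Integration.integral_nonneg)
    fix x
    have "p_flux p (G x) \<bullet> ?Z x - (a *\<^sub>R (x - y)) \<bullet> ?Z x = (\<eta> x * saturate' (u x - f x)) * ((p_flux p (G x) - p_flux p (F x)) \<bullet> (G x - F x))"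
      unfolding TE flux by (simp add: inner_diff_left right_diff_distrib)
    then show "0 \<le> p_flux p (G x) \<bullet> ?Z x - (a *\<^sub>R (x - y)) \<bullet> ?Z x"
      using p_flux_monotone[OF p, of "G x" "F x"] \<eta>(2)[of x] saturate_props(5)[of "u x - f x"] by simp
  qed
  ultimately have le: "(LINT x|?M. \<kappa> x * ?T x) \<le> (LINT x|?M. \<mu> * ?T x)" by linarith
  have iT: "integrable ?M ?T"
    using integrable_mult_right[OF w2(2), of "1 / \<mu>"] \<mu>(1) by simp
  have AE_\<Omega>: "AE x in ?M. x \<in> \<Omega>" using AE_space by eventually_elim simp
  have "(LINT x|?M. m * ?T x) \<le> (LINT x|?M. \<kappa> x * ?T x)"
  proof (rule integral_mono_AE[OF integrable_mult_right[OF iT] w1(2)])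
    show "AE x in ?M. m * ?T x \<le> \<kappa> x * ?T x"
      using AE_\<Omega>
    proof eventually_elim
      case (elim x)
      show ?case
      proof (cases "u x - f x > 0")
        case True
        \<comment> \<open>Where \<open>u\<close> exceeds the positive barrier it is itself positive,
          so the indicator in \<kappa> equals one and the lower bound on \<open>lam\<close> is
          available.\<close>
        have "f x > 0" unfolding f_def using c d(1) by (intro add_nonneg_pos) auto
        then have "\<kappa> x = lam x" using True unfolding \<kappa>_def by simp
        then show ?thesis using lam(2)[OF elim] \<eta>(2)[of x] saturate_props(3)[of "u x - f x"]
          by (intro mult_right_mono mult_nonneg_nonneg) auto
      next
        case False
        then show ?thesis using saturate_props(7)[of "u x - f x"] by simp
      qed
    qed
  qed
  then have "m * (LINT x|?M. ?T x) \<le> \<mu> * (LINT x|?M. ?T x)" using le by simp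
  then have "(m - \<mu>) * (LINT x|?M. ?T x) \<le> 0" by (simp add: left_diff_distrib)
  then have "(LINT x|?M. ?T x) \<le> 0" using \<mu>(2) by (simp add: mult_le_0_iff)
  moreover have Tnn: "?T x \<ge> 0" for x using \<eta>(2)[of x] saturate_props(3) by simp
  moreover have "(LINT x|?M. ?T x) \<ge> 0" by (rule Bochner_Integration.integral_nonneg) (rule Tnn)
  ultimately have "(LINT x|?M. ?T x) = 0" by linarith
  then have "AE x in ?M. ?T x = 0"
    using integral_nonneg_eq_0_iff_AE[OF iT] Tnn by simp
  then have ae: "AE x in lebesgue. x \<in> \<Omega> \<longrightarrow> ?T x = 0"
    using sl by (simp add: AE_restrict_space_iff)
  \<comment> \<open>The integrand is continuous, so its vanishing almost everywhere makes this open
    set empty, although it contains \<open>y\<close>.\<close>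
  define U where "U = {x \<in> \<Omega>. 0 < \<eta> x * saturate (u x - f x)}"
  have satc: "continuous_on UNIV saturate"
    using saturate_props(1) DERIV_continuous by (blast intro: continuous_at_imp_continuous_on)
  have "continuous_on \<Omega> ?T"
    by (intro continuous_on_mult C1_grad_continuous[OF C\<Omega>(2)] continuous_on_compose2[OF satc] continuous_on_diff uc C1_grad_continuous[OF C\<Omega>(1)]) auto
  then have "open (?T -` {0<..} \<inter> \<Omega>)"
    using continuous_on_open_vimage[OF op(1)] open_greaterThan by blast
  moreover have "?T -` {0<..} \<inter> \<Omega> = U" unfolding U_def by auto
  ultimately have "open U" by simp
  moreover have "AE x in lebesgue. x \<notin> U"
    using ae by eventually_elim (auto simp: U_def)
  ultimately have "U = {}" by (rule AE_open_False)
  moreover have "y \<in> U"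
  proof -
    have "u y - f y > 0" unfolding f_def using d(2) q by simp
    then have "saturate (u y - f y) > 0" by (rule saturate_props(8))
    moreover have "\<eta> y = 1" using \<eta>(3)[of y] r1(1) by simp
    ultimately show ?thesis unfolding U_def using yO by simp
  qed
  ultimately show False by simp
qed

text \<open>If \<open>u_inf\<close> stayed below r/2 on the ball, so would \<open>u k\<close> for
  large \<open>k\<close>. The boundary value of the barrier tends to r, because the constant
  depending on \<open>lam\<close> and the dimension is raised to a power tending to zero. Comparison
  then gives \<open>u k y \<le> 0\<close>, against convergence to a positive value.\<close>

lemma limit_nondegeneracy:
  fixes u :: "nat \<Rightarrow> 'a::euclidean_space \<Rightarrow> real"
  assumes op: "open \<Omega>" "bounded \<Omega>" "\<Omega> \<noteq> {}"
    and lam: "lam \<in> borel_measurable (lebesgue_on \<Omega>)" "\<And>x. x \<in> \<Omega> \<Longrightarrow> m \<le> lam x" "\<And>x. x \<in> \<Omega> \<Longrightarrow> lam x \<le> M" "m > 0"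
    and p: "\<And>k. 1 < p k" "filterlim p at_top sequentially"
    and u: "\<And>k. weak_solution (p k) \<Omega> lam g (u k)" "\<And>k. continuous_on \<Omega> (u k)"
    and lim: "uniform_limit \<Omega> u u_inf sequentially"
    and ball: "cball y r \<subseteq> \<Omega>" "r > 0" and pos: "u_inf y > 0"
  shows "\<exists>x\<in>cball y r. u_inf x \<ge> r / 2"
proof (rule ccontr)
  assume neg: "\<not> (\<exists>x\<in>cball y r. u_inf x \<ge> r / 2)"
  have uc: "continuous_on \<Omega> u_inf"
    by (rule uniform_limit_theorem[OF _ lim]) (use u(2) in auto)
  obtain x0 where x0: "x0 \<in> cball y r" "\<And>x. x \<in> cball y r \<Longrightarrow> u_inf x \<le> u_inf x0"
    using continuous_attains_sup[OF compact_cball _ continuous_on_subset[OF uc ball(1)]] ball(2) by auto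
  \<comment> \<open>The gap left by the maximum on the compact ball; uniform closeness within
    \<open>e\<close> keeps \<open>u k\<close> below r/2.\<close>
  define e where "e = r / 2 - u_inf x0"
  have "\<not> u_inf x0 \<ge> r / 2" using neg x0(1) by blast
  then have e: "e > 0" unfolding e_def by simp
  have yO: "y \<in> \<Omega>" using ball by auto
  have ev1: "\<forall>\<^sub>F k in sequentially. \<forall>x\<in>\<Omega>. dist (u k x) (u_inf x) < e"
    using lim e unfolding uniform_limit_iff by blast
  have ev2: "\<forall>\<^sub>F k in sequentially. u k y > 0"
    by (rule order_tendstoD(1)[OF tendsto_uniform_limitI[OF lim yO] pos])
  define \<mu> where "\<mu> = m / 2"
  have \<mu>: "0 < \<mu>" "\<mu> < m" unfolding \<mu>_def using lam(4) by auto
  define a where "a = \<mu> / DIM('a)"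
  have a: "a > 0" unfolding a_def using \<mu>(1) by simp
  have t: "((\<lambda>q::real. 1 / (q - 1)) \<longlongrightarrow> 0) at_top" "((\<lambda>q::real. (q - 1) / q) \<longlongrightarrow> 1) at_top" "((\<lambda>q::real. q / (q - 1)) \<longlongrightarrow> 1) at_top"
    by real_asymp+
  note t' = t[THEN filterlim_compose, OF p(2)]
  \<comment> \<open>The limit r exceeds r/2, hence so do these boundary values eventually.\<close>
  have "(\<lambda>k. a powr (1 / (p k - 1)) * ((p k - 1) / p k) * r powr (p k / (p k - 1))) \<longlonglongrightarrow> a powr 0 * 1 * r powr 1"
    by (intro tendsto_mult tendsto_powr tendsto_const t') (use a ball(2) in auto)
  then have "(\<lambda>k. a powr (1 / (p k - 1)) * ((p k - 1) / p k) * r powr (p k / (p k - 1))) \<longlonglongrightarrow> r"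
    using a ball(2) by simp
  then have ev3: "\<forall>\<^sub>F k in sequentially. r / 2 < a powr (1 / (p k - 1)) * ((p k - 1) / p k) * r powr (p k / (p k - 1))"
    by (rule order_tendstoD) (use ball(2) in simp)
  obtain k where k: "\<forall>x\<in>\<Omega>. dist (u k x) (u_inf x) < e" "u k y > 0"
    "r / 2 < a powr (1 / (p k - 1)) * ((p k - 1) / p k) * r powr (p k / (p k - 1))"
    using eventually_happens'[OF sequentially_bot eventually_conj[OF ev1 eventually_conj[OF ev2 ev3]]] by blast
  obtain G where uG: "W1p_grad (p k) \<Omega> (u k) G"
    and weak: "\<And>\<phi>. \<phi> \<in> C1_0 \<Omega> \<Longrightarrow> (LINT x:\<Omega>|lebesgue. p_flux (p k) (G x) \<bullet> gradient \<phi> x) =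
       - (LINT x:\<Omega>|lebesgue. lam x * indicator {y. u k y > 0} x * \<phi> x)"
    and bv: "has_boundary_value (p k) \<Omega> (u k) g"
    using u(1)[of k] unfolding weak_solution_def p_flux_def by blast
  have "\<exists>v V. strong_approx (p k) \<Omega> (u k) G v V"
  proof (rule weak_solution_approximation[OF op p(1) uG bv])
    fix v :: "nat \<Rightarrow> 'a \<Rightarrow> real" and V h
    assume "\<And>i. C1_grad UNIV (v i) (V i)" "AE x in lebesgue_on \<Omega>. (\<lambda>i. v i x) \<longlonglongrightarrow> u k x"
      "\<And>i. integrable (lebesgue_on \<Omega>) (\<lambda>x. (1 + norm (G x) powr (p k - 1)) * norm (V i x - G x))"
      "(\<lambda>i. LINT x|lebesgue_on \<Omega>. (1 + norm (G x) powr (p k - 1)) * norm (V i x - G x)) \<longlonglongrightarrow> 0"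
    then show "\<exists>v V. strong_approx (p k) \<Omega> (u k) G v V" unfolding strong_approx_def by blast
  qed
  then obtain v V where sa: "strong_approx (p k) \<Omega> (u k) G v V" by blast
  have "u k y \<le> 0"
  proof (rule barrier_comparison[OF op(1,2) p(1) uG sa u(2) weak lam(1-3) \<mu> ball])
    fix x assume "norm (x - y) = r"
    then have x: "x \<in> cball y r" by (simp add: dist_norm norm_minus_commute)
    then have "dist (u k x) (u_inf x) < e" using k(1) ball(1) by blast
    then have "u k x < u_inf x + e" by (auto simp: dist_real_def)
    also have "\<dots> \<le> r / 2" using x0(2)[OF x] unfolding e_def by simp
    finally show "u k x \<le> (\<mu> / DIM('a)) powr (1 / (p k - 1)) * ((p k - 1) / p k) * r powr (p k / (p k - 1))"
      using k(3) unfolding a_def by linarith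
  qed
  then show False using k(2) by simp
qed

section \<open>Counting the subcubes that meet a porous set\<close>

section \<open>Hausdorff measure of porous sets\<close>

definition cube :: "'a::euclidean_space \<Rightarrow> real \<Rightarrow> 'a set" where
  "cube a t = cbox a (a + t *\<^sub>R One)"

lemma mem_cube: "x \<in> cube a t \<longleftrightarrow> (\<forall>b\<in>Basis. a \<bullet> b \<le> x \<bullet> b \<and> x \<bullet> b \<le> a \<bullet> b + t)"
  unfolding cube_def mem_box by (simp add: inner_add_left)

lemma cube_norm_le:
  fixes x :: "'a::euclidean_space" and t :: real
  assumes "x \<in> cube a t" "y \<in> cube a t" shows "norm (x - y) \<le> DIM('a) * t"
proof -
  have "norm (x - y) \<le> (\<Sum>b\<in>Basis. \<bar>(x - y) \<bullet> b\<bar>)" by (rule norm_le_l1)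
  also have "\<dots> \<le> (\<Sum>b\<in>(Basis::'a set). t)"
  proof (rule sum_mono)
    fix b :: 'a assume "b \<in> Basis"
    then show "\<bar>(x - y) \<bullet> b\<bar> \<le> t" using assms unfolding mem_cube inner_diff_left by (fastforce simp: abs_le_iff)
  qed
  finally show ?thesis by simp
qed

lemma cube_subdivision:
  fixes a :: "'a::euclidean_space"
  assumes t: "t > 0" and M: "(M::nat) > 0" and x: "x \<in> cube a t"
  shows "\<exists>i\<in>Basis \<rightarrow>\<^sub>E {..<M}. x \<in> cube (a + (t / M) *\<^sub>R (\<Sum>b\<in>Basis. real (i b) *\<^sub>R b)) (t / M)"
proof -
  \<comment> \<open>The minimum with M - 1 assigns points of the far face, where the floor equals M,
    to the last subcube.\<close>
  define j where "j b = min (M - 1) (nat \<lfloor>(x - a) \<bullet> b * M / t\<rfloor>)" for b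
  define i where "i = restrict j Basis"
  have i: "i \<in> Basis \<rightarrow>\<^sub>E {..<M}" unfolding i_def j_def using M by auto
  have key: "real (j b) * (t / M) \<le> (x - a) \<bullet> b \<and> (x - a) \<bullet> b \<le> real (j b) * (t / M) + t / M" if b: "b \<in> Basis" for b
  proof -
    define z where "z = (x - a) \<bullet> b * M / t"
    have xa: "0 \<le> (x - a) \<bullet> b" "(x - a) \<bullet> b \<le> t" using x b unfolding mem_cube by (auto simp: inner_diff_left algebra_simps)
    have z: "0 \<le> z" "z \<le> M" unfolding z_def using xa t M by (auto simp: divide_le_eq mult_right_mono mult.commute)
    have jb: "j b = min (M - 1) (nat \<lfloor>z\<rfloor>)" unfolding j_def z_def ..
    have fl: "real (nat \<lfloor>z\<rfloor>) \<le> z" "z < real (nat \<lfloor>z\<rfloor>) + 1" using z(1) by linarith+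
    have "real (j b) \<le> z" using fl(1) unfolding jb by (simp add: min_def)
    moreover have "z \<le> real (j b) + 1"
    proof (cases "nat \<lfloor>z\<rfloor> \<le> M - 1")
      case True
      then show ?thesis using fl(2) unfolding jb by (simp add: min_def)
    next
      case False
      then have "j b = M - 1" unfolding jb by simp
      then show ?thesis using z(2) M by (simp add: of_nat_diff)
    qed
    moreover have "(x - a) \<bullet> b = z * (t / M)" unfolding z_def using t M by simp
    moreover have "0 \<le> t / M" using t by simp
    ultimately show ?thesis
      using mult_right_mono[of "real (j b)" z "t / M"] mult_right_mono[of z "real (j b) + 1" "t / M"]
      by (simp add: distrib_right add_divide_distrib)
  qed
  have "x \<in> cube (a + (t / M) *\<^sub>R (\<Sum>b\<in>Basis. real (i b) *\<^sub>R b)) (t / M)"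
    unfolding mem_cube
  proof
    fix b :: 'a assume b: "b \<in> Basis"
    have "(\<Sum>b'\<in>Basis. real (i b') *\<^sub>R b') \<bullet> b = real (j b)"
      using b by (simp add: i_def)
    then have e: "(a + (t / M) *\<^sub>R (\<Sum>b'\<in>Basis. real (i b') *\<^sub>R b')) \<bullet> b = a \<bullet> b + real (j b) * (t / M)"
      by (simp only: inner_add_left inner_scaleR_left mult.commute)
    show "(a + (t / M) *\<^sub>R (\<Sum>b'\<in>Basis. real (i b') *\<^sub>R b')) \<bullet> b \<le> x \<bullet> b
      \<and> x \<bullet> b \<le> (a + (t / M) *\<^sub>R (\<Sum>b'\<in>Basis. real (i b') *\<^sub>R b')) \<bullet> b + t / M"
      unfolding e using key[OF b] unfolding inner_diff_left by linarith
  qed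
  then show ?thesis using i by blast
qed

definition porous :: "real \<Rightarrow> real \<Rightarrow> 'a::metric_space set \<Rightarrow> bool" where
  "porous \<kappa> r0 E \<longleftrightarrow> (\<forall>x\<in>E. \<forall>r. 0 < r \<and> r \<le> r0 \<longrightarrow> (\<exists>z. dist x z < r \<and> ball z (\<kappa> * r) \<inter> E = {}))"

text \<open>A hole of radius \<kappa> t / 4 is centred in the cube: either at the cube's centre, if
  \<open>E\<close> misses the ball of radius t/4 around it, or supplied by porosity at scale t/4
  from a point of \<open>E\<close> in that ball. The condition on \<open>M\<close> makes the
  diameter of a subcube smaller than this radius, so the subcube containing the hole's centre misses
  \<open>E\<close>.\<close>

lemma porous_cube_cover:
  fixes E :: "'a::euclidean_space set"
  assumes E: "porous \<kappa> r0 E" and \<kappa>: "0 < \<kappa>" "\<kappa> \<le> 1" and t: "0 < t" "t \<le> 4 * r0"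
    and M: "4 * DIM('a) / \<kappa> < real M"
  obtains A where "finite A" "card A \<le> M ^ DIM('a) - 1" "E \<inter> cube a t \<subseteq> (\<Union>c\<in>A. cube c (t / M))"
proof -
  have M0: "M > 0" "real M > 0"
  proof -
    have "0 < 4 * DIM('a) / \<kappa>" using \<kappa> by simp
    then show "real M > 0" using M by linarith
    then show "M > 0" by simp
  qed
  define c where "c = a + (t / 2) *\<^sub>R One"
  have sub: "ball c (t / 2) \<subseteq> cube a t"
  proof
    fix z assume z: "z \<in> ball c (t / 2)"
    show "z \<in> cube a t"
      unfolding mem_cube
    proof
      fix b :: 'a assume b: "b \<in> Basis"
      have "\<bar>(z - c) \<bullet> b\<bar> \<le> norm (z - c)" using b by (rule Basis_le_norm)
      also have "\<dots> < t / 2" using z by (simp add: dist_norm norm_minus_commute)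
      finally have "\<bar>z \<bullet> b - (a \<bullet> b + t / 2)\<bar> < t / 2"
        unfolding c_def using b by (simp add: inner_diff_left inner_add_left)
      then show "a \<bullet> b \<le> z \<bullet> b \<and> z \<bullet> b \<le> a \<bullet> b + t" by linarith
    qed
  qed
  have "\<exists>z\<in>cube a t. ball z (\<kappa> * (t / 4)) \<inter> E = {}"
  proof (cases "ball c (t / 4) \<inter> E = {}")
    case True
    have "\<kappa> * (t / 4) \<le> t / 4" using \<kappa> t by (simp add: mult_left_le_one_le)
    then have "ball c (\<kappa> * (t / 4)) \<subseteq> ball c (t / 4)" by (rule subset_ball)
    then have "ball c (\<kappa> * (t / 4)) \<inter> E = {}" using True by blast
    moreover have "c \<in> cube a t" using sub t(1) by auto
    ultimately show ?thesis by blast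
  next
    case False
    then obtain x where x: "x \<in> E" "dist c x < t / 4" by auto
    obtain z where z: "dist x z < t / 4" "ball z (\<kappa> * (t / 4)) \<inter> E = {}"
      using E x(1) t unfolding porous_def by (metis divide_le_eq_numeral1(1) mult.commute zero_less_divide_iff zero_less_numeral)
    have "dist c z < t / 2" using dist_triangle[of c z x] x(2) z(1) by linarith
    then have "z \<in> cube a t" using sub by auto
    then show ?thesis using z(2) by blast
  qed
  then obtain z where z: "z \<in> cube a t" "ball z (\<kappa> * (t / 4)) \<inter> E = {}" by blast
  define I :: "('a \<Rightarrow> nat) set" where I: "I = Basis \<rightarrow>\<^sub>E {..<M}"
  define cr where "cr i = a + (t / M) *\<^sub>R (\<Sum>b\<in>Basis. real (i b) *\<^sub>R b)" for i :: "'a \<Rightarrow> nat"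
  have finI: "finite I" unfolding I by (intro finite_PiE) auto
  have cardI: "card I = M ^ DIM('a)" unfolding I by (simp add: card_PiE)
  obtain i0 where i0: "i0 \<in> I" "z \<in> cube (cr i0) (t / M)"
    using cube_subdivision[OF t(1) M0(1) z(1)] unfolding I cr_def by blast
  have miss: "cube (cr i0) (t / M) \<inter> E = {}"
  proof -
    have "cube (cr i0) (t / M) \<subseteq> ball z (\<kappa> * (t / 4))"
    proof
      fix x assume "x \<in> cube (cr i0) (t / M)"
      then have "norm (z - x) \<le> DIM('a) * (t / M)" using cube_norm_le[OF i0(2)] by simp
      also have "\<dots> < \<kappa> * (t / 4)"
      proof -
        have "4 * DIM('a) < \<kappa> * M" using M \<kappa>(1) by (simp add: divide_less_eq mult.commute)
        then have "(4 * DIM('a)) * t < (\<kappa> * M) * t" using t(1) by (rule mult_strict_right_mono)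
        then show ?thesis using M0(2) by (simp add: field_simps)
      qed
      finally show "x \<in> ball z (\<kappa> * (t / 4))" by (simp add: dist_norm)
    qed
    then show ?thesis using z(2) by blast
  qed
  show ?thesis
  proof (rule that)
    show "finite (cr ` (I - {i0}))" using finI by simp
    have "card (cr ` (I - {i0})) \<le> card (I - {i0})" using finI by (intro card_image_le) auto
    then show "card (cr ` (I - {i0})) \<le> M ^ DIM('a) - 1" using i0(1) finI cardI by simp
    show "E \<inter> cube a t \<subseteq> (\<Union>c\<in>cr ` (I - {i0}). cube c (t / M))"
    proof
      fix x assume x: "x \<in> E \<inter> cube a t"
      then obtain i where i: "i \<in> I" "x \<in> cube (cr i) (t / M)"
        using cube_subdivision[OF t(1) M0(1), of x a] unfolding I cr_def by blast
      then have "i \<noteq> i0" using miss x by blast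
      then show "x \<in> (\<Union>c\<in>cr ` (I - {i0}). cube c (t / M))" using i by blast
    qed
  qed
qed

lemma porous_multiscale_cover:
  fixes E :: "'a::euclidean_space set"
  assumes E: "porous \<kappa> r0 E" and \<kappa>: "0 < \<kappa>" "\<kappa> \<le> 1" and t: "0 < t" "t \<le> 4 * r0"
    and M: "4 * DIM('a) / \<kappa> < real M" and A: "finite A" "E \<subseteq> (\<Union>c\<in>A. cube c t)"
  shows "\<exists>B. finite B \<and> card B \<le> card A * (M ^ DIM('a) - 1) ^ k \<and> E \<subseteq> (\<Union>c\<in>B. cube c (t / real M ^ k))"
proof (induction k)
  case 0
  then show ?case using A by auto
next
  case (Suc k)
  from Suc.IH obtain B where B: "finite B" "card B \<le> card A * (M ^ DIM('a) - 1) ^ k" "E \<subseteq> (\<Union>c\<in>B. cube c (t / real M ^ k))"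
    by (elim exE conjE)
  have M1: "real M \<ge> 1"
  proof -
    have "0 < 4 * DIM('a) / \<kappa>" using \<kappa> by simp
    then have "real M > 0" using M by linarith
    then show ?thesis by simp
  qed
  have "1 \<le> real M ^ k" using M1 by simp
  moreover from this have "0 < real M ^ k" by linarith
  ultimately have Mk: "1 \<le> real M ^ k" "0 < real M ^ k" .
  have "0 < t / real M ^ k" by (rule divide_pos_pos[OF t(1) Mk(2)])
  moreover have "t / real M ^ k \<le> t / 1"
    by (rule divide_left_mono[OF Mk(1)]) (use t(1) Mk(2) in auto)
  ultimately have tk: "0 < t / real M ^ k" "t / real M ^ k \<le> 4 * r0"
    using t(2) by linarith+
  have "\<exists>A'. finite A' \<and> card A' \<le> M ^ DIM('a) - 1 \<and> E \<inter> cube c (t / real M ^ k) \<subseteq> (\<Union>c'\<in>A'. cube c' (t / real M ^ k / real M))" for c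
    by (rule porous_cube_cover[OF E \<kappa> tk M, of c]) blast
  then obtain F where F: "\<And>c. finite (F c)" "\<And>c. card (F c) \<le> M ^ DIM('a) - 1"
    "\<And>c. E \<inter> cube c (t / real M ^ k) \<subseteq> (\<Union>c'\<in>F c. cube c' (t / real M ^ k / real M))" by metis
  show ?case
  proof (intro exI conjI)
    show "finite (\<Union>c\<in>B. F c)" using B(1) F(1) by blast
    have "card (\<Union>c\<in>B. F c) \<le> (\<Sum>c\<in>B. card (F c))" using B(1) by (rule card_UN_le)
    also have "\<dots> \<le> card B * (M ^ DIM('a) - 1)" using sum_bounded_above[of B "\<lambda>c. card (F c)"] F(2) by simp
    also have "\<dots> \<le> card A * (M ^ DIM('a) - 1) ^ k * (M ^ DIM('a) - 1)" using B(2) by (rule mult_right_mono) simp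
    finally show "card (\<Union>c\<in>B. F c) \<le> card A * (M ^ DIM('a) - 1) ^ Suc k" by (simp add: mult_ac)
    show "E \<subseteq> (\<Union>c\<in>(\<Union>c\<in>B. F c). cube c (t / real M ^ Suc k))"
    proof
      fix x assume x: "x \<in> E"
      then obtain c where c: "c \<in> B" "x \<in> cube c (t / real M ^ k)" using B(3) by blast
      then obtain c' where "c' \<in> F c" "x \<in> cube c' (t / real M ^ k / real M)" using F(3)[of c] x by blast
      then show "x \<in> (\<Union>c\<in>(\<Union>c\<in>B. F c). cube c (t / real M ^ Suc k))" using c(1) by (auto simp: mult.commute)
    qed
  qed
qed

lemma hausdorff_premeasure_finite_cover:
  fixes E :: "'a::euclidean_space set" and t :: real
  assumes B: "finite B" "E \<subseteq> (\<Union>c\<in>B. cube c t)" and t: "0 \<le> t" "DIM('a) * t \<le> \<delta>" and \<delta>: "\<delta> > 0" and s: "s > 0"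
  shows "hausdorff_premeasure \<delta> s E \<le> ennreal (card B * (unit_ball_vol s * (DIM('a) * t / 2) powr s))"
proof -
  obtain h where h: "bij_betw h {0..<card B} B" using ex_bij_betw_nat_finite[OF B(1)] by blast
  \<comment> \<open>The finite family is padded with empty sets, which have weight zero, to a
    countable cover.\<close>
  define Q where "Q i = (if i < card B then cube (h i) t else {})" for i
  have bnd: "bounded (cube c t)" for c :: 'a unfolding cube_def by (rule bounded_cbox)
  have dm: "diameter (cube c t) \<le> DIM('a) * t" for c :: 'a
    using t(1) cube_norm_le by (intro diameter_le) auto
  have Q: "bounded (Q i)" "diameter (Q i) \<le> \<delta>" for i
    unfolding Q_def using bnd order_trans[OF dm t(2)] \<delta> by auto
  have sub: "E \<subseteq> (\<Union>i. Q i)"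
  proof
    fix x assume "x \<in> E"
    then obtain c where c: "c \<in> B" "x \<in> cube c t" using B(2) by blast
    then obtain i where "i < card B" "h i = c" using h unfolding bij_betw_def by (metis atLeastLessThan_iff imageE)
    then show "x \<in> (\<Union>i. Q i)" using c(2) unfolding Q_def by auto
  qed
  have v0: "unit_ball_vol s \<ge> 0" using s by simp
  have w: "hausdorff_weight s (Q i) \<le> unit_ball_vol s * (DIM('a) * t / 2) powr s" for i
  proof (cases "i < card B")
    case True
    have "0 \<le> diameter (cube (h i) t)" by (rule diameter_ge_0[OF bnd])
    then have "(diameter (cube (h i) t) / 2) powr s \<le> (DIM('a) * t / 2) powr s"
      using dm[of "h i"] s by (intro powr_mono2) auto
    then show ?thesis using True s v0 unfolding hausdorff_weight_def Q_def by (auto intro: mult_left_mono)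
  next
    case False
    then show ?thesis using v0 unfolding hausdorff_weight_def Q_def by simp
  qed
  have "hausdorff_premeasure \<delta> s E \<le> (\<Sum>i. ennreal (hausdorff_weight s (Q i)))"
    unfolding hausdorff_premeasure_def using sub Q by (intro Inf_lower) blast
  also have "\<dots> = (\<Sum>i<card B. ennreal (hausdorff_weight s (Q i)))"
    by (rule suminf_finite) (auto simp: Q_def hausdorff_weight_def)
  also have "\<dots> \<le> (\<Sum>i<card B. ennreal (unit_ball_vol s * (DIM('a) * t / 2) powr s))"
    by (intro sum_mono ennreal_leI w)
  also have "\<dots> = ennreal (card B * (unit_ball_vol s * (DIM('a) * t / 2) powr s))"
    using v0 by (simp add: ennreal_mult ennreal_of_nat_eq_real_of_nat)
  finally show ?thesis .
qed

text \<open>In generation k there are at most \<open>card A * (M ^ DIM('a) - 1) ^ k\<close> cubes,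
  of side t / M^k. With this exponent \<open>s\<close> the two factors depending on k cancel, so one
  bound \<open>W\<close> holds at every scale.\<close>

lemma porous_hausdorff_measure_finite:
  fixes E :: "'a::euclidean_space set"
  assumes E: "porous \<kappa> r0 E" "bounded E" and \<kappa>: "0 < \<kappa>" "\<kappa> \<le> 1" and r0: "r0 > 0"
    and M: "4 * DIM('a) / \<kappa> < real M" and s: "s > 0" "real M powr s = real (M ^ DIM('a) - 1)"
  shows "hausdorff_measure s E < \<infinity>"
proof -
  have M4: "real M > 4"
  proof -
    have "1 \<le> real DIM('a)" using DIM_ge_Suc0[where 'a='a] by simp
    then have "\<kappa> \<le> real DIM('a)" using \<kappa>(2) by linarith
    then have "4 \<le> 4 * DIM('a) / \<kappa>" using \<kappa>(1) by (simp add: le_divide_eq)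
    then show ?thesis using M by linarith
  qed
  define t where "t = r0"
  have t: "0 < t" "t \<le> 4 * r0" unfolding t_def using r0 by auto
  define K where "K = closure E"
  have K: "compact K" unfolding K_def using E(2) by simp
  \<comment> \<open>Open cubes, so that compactness of the closure yields finitely many initial
    cubes; their corners form \<open>A\<close> below.\<close>
  define N where "N x = box (x - (t / 2) *\<^sub>R One) (x + (t / 2) *\<^sub>R One)" for x :: 'a
  have xN: "x \<in> N x" for x unfolding N_def mem_box using t(1) by (simp add: inner_diff_left inner_add_left)
  obtain A0 where A0: "finite A0" "K \<subseteq> (\<Union>x\<in>A0. N x)"
  proof -
    have "\<And>x. x \<in> K \<Longrightarrow> open (N x)" "K \<subseteq> (\<Union>x\<in>K. N x)" using xN unfolding N_def by auto
    then obtain C' where "C' \<subseteq> K" "finite C'" "K \<subseteq> (\<Union>x\<in>C'. N x)" using compactE_image[OF K] by metis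
    then show ?thesis using that by blast
  qed
  define A where "A = (\<lambda>x. x - (t / 2) *\<^sub>R One) ` A0"
  have A: "finite A" "E \<subseteq> (\<Union>c\<in>A. cube c t)"
  proof -
    show "finite A" unfolding A_def using A0(1) by simp
    have NQ: "N x \<subseteq> cube (x - (t / 2) *\<^sub>R One) t" for x
    proof -
      have "x - (t / 2) *\<^sub>R One + t *\<^sub>R One = x + (t / 2) *\<^sub>R (One::'a)"
        by (simp add: algebra_simps flip: scaleR_add_left)
      then show ?thesis unfolding N_def cube_def using box_subset_cbox by metis
    qed
    show "E \<subseteq> (\<Union>c\<in>A. cube c t)"
    proof
      fix x assume "x \<in> E"
      then have "x \<in> K" using closure_subset unfolding K_def by blast
      then obtain z where "z \<in> A0" "x \<in> N z" using A0(2) by blast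
      then show "x \<in> (\<Union>c\<in>A. cube c t)" using NQ[of z] unfolding A_def by blast
    qed
  qed
  define v where "v = unit_ball_vol s"
  have v: "v \<ge> 0" unfolding v_def using s(1) by simp
  define W where "W = card A * (v * (DIM('a) * t / 2) powr s)"
  have "hausdorff_premeasure \<delta> s E \<le> ennreal W" if \<delta>: "\<delta> > 0" for \<delta>
  proof -
    obtain k where k: "DIM('a) * t / \<delta> < real M ^ k" using real_arch_pow[of "real M"] M4 by auto
    have Mk: "real M ^ k > 0" using M4 by simp
    obtain B where B: "finite B" "card B \<le> card A * (M ^ DIM('a) - 1) ^ k" "E \<subseteq> (\<Union>c\<in>B. cube c (t / real M ^ k))"
      using porous_multiscale_cover[OF E(1) \<kappa> t M A, of k] by blast
    have tk: "0 \<le> t / real M ^ k" "DIM('a) * (t / real M ^ k) \<le> \<delta>"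
    proof -
      show "0 \<le> t / real M ^ k" using t(1) by simp
      have "DIM('a) * t < real M ^ k * \<delta>" using k \<delta> by (simp add: divide_less_eq)
      then show "DIM('a) * (t / real M ^ k) \<le> \<delta>" using Mk by (simp add: divide_le_eq mult.commute)
    qed
    have "hausdorff_premeasure \<delta> s E \<le> ennreal (card B * (v * (DIM('a) * (t / real M ^ k) / 2) powr s))"
      unfolding v_def using tk by (intro hausdorff_premeasure_finite_cover[OF B(1)] B(3) \<delta> s(1)) auto
    also have "\<dots> \<le> ennreal W"
    proof (rule ennreal_leI)
      have e: "(DIM('a) * (t / real M ^ k) / 2) powr s = (DIM('a) * t / 2) powr s / (real (M ^ DIM('a) - 1)) ^ k"
      proof -
        have "(DIM('a) * (t / real M ^ k) / 2) powr s = ((DIM('a) * t / 2) / M ^ k) powr s" by (simp add: field_simps)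
        also have "\<dots> = (DIM('a) * t / 2) powr s / (real M ^ k) powr s"
          by (simp add: powr_divide powr_mult)
        also have "(real M ^ k) powr s = (real M powr s) ^ k"
          using M4 by (simp add: powr_realpow[symmetric] powr_powr mult.commute powr_power)
        finally show ?thesis unfolding s(2) .
      qed
      have n0: "real (M ^ DIM('a) - 1) ^ k > 0"
        unfolding s(2)[symmetric] using M4 by simp
      have "real (card B) \<le> real (card A) * real (M ^ DIM('a) - 1) ^ k" using B(2) by (metis of_nat_le_iff of_nat_mult of_nat_power)
      then have "real (card B) * (v * (DIM('a) * (t / real M ^ k) / 2) powr s)
          \<le> (real (card A) * real (M ^ DIM('a) - 1) ^ k) * (v * (DIM('a) * (t / real M ^ k) / 2) powr s)"
        using v by (intro mult_right_mono) auto
      also have "\<dots> = W"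
      proof -
        have "(c * q) * (v * (X / q)) = c * (v * X)" if "q > 0" for c q X :: real using that by simp
        from this[OF n0] show ?thesis unfolding e W_def .
      qed
      finally show "real (card B) * (v * (DIM('a) * (t / real M ^ k) / 2) powr s) \<le> W" .
    qed
    finally show ?thesis .
  qed
  then have "hausdorff_measure s E \<le> ennreal W"
    unfolding hausdorff_measure_def by (intro SUP_least) auto
  then show ?thesis by (auto intro: le_less_trans)
qed

text \<open>Comparing M^n - 1 with neighbouring powers of M: it lies below M^n, so \<xi> > 0; it is
  at least M^(n-1), so \<xi> \<le> 1; and it exceeds 1, so the dimension n - \<xi> is positive even
  for n = 1.\<close>

lemma porosity_exponent:
  assumes "(M::nat) > 4" "n \<ge> 1"
  defines "\<xi> \<equiv> real n - log M (M ^ n - 1)"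
  shows "0 < \<xi>" "\<xi> \<le> 1" "real n - \<xi> > 0" "real M powr (real n - \<xi>) = real (M ^ n - 1)"
proof -
  have M1: "real M > 1" using assms(1) by simp
  have Mn: "real M ^ n \<ge> real M" using assms(2) M1 by (intro self_le_power) auto
  then have nn: "real M ^ n - 1 > 1" using assms(1) by linarith
  have e: "real (M ^ n - 1) = real M ^ n - 1" using assms(1) by (simp add: of_nat_diff)
  have l: "log M (real M ^ n) = n" using M1 by (simp add: log_nat_power)
  have "log M (real M ^ n - 1) < log M (real M ^ n)" using M1 nn by (intro log_less) auto
  then show "0 < \<xi>" unfolding \<xi>_def l e by simp
  have "real M ^ (n - 1) \<le> real M ^ n - 1"
  proof -
    have "real M ^ n = real M * real M ^ (n - 1)" using assms(2) by (simp flip: power_Suc)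
    moreover have "real M ^ (n - 1) \<ge> 1" using M1 by simp
    moreover have "2 * real M ^ (n - 1) \<le> real M * real M ^ (n - 1)" using assms(1) by (intro mult_right_mono) auto
    ultimately show ?thesis by linarith
  qed
  then have "log M (real M ^ (n - 1)) \<le> log M (real M ^ n - 1)" 
    using M1 nn by (subst log_le_cancel_iff) auto
  then have "real (n - 1) \<le> log M (real M ^ n - 1)" using M1 by (simp add: log_nat_power)
  then show "\<xi> \<le> 1" unfolding \<xi>_def e using assms(2) by simp
  have "log M (real M ^ n - 1) > 0" using M1 nn by simp
  then show "real n - \<xi> > 0" unfolding \<xi>_def e by simp
  show "real M powr (real n - \<xi>) = real (M ^ n - 1)"
    unfolding \<xi>_def e using M1 nn by simp
qed

section \<open>Porosity of the free boundary, and the choice of the exponent\<close>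

section \<open>The free boundary\<close>

text \<open>The infimum is attained, since every difference quotient is a lower bound for all
  admissible constants. This allows \<xi> to be evaluated at \<open>Lip\<close> itself.\<close>

lemma Lip_lipschitz_on:
  assumes "C-lipschitz_on S g" shows "(Lip S g)-lipschitz_on S g"
proof -
  have ne: "{C. C-lipschitz_on S g} \<noteq> {}" using assms by auto
  show ?thesis
  proof (rule lipschitz_onI)
    show "0 \<le> Lip S g"
      unfolding Lip_def by (rule cInf_greatest[OF ne]) (auto dest: lipschitz_on_nonneg)
    fix x y assume xy: "x \<in> S" "y \<in> S"
    show "dist (g x) (g y) \<le> Lip S g * dist x y"
    proof (cases "x = y")
      case False
      have "dist (g x) (g y) / dist x y \<le> Lip S g"
        unfolding Lip_def
      proof (rule cInf_greatest[OF ne])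
        fix D assume "D \<in> {C. C-lipschitz_on S g}"
        then have "dist (g x) (g y) \<le> D * dist x y" using lipschitz_onD xy by blast
        then show "dist (g x) (g y) / dist x y \<le> D" using False by (simp add: divide_le_eq)
      qed
      then show ?thesis using False by (simp add: divide_le_eq)
    qed simp
  qed
qed

text \<open>The positivity set is open and hence disjoint from its frontier, so any ball inside it
  is a hole of the free boundary.\<close>

lemma free_boundary_porous:
  fixes w :: "'a::euclidean_space \<Rightarrow> real"
  assumes op: "open \<Omega>" and c: "continuous_on \<Omega> w"
    and lip: "\<And>x y z R. ball z R \<subseteq> \<Omega> \<Longrightarrow> x \<in> ball z R \<Longrightarrow> y \<in> ball z R \<Longrightarrow> \<bar>w x - w y\<bar> \<le> K * norm (x - y)" and K: "K \<ge> 1"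
    and nd: "\<And>y r. cball y r \<subseteq> \<Omega> \<Longrightarrow> r > 0 \<Longrightarrow> w y > 0 \<Longrightarrow> \<exists>x\<in>cball y r. w x \<ge> r / 2"
    and r0: "r0 > 0" "\<And>x. x \<in> B \<Longrightarrow> ball x (2 * r0) \<subseteq> \<Omega>"
  shows "porous (1 / (8 * K)) r0 (frontier {x \<in> \<Omega>. w x > 0} \<inter> B)"
  unfolding porous_def
proof (intro ballI allI impI)
  let ?P = "{x \<in> \<Omega>. w x > 0}"
  have "open (w -` {0<..} \<inter> \<Omega>)"
    using continuous_on_open_vimage[OF op] c open_greaterThan by blast
  moreover have "w -` {0<..} \<inter> \<Omega> = ?P" by auto
  ultimately have oP: "open ?P" by simp
  fix x r assume x: "x \<in> frontier ?P \<inter> B" and "0 < r \<and> r \<le> r0"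
  then have r: "0 < r" "r \<le> r0" by auto
  have bx: "ball x (2 * r0) \<subseteq> \<Omega>" using r0(2) x by blast
  have "x \<in> closure ?P" using x by (simp add: frontier_def)
  then obtain y where y: "y \<in> ?P" "dist y x < r / 4" using r(1) unfolding closure_approachable by (metis zero_less_divide_iff zero_less_numeral)
  have "cball y (r / 4) \<subseteq> ball x (2 * r0)"
  proof
    fix z assume "z \<in> cball y (r / 4)"
    then show "z \<in> ball x (2 * r0)" using dist_triangle[of x z y] y(2) r by (simp add: dist_commute)
  qed
  then have "cball y (r / 4) \<subseteq> \<Omega>" using bx by (rule order_trans)
  then obtain z where z: "z \<in> cball y (r / 4)" "w z \<ge> r / 4 / 2"
    using nd[of y "r / 4"] y(1) r(1) by auto
  have xz: "dist x z < r / 2" using dist_triangle[of x z y] y(2) z(1) by (simp add: dist_commute)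
  \<comment> \<open>The value at \<open>z\<close> is at least r/8, and a Lipschitz function loses
    less than that within r / (8 K). With K at least 1 this ball lies within r/2 + r/8 of
    \<open>x\<close>, well inside the ball of radius 2 r0 on which the Lipschitz bound
    holds.\<close>
  have small: "1 / (8 * K) * r \<le> r / 8" using K r(1) by (simp add: divide_simps mult_le_cancel_left)
  have "ball z (1 / (8 * K) * r) \<subseteq> ?P"
  proof
    fix t assume t: "t \<in> ball z (1 / (8 * K) * r)"
    have "dist x t \<le> dist x z + dist z t" by (rule dist_triangle)
    then have tx: "t \<in> ball x (2 * r0)" using xz t small r by simp
    have zx: "z \<in> ball x (2 * r0)" using xz r by simp
    have "\<bar>w z - w t\<bar> \<le> K * norm (z - t)" by (rule lip[OF bx zx tx])
    also have "\<dots> < K * (1 / (8 * K) * r)" using t K by (intro mult_strict_left_mono) (auto simp: dist_norm)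
    also have "\<dots> = r / 8" using K by simp
    finally have "w t > 0" using z(2) by linarith
    then show "t \<in> ?P" using tx bx by blast
  qed
  moreover have "?P \<inter> frontier ?P = {}" using oP by (simp add: frontier_def interior_open)
  ultimately have "ball z (1 / (8 * K) * r) \<inter> (frontier ?P \<inter> B) = {}" by blast
  then show "\<exists>z. dist x z < r \<and> ball z (1 / (8 * K) * r) \<inter> (frontier ?P \<inter> B) = {}"
    using xz r(1) by (intro exI[of _ z]) simp
qed

theorem theorem7p3:
  shows "\<exists>\<xi> :: real \<Rightarrow> real.
    (\<forall>L\<ge>0. 0 < \<xi> L \<and> \<xi> L \<le> 1) \<and>
    (\<forall>(\<Omega> :: (real ^ 'n) set) (lam0 :: real ^ 'n \<Rightarrow> real) (g :: real ^ 'n \<Rightarrow> real)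
      (p :: nat \<Rightarrow> real) (u :: nat \<Rightarrow> real ^ 'n \<Rightarrow> real) (u_inf :: real ^ 'n \<Rightarrow> real).
      regular_domain \<Omega> \<longrightarrow> bounded \<Omega> \<longrightarrow> closure (ball 0 (1/2)) \<subseteq> \<Omega> \<longrightarrow>
      set_borel_measurable lebesgue \<Omega> lam0 \<longrightarrow>
      (\<exists>m M. 0 < m \<and> (\<forall>x\<in>\<Omega>. m \<le> lam0 x \<and> lam0 x \<le> M)) \<longrightarrow>
      (\<exists>C. C-lipschitz_on (frontier \<Omega>) g) \<longrightarrow>
      (\<forall>k. 1 < p k) \<longrightarrow> filterlim p at_top sequentially \<longrightarrow>
      (\<forall>k. weak_solution (p k) \<Omega> lam0 g (u k) \<and> continuous_on \<Omega> (u k)) \<longrightarrow>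
      uniform_limit \<Omega> u u_inf sequentially \<longrightarrow>
      hausdorff_measure (real CARD('n) - \<xi> (Lip (frontier \<Omega>) g))
        (frontier {x \<in> \<Omega>. u_inf x > 0} \<inter> ball 0 (1/2)) < \<infinity>)"
proof -
  define n where "n = CARD('n)"
  have n: "n \<ge> 1" "DIM(real ^ 'n) = n" unfolding n_def by (simp_all add: Suc_leI)
  define K where "K L = real n * (3 * L + 2) + L" for L :: real
  have K: "K L \<ge> 1" if "L \<ge> 0" for L
  proof -
    have "1 * 2 \<le> real n * (3 * L + 2)" using n(1) that by (intro mult_mono) auto
    then show ?thesis unfolding K_def using that by simp
  qed
  \<comment> \<open>With \<kappa> = 1 / (8 K) the subdivision requirement M > 4 n / \<kappa> reads M
    > 32 n K; the summand 5 gives strictness and M > 4. Only the dimension and L enter.\<close>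
  define M where "M L = nat \<lceil>32 * real n * K L\<rceil> + 5" for L
  define \<xi> where "\<xi> L = real n - log (M L) (M L ^ n - 1)" for L
  have M: "M L > 4" for L unfolding M_def by simp
  note \<xi> = porosity_exponent[OF M n(1), folded \<xi>_def]
  show ?thesis
  proof (intro exI[of _ \<xi>] conjI allI impI)
    show "0 < \<xi> L" "\<xi> L \<le> 1" for L by (rule \<xi>(1), rule \<xi>(2))
    fix \<Omega> :: "(real ^ 'n) set" and lam0 g :: "real ^ 'n \<Rightarrow> real" and p :: "nat \<Rightarrow> real"
      and u :: "nat \<Rightarrow> real ^ 'n \<Rightarrow> real" and u_inf :: "real ^ 'n \<Rightarrow> real"
    assume reg: "regular_domain \<Omega>" and bd: "bounded \<Omega>" and half: "closure (ball 0 (1/2)) \<subseteq> \<Omega>"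
      and lamm: "set_borel_measurable lebesgue \<Omega> lam0"
      and lamb: "\<exists>m M. 0 < m \<and> (\<forall>x\<in>\<Omega>. m \<le> lam0 x \<and> lam0 x \<le> M)"
      and gl: "\<exists>C. C-lipschitz_on (frontier \<Omega>) g"
      and p: "\<forall>k. 1 < p k" "filterlim p at_top sequentially"
      and u: "\<forall>k. weak_solution (p k) \<Omega> lam0 g (u k) \<and> continuous_on \<Omega> (u k)"
      and lim: "uniform_limit \<Omega> u u_inf sequentially"
    define L where "L = Lip (frontier \<Omega>) g"
    have op: "open \<Omega>" "\<Omega> \<noteq> {}" using reg unfolding regular_domain_def by auto
    have sl: "\<Omega> \<in> sets lebesgue" using op(1) by auto
    \<comment> \<open>Only the empty set and the whole space have empty frontier; a nonempty
      frontier is needed to extend \<open>g\<close> from it.\<close>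
    have "\<Omega> \<noteq> UNIV" using bd not_bounded_UNIV by metis
    then have fr: "frontier \<Omega> \<noteq> {}" using op(2) by (metis frontier_eq_empty)
    have g: "L-lipschitz_on (frontier \<Omega>) g" unfolding L_def using gl Lip_lipschitz_on by blast
    have L0: "L \<ge> 0" using g by (rule lipschitz_on_nonneg)
    obtain m b where m: "0 < m" "\<And>x. x \<in> \<Omega> \<Longrightarrow> m \<le> lam0 x" "\<And>x. x \<in> \<Omega> \<Longrightarrow> lam0 x \<le> b" using lamb by blast
    have lm: "lam0 \<in> borel_measurable (lebesgue_on \<Omega>)"
      using lamm set_integral_lebesgue_on(3)[OF sl] by blast
    have abs: "\<bar>lam0 x\<bar> \<le> max 0 b" if "x \<in> \<Omega>" for x using m(1) m(2,3)[OF that] by simp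
    have b0: "max 0 b \<ge> 0" by simp
    have p1: "\<And>k. 1 < p k" and u1: "\<And>k. weak_solution (p k) \<Omega> lam0 g (u k)" and u2: "\<And>k. continuous_on \<Omega> (u k)"
      using p u by blast+
    have uc: "continuous_on \<Omega> u_inf"
      by (rule uniform_limit_theorem[OF _ lim]) (use u2 in auto)
    have lip: "\<bar>u_inf x - u_inf y\<bar> \<le> K L * norm (x - y)" if "ball z R \<subseteq> \<Omega>" "x \<in> ball z R" "y \<in> ball z R" for x y z R
      using limit_lipschitz[OF op(1) bd op(2) fr g lm abs b0 p1 p(2) u1 u2 lim that] unfolding K_def n(2) .
    have nd: "\<exists>x\<in>cball y r. u_inf x \<ge> r / 2" if "cball y r \<subseteq> \<Omega>" "r > 0" "u_inf y > 0" for y r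
      by (rule limit_nondegeneracy[OF op(1) bd op(2) lm m(2,3,1) p1 p(2) u1 u2 lim that])
    have "compact (closure (ball (0::real ^ 'n) (1/2)))" by simp
    then obtain d where d: "d > 0" "(\<Union>x\<in>closure (ball 0 (1/2)). ball x d) \<subseteq> \<Omega>"
      by (rule compact_subset_open_imp_ball_epsilon_subset[OF _ op(1) half])
    \<comment> \<open>Half of the margin around the closed ball, so that balls of radius 2 r0 about
      its points remain in \<Omega>.\<close>
    define r0 where "r0 = d / 2"
    have r0: "ball x (2 * r0) \<subseteq> \<Omega>" if "x \<in> ball 0 (1/2)" for x
    proof -
      have "x \<in> closure (ball 0 (1/2))" using that closure_subset by blast
      then have "ball x d \<subseteq> \<Omega>" using d(2) by blast
      then show "ball x (2 * r0) \<subseteq> \<Omega>" unfolding r0_def by simp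
    qed
    have r00: "r0 > 0" unfolding r0_def using d(1) by simp
    let ?E = "frontier {x \<in> \<Omega>. u_inf x > 0} \<inter> ball 0 (1/2)"
    have por: "porous (1 / (8 * K L)) r0 ?E"
      by (rule free_boundary_porous[OF op(1) uc lip K[OF L0] nd r00 r0])
    have bE: "bounded ?E" using bounded_subset[OF bounded_ball] by blast
    have k1: "0 < 1 / (8 * K L)" "1 / (8 * K L) \<le> 1" using K[OF L0] by auto
    have Mbig: "real (4 * DIM(real ^ 'n)) / (1 / (8 * K L)) < real (M L)"
      unfolding n(2) M_def by simp linarith
    show "hausdorff_measure (real CARD('n) - \<xi> (Lip (frontier \<Omega>) g)) ?E < \<infinity>"
      unfolding L_def[symmetric] n_def[symmetric]
      by (rule porous_hausdorff_measure_finite[OF por bE k1 r00 Mbig \<xi>(3)]) (use \<xi>(4) n(2) in simp)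
  qed
qed

end
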